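(* Let $N\ge2$ be an integer, and let $\nu>0$ and $Pr>0$ be constants. The EQMOM moment system of the 1-D Boltzmann equation with the Shakhov model, $$\partial_tM+A(M)\,\partial_xM=\nu S^{Sh}(M),\qquad S^{Sh}(M)=\rho\big(\Delta_0^S,\Delta_1^S,\dots,\Delta_{2N}^S\big)^T-M,\qquad M\in\mathbb{G}=\mathcal{M}(\Omega_W),$$ satisfies the structural stability condition.
   Context: Notation. $\Delta_j(u,\vartheta)$ denotes the $j$th moment $\int_{\mathbb R}\xi^j\frac{1}{\sqrt{2\pi\vartheta}}e^{-(\xi-u)^2/(2\vartheta)}d\xi$ of the Gaussian with mean $u$ and variance $\vartheta>0$; it is a polynomial in $u$ and $\vartheta$. EQMOM with $N$ nodes. For $W=(w_1,u_1,\dots,w_N,u_N,\sigma^2)^T\in\mathbb{R}^{2N+1}$ let $\mathcal{M}(W)=(M_0,\dots,M_{2N})^T$ with $M_j=\sum_{i=1}^N w_i\Delta_j(u_i,\sigma^2)$. The domain is $\Omega_W=\Omega_W^{open}\cup\Omega_W^{eq}$, where $\Omega_W^{open}=\{W: w_i>0,\ \sigma^2>0,\ u_i\ne u_j\ \forall i\ne j\}$ and $\Omega_W^{eq}=\{W: w_i>0,\ \sigma^2>0,\ u_1=\dots=u_N\}$. Macroscopic parameters and Shakhov source. Given $M=(M_0,\dots,M_{2N})^T$, define $\rho,U,\theta,q$ by $M_0=\rho$, $M_1=\rho U$, $M_2=\rho(U^2+\theta)$, $M_3=\rho(U^3+3U\theta)+2q$. With the Prandtl number $Pr$, let $$f_{eq}(\xi)=\frac{\rho}{\sqrt{2\pi\theta}}e^{-(\xi-U)^2/(2\theta)},\qquad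 f_S(\xi)=f_{eq}(\xi)\Big(1+\frac{(1-Pr)\,q\,(\xi-U)}{3\rho\theta^2}\Big(\frac{(\xi-U)^2}{\theta}-3\Big)\Big),$$ and $\Delta_j^S=\frac1\rho\int_{\mathbb R}\xi^jf_S(\xi)\,d\xi$. Coefficient matrix. $A(M)$ is the $(2N+1)\times(2N+1)$ matrix whose entries in position $(k,k+1)$ equal $1$ for $1\le k\le 2N$, whose last row is $(a_0,\dots,a_{2N})$, and whose other entries are zero. For $M\in\mathcal{M}(\Omega_W^{open})$, $M$ determines $W\in\Omega_W^{open}$ up to relabeling the pairs $(w_i,u_i)$, so $\bar M_{2N+1}=\sum_{i=1}^Nw_i\Delta_{2N+1}(u_i,\sigma^2)$ is a (smooth) function of $M$, and $a_j=\partial\bar M_{2N+1}/\partial M_j$. For $M\in\mathcal{M}(\Omega_W^{eq})$, i.e. $M_j=\rho\Delta_j(U,\theta)$ with $\theta=\sigma^2$, the $a_j$ are defined (by continuous extension) through $$u^{2N+1}-a_{2N}u^{2N}-\dots-a_1u-a_0=\sum_{k\ge0}\frac{1}{k!}\Big(-\frac{\sigma^2}{2}\Big)^k\frac{d^{2k}}{du^{2k}}(u-U)^{2N+1}.$$ Structural stability condition. Consider a system $\partial_tM+A(M)\partial_xM=Q(M)$ with $M\in\mathbb{G}\subset\mathbb{R}^n$, equilibrium manifold $\mathcal{E}=\{M\in\mathbb{G}:Q(M)=0\}\neq\emptyset$, and Jacobian $Q_M=\partial Q/\partial M$ (here $n=2N+1$, $Q=\nu S^{Sh}$; the formula for $S^{Sh}$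 is smooth on an open neighborhood of $\mathbb{G}$, where $Q_M$ is computed). The condition requires that there is an integer $r$ with $0<r\le n$ such that: (i) there exist an invertible $n\times n$ matrix $P(M)$ and an invertible $r\times r$ matrix $\hat T(M)$ with $P(M)Q_M(M)=\begin{bmatrix}0&0\\0&\hat T(M)\end{bmatrix}P(M)$ for all $M\in\mathcal{E}$; (ii) there exists a symmetric positive definite matrix $A_0(M)$ with $A_0(M)A(M)=A(M)^TA_0(M)$ for all $M\in\mathbb{G}$; (iii) with these same $A_0$ and $P$, $A_0(M)Q_M(M)+Q_M(M)^TA_0(M)\le -P(M)^T\begin{bmatrix}0&0\\0&I_r\end{bmatrix}P(M)$ for all $M\in\mathcal{E}$, where $\le$ is the order of symmetric matrices and $I_r$ is the identity of order $r$. *)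

theory Defs
  imports
    "HOL-Probability.Distributions"
    "HOL-Computational_Algebra.Polynomial"
    "Jordan_Normal_Form.Matrix"
begin

unbundle no vec_syntax
no_notation inner (infix \<open>\<bullet>\<close> 70)

section \<open>The structural stability condition\<close>

definition positive_definite :: "nat \<Rightarrow> real mat \<Rightarrow> bool" where
  "positive_definite n A \<longleftrightarrow> A \<in> carrier_mat n n \<and> A\<^sup>T = A \<and>
     (\<forall>v \<in> carrier_vec n. v \<noteq> 0\<^sub>v n \<longrightarrow> 0 < v \<bullet> (A *\<^sub>v v))"

definition positive_semidefinite :: "nat \<Rightarrow> real mat \<Rightarrow> bool" where
  "positive_semidefinite n A \<longleftrightarrow> A \<in> carrier_mat n n \<and> A\<^sup>T = A \<and>
     (\<forall>v \<in> carrier_vec n. 0 \<le> v \<bullet> (A *\<^sub>v v))"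

text \<open>The order of symmetric matrices; the library's \<open>\<le>\<close> on matrices is entrywise.\<close>

definition symmetric_le :: "nat \<Rightarrow> real mat \<Rightarrow> real mat \<Rightarrow> bool" where
  "symmetric_le n A B \<longleftrightarrow> positive_semidefinite n (B - A)"

definition lower_block :: "nat \<Rightarrow> nat \<Rightarrow> real mat \<Rightarrow> real mat" where
  "lower_block n r T =
     four_block_mat (0\<^sub>m (n - r) (n - r)) (0\<^sub>m (n - r) r) (0\<^sub>m r (n - r)) T"

text \<open>\<open>Q\<close> is a total function, so the partial derivatives below do not refer to the state
  space \<open>G\<close>, which need not be a neighbourhood of its points.\<close>

definition jacobian :: "nat \<Rightarrow> (real vec \<Rightarrow> real vec) \<Rightarrow> real vec \<Rightarrow> real mat" where
  "jacobian n Q M = mat n n (\<lambda>(i, j). deriv (\<lambda>t. Q (M |\<^sub>v j \<mapsto> t) $ i) (M $ j))"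

definition equilibria :: "nat \<Rightarrow> real vec set \<Rightarrow> (real vec \<Rightarrow> real vec) \<Rightarrow> real vec set" where
  "equilibria n G Q = {M \<in> G. Q M = 0\<^sub>v n}"

definition structural_stability_condition ::
  "nat \<Rightarrow> real vec set \<Rightarrow> (real vec \<Rightarrow> real mat) \<Rightarrow> (real vec \<Rightarrow> real vec) \<Rightarrow> bool" where
  "structural_stability_condition n G A Q \<longleftrightarrow>
     equilibria n G Q \<noteq> {} \<and>
     (\<exists>r P T A0. 0 < r \<and> r \<le> n \<and>
        (\<forall>M \<in> equilibria n G Q.
           P M \<in> carrier_mat n n \<and> invertible_mat (P M) \<and>
           T M \<in> carrier_mat r r \<and> invertible_mat (T M) \<and>
           P M * jacobian n Q M = lower_block n r (T M) * P M) \<and>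
        (\<forall>M \<in> G. positive_definite n (A0 M) \<and> A0 M * A M = (A M)\<^sup>T * A0 M) \<and>
        (\<forall>M \<in> equilibria n G Q.
           symmetric_le n (A0 M * jacobian n Q M + (jacobian n Q M)\<^sup>T * A0 M)
             (- ((P M)\<^sup>T * lower_block n r (1\<^sub>m r) * P M))))"


section \<open>EQMOM with \<open>N\<close> nodes\<close>

text \<open>The second parameter of \<^const>\<open>normal_density\<close> is the standard deviation.\<close>

definition gauss_moment :: "nat \<Rightarrow> real \<Rightarrow> real \<Rightarrow> real" where
  "gauss_moment j u \<theta> = (LINT \<xi>|lborel. \<xi> ^ j * normal_density u (sqrt \<theta>) \<xi>)"

text \<open>A parameter vector is \<open>(w\<^sub>1, u\<^sub>1, \<dots>, w\<^sub>N, u\<^sub>N, \<sigma>\<^sup>2)\<close>; the nodes are numbered from \<open>0\<close>.\<close>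

definition weight :: "real vec \<Rightarrow> nat \<Rightarrow> real" where
  "weight W i = W $ (2 * i)"

definition node :: "real vec \<Rightarrow> nat \<Rightarrow> real" where
  "node W i = W $ (2 * i + 1)"

definition variance_param :: "nat \<Rightarrow> real vec \<Rightarrow> real" where
  "variance_param N W = W $ (2 * N)"

definition eqmom_moment :: "nat \<Rightarrow> real vec \<Rightarrow> nat \<Rightarrow> real" where
  "eqmom_moment N W j =
     (\<Sum>i<N. weight W i * gauss_moment j (node W i) (variance_param N W))"

definition moment_map :: "nat \<Rightarrow> real vec \<Rightarrow> real vec" where
  "moment_map N W = vec (2 * N + 1) (eqmom_moment N W)"

definition Omega_open :: "nat \<Rightarrow> real vec set" where
  "Omega_open N = {W \<in> carrier_vec (2 * N + 1).
     (\<forall>i<N. weight W i > 0) \<and> variance_param N W > 0 \<and>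
     (\<forall>i<N. \<forall>j<N. i \<noteq> j \<longrightarrow> node W i \<noteq> node W j)}"

definition Omega_eq :: "nat \<Rightarrow> real vec set" where
  "Omega_eq N = {W \<in> carrier_vec (2 * N + 1).
     (\<forall>i<N. weight W i > 0) \<and> variance_param N W > 0 \<and>
     (\<forall>i<N. \<forall>j<N. node W i = node W j)}"

definition Omega :: "nat \<Rightarrow> real vec set" where
  "Omega N = Omega_open N \<union> Omega_eq N"


section \<open>Macroscopic parameters and the Shakhov source\<close>

text \<open>These solve \<open>M\<^sub>0 = \<rho>\<close>, \<open>M\<^sub>1 = \<rho> U\<close>, \<open>M\<^sub>2 = \<rho> (U\<^sup>2 + \<theta>)\<close>, \<open>M\<^sub>3 = \<rho> (U\<^sup>3 + 3 U \<theta>) + 2 q\<close>.\<close>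

definition mass_density :: "real vec \<Rightarrow> real" where
  "mass_density M = M $ 0"

definition velocity :: "real vec \<Rightarrow> real" where
  "velocity M = M $ 1 / mass_density M"

definition temperature :: "real vec \<Rightarrow> real" where
  "temperature M = M $ 2 / mass_density M - (velocity M)\<^sup>2"

definition heat_flux :: "real vec \<Rightarrow> real" where
  "heat_flux M =
     (M $ 3 - mass_density M * ((velocity M) ^ 3 + 3 * velocity M * temperature M)) / 2"

definition f_eq :: "real vec \<Rightarrow> real \<Rightarrow> real" where
  "f_eq M \<xi> = mass_density M * normal_density (velocity M) (sqrt (temperature M)) \<xi>"

definition f_S :: "real \<Rightarrow> real vec \<Rightarrow> real \<Rightarrow> real" where
  "f_S Pr M \<xi> = f_eq M \<xi> *
     (1 + (1 - Pr) * heat_flux M * (\<xi> - velocity M) / (3 * mass_density M * (temperature M)\<^sup>2)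
          * ((\<xi> - velocity M)\<^sup>2 / temperature M - 3))"

definition Shakhov_moment :: "real \<Rightarrow> real vec \<Rightarrow> nat \<Rightarrow> real" where
  "Shakhov_moment Pr M j = 1 / mass_density M * (LINT \<xi>|lborel. \<xi> ^ j * f_S Pr M \<xi>)"

definition Shakhov_source :: "nat \<Rightarrow> real \<Rightarrow> real vec \<Rightarrow> real vec" where
  "Shakhov_source N Pr M =
     mass_density M \<cdot>\<^sub>v vec (2 * N + 1) (Shakhov_moment Pr M) - M"


section \<open>The coefficient matrix\<close>

text \<open>On the image of \<^term>\<open>Omega_open N\<close>, the parameters \<open>W\<close> are determined up to relabeling of
  the nodes, so the choice of \<open>W\<close> does not affect the value.\<close>

definition M_bar :: "nat \<Rightarrow> real vec \<Rightarrow> real" where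
  "M_bar N M =
     eqmom_moment N (SOME W. W \<in> Omega_open N \<and> moment_map N W = M) (2 * N + 1)"

text \<open>The sum over all \<open>k \<ge> 0\<close> stops at \<open>N\<close>: the later derivatives of \<open>(u - U)\<^bsup>2N+1\<^esup>\<close> vanish.
  On the image of \<^term>\<open>Omega_eq N\<close>, \<open>\<sigma>\<^sup>2\<close> is the temperature.\<close>

definition equilibrium_poly :: "nat \<Rightarrow> real vec \<Rightarrow> real poly" where
  "equilibrium_poly N M =
     (\<Sum>k\<le>N. Polynomial.smult (1 / fact k * (- temperature M / 2) ^ k)
        ((pderiv ^^ (2 * k)) ([:- velocity M, 1:] ^ (2 * N + 1))))"

text \<open>The images of \<^term>\<open>Omega_open N\<close> and \<^term>\<open>Omega_eq N\<close> are disjoint for \<open>N \<ge> 2\<close>. The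
  image of \<^term>\<open>Omega_open N\<close> is open, so the partial derivative does not depend on the values
  of \<^const>\<open>M_bar\<close> elsewhere. The second case is only relevant on the image of
  \<^term>\<open>Omega_eq N\<close>.\<close>

definition closure_coeff :: "nat \<Rightarrow> real vec \<Rightarrow> nat \<Rightarrow> real" where
  "closure_coeff N M j =
     (if M \<in> moment_map N ` Omega_open N
      then deriv (\<lambda>t. M_bar N (M |\<^sub>v j \<mapsto> t)) (M $ j)
      else - Polynomial.coeff (equilibrium_poly N M) j)"

definition coeff_matrix :: "nat \<Rightarrow> real vec \<Rightarrow> real mat" where
  "coeff_matrix N M = mat (2 * N + 1) (2 * N + 1)
     (\<lambda>(i, j). if i = 2 * N then closure_coeff N M j else if j = i + 1 then 1 else 0)"

end

theory Submission
  imports Defs "Jordan_Normal_Form.Determinant"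
begin

text \<open>
Gaussian smoothing of variance \<open>s\<close> acts on polynomials as \<open>heat s = exp ((s/2) D\<^sup>2)\<close>. The EQMOM moments
are thus the values of the functional \<open>\<langle>p\<rangle> = (\<Sum>i. w\<^sub>i (heat \<sigma>\<^sup>2 p)(u\<^sub>i))\<close>, and \<open>A(M)\<close> is the companion
matrix of a monic polynomial \<open>c\<close> of degree \<open>2N + 1\<close>. What has to be found is a symmetrizer of this
matrix, and at equilibria one that also controls the linearised source.

Suppose first that \<open>M\<close> comes from distinct nodes. By the chain rule, \<open>c\<close> is characterised by the vanishing
of all partial derivatives of \<open>\<langle>c\<rangle>\<close> in the parameters. For \<open>g = heat \<sigma>\<^sup>2 c\<close> this means
\<open>g(u\<^sub>i) = g'(u\<^sub>i) = 0\<close> and \<open>(\<Sum>i. w\<^sub>i g''(u\<^sub>i)) = 0\<close>, so that \<open>g = (x - v) (\<Prod>i. (x - u\<^sub>i)\<^sup>2)\<close> with a real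
number \<open>v\<close> (\<open>exists_critical_poly\<close>, \<open>closure_coeff_eq\<close>). Hence \<open>c = heat (- \<sigma>\<^sup>2) g\<close> is the backward heat
flow of a polynomial with only real roots, and such a flow has simple real roots
(\<open>real_simple_roots_heat_root_poly\<close>). So \<open>A(M)\<close> is diagonalisable over the reals, and its left eigenvectors
give a symmetrizer (\<open>companion_symmetrizer\<close>).

The chain rule needs two facts about the moment map. The closing moment must be a function of \<open>M\<close>: this is
\<open>same_moments_mixture_mean\<close>, which tests two mixtures with the squared nodal polynomial of one of them. And
nearby moment vectors must come from nearby parameters: this is \<open>local_solvability\<close>, an inverse function
theorem whose hypothesis is \<open>mixture_partial_injective\<close>.

At an equilibrium the heat flux vanishes and \<open>M\<close> consists of the moments of a Gaussian with mean \<open>U\<close> and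
variance \<open>\<theta>\<close> (\<open>equilibria_gaussian\<close>). Such an \<open>M\<close> does not come from distinct nodes
(\<open>Omega_images_disjoint\<close>), so \<open>c\<close> is the Hermite polynomial of degree \<open>2N + 1\<close> for this Gaussian. Let the
rows of \<open>P\<close> hold the coefficients of the orthonormal Hermite polynomials of degree at most \<open>2N\<close>. By the
three-term recurrence, \<open>P\<close> conjugates \<open>A(M)\<close> to a symmetric tridiagonal matrix
(\<open>hermite_mat_mult_companion\<close>). It also conjugates the Jacobian of the source to the diagonal matrix with
entries \<open>0, 0, 0, - \<nu> Pr, - \<nu>, \<dots>, - \<nu>\<close> (\<open>hermite_mat_mult_jacobian\<close>): mass, momentum and energy are conserved,
and the Shakhov model relaxes only the heat flux at a rate of its own. Thus \<open>r = 2N - 2\<close>, and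
\<open>A\<^sub>0 = \<kappa> P\<^sup>T P\<close> with \<open>\<kappa> = 1 / (2 \<nu> min Pr 1)\<close> meets all three requirements at once.\<close>

hide_const (open) Module.smult

section \<open>The heat operator on polynomials\<close>

text \<open>The operator \<open>exp ((s/2) D\<^sup>2)\<close>, which runs the heat equation for the time \<open>s\<close>. Negative times are
meaningful on polynomials and undo the flow. Derivatives beyond the degree vanish, so the sum may
stop there.\<close>

definition heat :: "real \<Rightarrow> real poly \<Rightarrow> real poly" where
  "heat s p = (\<Sum>k\<le>degree p. smult ((s / 2) ^ k / fact k) ((pderiv ^^ (2 * k)) p))"

lemma higher_pderiv_eq_0: "degree p < m \<Longrightarrow> (pderiv ^^ m) (p :: real poly) = 0"
proof (induction m arbitrary: p)
  case (Suc m)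
  show ?case
  proof (cases "degree p = 0")
    case True
    then obtain a where "p = [:a:]" by (metis degree_eq_zeroE)
    have "(pderiv ^^ m) (0 :: real poly) = 0" for m by (induction m) auto
    then show ?thesis using \<open>p = [:a:]\<close> by (simp add: funpow_swap1 pderiv_pCons)
  next
    case False
    then show ?thesis using Suc by (simp add: funpow_Suc_right del: funpow.simps) (simp add: degree_pderiv)
  qed
qed simp

text \<open>Polynomials of different degrees can share one truncation of the exponential series.\<close>

lemma heat_eq_sum:
  assumes "degree p < 2 * K + 2"
  shows "heat s p = (\<Sum>k\<le>K. smult ((s / 2) ^ k / fact k) ((pderiv ^^ (2 * k)) p))"
proof -
  have "(\<Sum>k\<le>K. smult ((s / 2) ^ k / fact k) ((pderiv ^^ (2 * k)) p)) =
      (\<Sum>k\<le>max K (degree p). smult ((s / 2) ^ k / fact k) ((pderiv ^^ (2 * k)) p))"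
    using assms by (intro sum.mono_neutral_left) (auto simp: higher_pderiv_eq_0)
  moreover have "heat s p =
      (\<Sum>k\<le>max K (degree p). smult ((s / 2) ^ k / fact k) ((pderiv ^^ (2 * k)) p))"
    unfolding heat_def
    by (intro sum.mono_neutral_left) (auto simp: higher_pderiv_eq_0)
  ultimately show ?thesis by simp
qed

lemma higher_pderiv_add: "(pderiv ^^ m) (p + q :: real poly) = (pderiv ^^ m) p + (pderiv ^^ m) q"
  by (induction m arbitrary: p q) (auto simp: pderiv_add)

lemma higher_pderiv_smult: "(pderiv ^^ m) (smult c p :: real poly) = smult c ((pderiv ^^ m) p)"
  by (induction m arbitrary: p) (auto simp: pderiv_smult)

lemma smult_sum_right: "smult c (sum f A) = (\<Sum>k\<in>A. smult c (f k :: real poly))"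
  by (induction A rule: infinite_finite_induct) (auto simp: smult_add_right)

lemma heat_add: "heat s (p + q) = heat s p + heat s q"
proof -
  define K where "K = max (degree p) (degree q)"
  have "degree (p + q) \<le> K" unfolding K_def by (rule degree_add_le_max)
  then show ?thesis
    by (subst (1 2 3) heat_eq_sum[where K = K])
      (auto simp: K_def higher_pderiv_add smult_add_right sum.distrib)
qed

lemma heat_smult: "heat s (smult c p) = smult c (heat s p)"
proof -
  have "degree (smult c p) < 2 * degree p + 2" using degree_smult_le[of c p] by linarith
  then show ?thesis
    by (subst (1 2) heat_eq_sum[where K = "degree p"])
      (auto simp: higher_pderiv_smult smult_sum_right mult.commute)
qed

lemma heat_0 [simp]: "heat s 0 = 0" by (simp add: heat_def)

lemma heat_diff: "heat s (p - q) = heat s p - heat s q"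
  using heat_add[of s "p - q" q] by (simp add: algebra_simps)

lemma heat_sum: "heat s (sum f A) = (\<Sum>i\<in>A. heat s (f i))"
  by (induction A rule: infinite_finite_induct) (auto simp: heat_add)

lemma heat_const [simp]: "heat s [:a:] = [:a:]" by (simp add: heat_def)

lemma heat_1 [simp]: "heat s 1 = 1" using heat_const[of s 1] by (simp add: one_pCons)

lemma heat_pderiv: "heat s (pderiv p) = pderiv (heat s p)"
proof -
  have *: "degree (pderiv p) < 2 * degree p + 2" by (simp add: degree_pderiv)
  have "pderiv (\<Sum>k\<in>A. smult (c k) (f k)) = (\<Sum>k\<in>A. smult (c k) (pderiv (f k)))"
    for A :: "nat set" and c :: "nat \<Rightarrow> real" and f
    by (induction A rule: infinite_finite_induct) (auto simp: pderiv_add pderiv_smult)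
  then show ?thesis using *
    by (subst (1 2) heat_eq_sum[where K = "degree p"]) (auto simp: funpow_swap1)
qed

lemma pderiv_linear_mult: "pderiv ([:-a, 1:] * p :: real poly) = [:-a, 1:] * pderiv p + p"
  unfolding pderiv_mult by (simp add: pderiv_pCons)

lemma higher_pderiv_linear_mult:
  "(pderiv ^^ m) ([:-a, 1:] * p :: real poly) =
     [:-a, 1:] * (pderiv ^^ m) p + smult (of_nat m) ((pderiv ^^ (m - 1)) p)"
proof (induction m)
  case (Suc m)
  show ?case
  proof (cases m)
    case (Suc k)
    have "(pderiv ^^ Suc m) ([:-a, 1:] * p) =
        pderiv ([:-a, 1:] * (pderiv ^^ m) p + smult (of_nat m) ((pderiv ^^ k) p))"
      using Suc.IH Suc by simp
    also have "\<dots> = [:-a, 1:] * pderiv ((pderiv ^^ m) p) + (pderiv ^^ m) p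
        + smult (of_nat m) (pderiv ((pderiv ^^ k) p))"
      by (simp only: pderiv_add pderiv_smult pderiv_linear_mult)
    also have "\<dots> = [:-a, 1:] * (pderiv ^^ Suc m) p + smult (of_nat (Suc m)) ((pderiv ^^ m) p)"
      by (simp only: Suc funpow.simps comp_apply of_nat_Suc smult_add_left smult_1_left add.assoc)
    finally show ?thesis by simp
  qed (simp add: pderiv_linear_mult del: mult_pCons_left)
qed simp

text \<open>Since \<open>[D\<^bsup>2k\<^esup>, x] = 2k D\<^bsup>2k-1\<^esup>\<close>, the commutator of \<open>exp ((s/2) D\<^sup>2)\<close> with multiplication by
\<open>x - a\<close> is \<open>s D exp ((s/2) D\<^sup>2)\<close>. This one rule yields the semigroup law, the Gaussian moments, the
Hermite recurrence and the step from \<open>f\<close> to \<open>(x - a) f - s f'\<close> in the count of real roots.\<close>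

lemma heat_linear_mult:
  "heat s ([:-a, 1:] * p) = [:-a, 1:] * heat s p + smult s (heat s (pderiv p))"
proof -
  define K where "K = degree p"
  define c where "c = (\<lambda>k. (s / 2) ^ k / fact k)"
  have "degree ([:-a, 1:] * p) \<le> degree p + 1"
    using degree_mult_le[of "[:-a, 1:]" p] by simp
  then have "heat s ([:-a, 1:] * p) = (\<Sum>k\<le>Suc K. smult (c k) ((pderiv ^^ (2 * k)) ([:-a, 1:] * p)))"
    unfolding c_def K_def by (intro heat_eq_sum) simp
  also have "\<dots> = [:-a, 1:] * (\<Sum>k\<le>Suc K. smult (c k) ((pderiv ^^ (2 * k)) p)) +
      (\<Sum>k\<le>Suc K. smult (c k * of_nat (2 * k)) ((pderiv ^^ (2 * k - 1)) p))"
    by (simp only: higher_pderiv_linear_mult smult_add_right sum.distrib sum_distrib_left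
        mult_smult_right smult_smult)
  also have "(\<Sum>k\<le>Suc K. smult (c k) ((pderiv ^^ (2 * k)) p)) = heat s p"
    unfolding c_def K_def by (intro heat_eq_sum[symmetric]) simp
  also have "(\<Sum>k\<le>Suc K. smult (c k * of_nat (2 * k)) ((pderiv ^^ (2 * k - 1)) p)) =
      (\<Sum>k\<le>K. smult (c (Suc k) * of_nat (2 * Suc k)) ((pderiv ^^ (2 * Suc k - 1)) p))"
    by (subst sum.atMost_Suc_shift) simp
  also have "\<dots> = (\<Sum>k\<le>K. smult s (smult (c k) ((pderiv ^^ (2 * k)) (pderiv p))))"
  proof (rule sum.cong[OF refl])
    fix k
    have "c (Suc k) * of_nat (2 * Suc k) = s * c k"
      proof -
      have "(s / 2 * x) / (n * f) * (2 * n) = s * (x / f)" if "n \<noteq> 0" for n x f :: real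
        using that by simp
      from this[of "of_nat (Suc k)" "(s / 2) ^ k" "fact k"] show ?thesis
        by (simp only: c_def power_Suc fact_Suc of_nat_mult of_nat_fact of_nat_numeral
            of_nat_eq_0_iff nat.simps simp_thms)
    qed
    moreover have "(pderiv ^^ (2 * Suc k - 1)) p = (pderiv ^^ (2 * k)) (pderiv p)"
      by (simp add: funpow_swap1)
    ultimately show "smult (c (Suc k) * of_nat (2 * Suc k)) ((pderiv ^^ (2 * Suc k - 1)) p) =
        smult s (smult (c k) ((pderiv ^^ (2 * k)) (pderiv p)))" by simp
  qed
  also have "\<dots> = smult s (\<Sum>k\<le>K. smult (c k) ((pderiv ^^ (2 * k)) (pderiv p)))"
    by (simp add: smult_sum_right)
  also have "(\<Sum>k\<le>K. smult (c k) ((pderiv ^^ (2 * k)) (pderiv p))) = heat s (pderiv p)"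
    unfolding c_def K_def
    by (intro heat_eq_sum[symmetric]) (simp add: degree_pderiv)
  finally show ?thesis .
qed

lemma pCons_eq_linear_mult: "pCons a p = [:a:] + [:-0, 1:] * (p :: real poly)"
  by simp

lemma heat_pCons:
  "heat s (pCons a p) = [:a:] + [:-0, 1:] * heat s p + smult s (heat s (pderiv p))"
  by (subst pCons_eq_linear_mult, subst heat_add, subst heat_linear_mult) simp

text \<open>In an induction on the coefficients, the first-order corrections of \<open>heat_pCons\<close> contributed by the
two flows add up to \<open>s + t\<close>.\<close>

lemma heat_heat: "heat s (heat t p) = heat (s + t) p"
proof (induction p)
  case (pCons a p)
  show ?case
    using pCons.IH
    by (simp only: heat_pCons heat_add heat_linear_mult heat_const heat_smult heat_pderiv)
      (simp add: smult_add_left algebra_simps)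
qed simp

lemma heat_zero_time [simp]: "heat 0 p = p"
proof (induction p)
  case (pCons a p)
  then show ?case by (simp add: heat_pCons)
qed simp

lemma heat_inverse [simp]: "heat s (heat (- s) p) = p" "heat (- s) (heat s p) = p"
  by (simp_all add: heat_heat)

lemma degree_heat [simp]: "degree (heat s p) = degree p"
proof (rule antisym)
  have le: "degree (heat s p) \<le> degree p" for s p
    unfolding heat_def
  proof (rule degree_sum_le)
    fix k assume "k \<in> {..degree p}"
    have "degree ((pderiv ^^ m) p) \<le> degree p" for m
      by (induction m) (auto simp: degree_pderiv)
    then show "degree (smult ((s / 2) ^ k / fact k) ((pderiv ^^ (2 * k)) p)) \<le> degree p"
      using degree_smult_le order.trans by blast
  qed simp
  show "degree (heat s p) \<le> degree p" by (rule le)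
  show "degree p \<le> degree (heat s p)" using le[of "-s" "heat s p"] by simp
qed

lemma lead_coeff_heat [simp]: "lead_coeff (heat s p) = lead_coeff p"
proof (induction p)
  case (pCons a p)
  show ?case
  proof (cases "p = 0")
    case False
    have "degree (heat s (pderiv p)) < Suc (degree p)"
      by (simp add: degree_pderiv)
    then have "coeff (heat s (pderiv p)) (Suc (degree p)) = 0" by (rule coeff_eq_0)
    moreover have "degree (heat s (pCons a p)) = Suc (degree p)" using False by simp
    moreover have "coeff (heat s (pCons a p)) (Suc (degree p)) = coeff (heat s p) (degree p)"
      using calculation by (simp add: heat_pCons)
    ultimately show ?thesis using pCons.IH False by simp
  qed simp
qed simp

lemma numeral_mult_poly: "numeral n * p = smult (numeral n) (p :: real poly)"
  by (metis mult_1 mult_smult_left of_nat_numeral of_nat_poly one_pCons smult_one)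

text \<open>The heat equation \<open>d/ds = D\<^sup>2 / 2\<close> joined with the chain rule in the point of evaluation. The
recursion \<open>heat_pCons\<close> expresses \<open>p\<close> through \<open>q\<close> and \<open>q'\<close>, which both have smaller degree.\<close>

lemma DERIV_poly_heat:
  assumes "(f has_real_derivative f') (at t within A)"
    and "(g has_real_derivative g') (at t within A)"
  shows "((\<lambda>t. poly (heat (f t) p) (g t)) has_real_derivative
     (poly (heat (f t) (pderiv p)) (g t) * g' +
      poly (heat (f t) (pderiv (pderiv p))) (g t) / 2 * f')) (at t within A)"
proof (induction "degree p" arbitrary: p rule: less_induct)
  case less
  show ?case
  proof (cases p)
    case (pCons a q)
    show ?thesis
    proof (cases "q = 0")
      case True
      then show ?thesis using pCons by (simp add: pderiv_pCons)
    next
      case False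
      then have d: "degree q < degree p" "degree (pderiv q) < degree p"
        using pCons by (auto simp: degree_pderiv)
      have deriv: "((\<lambda>t. a + g t * poly (heat (f t) q) (g t) + f t * poly (heat (f t) (pderiv q)) (g t))
        has_real_derivative
          0 + (g t * (poly (heat (f t) (pderiv q)) (g t) * g' +
            poly (heat (f t) (pderiv (pderiv q))) (g t) / 2 * f') + g' * poly (heat (f t) q) (g t))
          + (f t * (poly (heat (f t) (pderiv (pderiv q))) (g t) * g' +
            poly (heat (f t) (pderiv (pderiv (pderiv q)))) (g t) / 2 * f')
            + f' * poly (heat (f t) (pderiv q)) (g t))) (at t within A)"
        by (intro DERIV_add DERIV_const DERIV_mult' assms less d)
      have split: "poly (heat s p) x = a + x * poly (heat s q) x + s * poly (heat s (pderiv q)) x"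
        "poly (heat s (pderiv p)) x = poly (heat s q) x + x * poly (heat s (pderiv q)) x
          + s * poly (heat s (pderiv (pderiv q))) x"
        "poly (heat s (pderiv (pderiv p))) x = 2 * poly (heat s (pderiv q)) x
          + x * poly (heat s (pderiv (pderiv q))) x
          + s * poly (heat s (pderiv (pderiv (pderiv q)))) x" for s x
        unfolding pCons by (simp_all add: heat_pCons pderiv_pCons heat_add pderiv_add numeral_mult_poly heat_smult)
      show ?thesis
        unfolding split by (rule DERIV_cong[OF deriv]) (simp add: field_simps)
    qed
  qed
qed

lemma continuous_on_heat:
  assumes "continuous_on A f" "continuous_on A g"
  shows "continuous_on A (\<lambda>x. poly (heat (f x) p) (g x) :: real)"
  unfolding heat_def poly_sum poly_smult
  by (intro continuous_intros assms continuous_on_compose2[OF continuous_on_poly[OF continuous_on_id]]) auto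

section \<open>Gaussian integrals of polynomials\<close>

lemma pderiv_linear_power:
  "pderiv ([:-a, 1:] ^ m :: real poly) = smult (real m) ([:-a, 1:] ^ (m - 1))"
  by (cases m) (simp_all add: pderiv_power_Suc pderiv_pCons del: power_Suc of_nat_Suc)

text \<open>Evaluated at \<open>a\<close>, this is the recursion \<open>m\<^sub>k\<^sub>+\<^sub>2 = s (k + 1) m\<^sub>k\<close> of the central Gaussian moments.\<close>

lemma heat_linear_power_Suc:
  "heat s ([:-a, 1:] ^ Suc m) = [:-a, 1:] * heat s ([:-a, 1:] ^ m)
     + smult (s * real m) (heat s ([:-a, 1:] ^ (m - 1)))"
  by (simp only: power_Suc heat_linear_mult pderiv_linear_power heat_smult smult_smult)

lemma poly_heat_linear_power:
  "poly (heat s ([:-a, 1:] ^ m)) a =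
     (if even m then fact m / ((2 / s) ^ (m div 2) * fact (m div 2)) else 0)" if "s > 0"
proof (induction m rule: less_induct)
  case (less m)
  consider "m = 0" | "m = 1" | k where "m = Suc (Suc k)"
    by (metis One_nat_def not0_implies_Suc)
  then show ?case
  proof cases
    case 3
    have step: "poly (heat s ([:-a, 1:] ^ m)) a = s * real (Suc k) * poly (heat s ([:-a, 1:] ^ k)) a"
      unfolding 3 heat_linear_power_Suc[of s a "Suc k"] by simp
    show ?thesis
    proof (cases "even m")
      case True
      then obtain b where k: "k = 2 * b" using 3 by (auto elim!: evenE)
      have "s * (c * (f / (z * g))) = (2 * n * c * f) / (2 / s * z * (n * g))" if "n \<noteq> 0" for c f z g n
        using that \<open>s > 0\<close> by (simp add: field_simps)
      from this[of "real (Suc b)" "real (Suc k)" "fact k" "(2 / s) ^ b" "fact b"]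
      moreover have "fact m = 2 * real (Suc b) * real (Suc k) * fact k"
        by (simp add: 3 k algebra_simps)
      moreover have "m div 2 = Suc b" by (simp add: 3 k)
      ultimately show ?thesis
        using step less.IH[of k] True by (simp add: 3 k mult.assoc del: of_nat_Suc fact_Suc power_Suc)
          (simp add: fact_Suc power_Suc del: of_nat_Suc)
    next
      case False
      then show ?thesis using step less.IH[of k] by (simp add: 3)
    qed
  next
    case 2
    then show ?thesis using heat_linear_power_Suc[of s a 0] by simp
  qed simp
qed

lemma has_bochner_integral_gaussian_linear_power:
  assumes "s > 0"
  shows "has_bochner_integral lborel (\<lambda>x. normal_density a (sqrt s) x * (x - a) ^ m)
     (poly (heat s ([:-a, 1:] ^ m)) a)"
proof (cases "even m")
  case True
  then show ?thesis
    using normal_moment_even[of "sqrt s" a "m div 2"] assms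
    by (simp add: poly_heat_linear_power)
next
  case False
  then show ?thesis
    using normal_moment_odd[of "sqrt s" a "m div 2"] assms
    by (simp add: poly_heat_linear_power)
qed

text \<open>The flow \<open>heat s\<close> is convolution with the Gaussian of variance \<open>s\<close>: expand \<open>p\<close> in powers of
\<open>x - a\<close> and compare with the central moments.\<close>

lemma has_bochner_integral_gaussian_poly:
  assumes "s > 0"
  shows "has_bochner_integral lborel (\<lambda>x. poly p x * normal_density a (sqrt s) x)
     (poly (heat s p) a)"
proof -
  define q where "q = pcompose p [:a, 1:]"
  have p: "p = (\<Sum>i\<le>degree q. smult (coeff q i) ([:-a, 1:] ^ i))"
  proof -
    have "poly p x = poly (\<Sum>i\<le>degree q. smult (coeff q i) ([:-a, 1:] ^ i)) x" for x
    proof -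
      have "poly p x = poly q (x - a)" by (simp add: q_def poly_pcompose)
      then show ?thesis by (simp add: poly_altdef[of q] poly_sum)
    qed
    then show ?thesis by (simp add: poly_eq_poly_eq_iff[symmetric] fun_eq_iff)
  qed
  have "has_bochner_integral lborel
      (\<lambda>x. \<Sum>i\<le>degree q. coeff q i * (normal_density a (sqrt s) x * (x - a) ^ i))
      (\<Sum>i\<le>degree q. coeff q i * poly (heat s ([:-a, 1:] ^ i)) a)"
    by (intro has_bochner_integral_sum has_bochner_integral_mult_right
        has_bochner_integral_gaussian_linear_power assms)
  moreover have "(\<Sum>i\<le>degree q. coeff q i * (normal_density a (sqrt s) x * (x - a) ^ i)) =
      poly p x * normal_density a (sqrt s) x" for x
    by (subst p) (simp add: poly_sum sum_distrib_left mult_ac)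
  moreover have "(\<Sum>i\<le>degree q. coeff q i * poly (heat s ([:-a, 1:] ^ i)) a) = poly (heat s p) a"
    proof -
    have "heat s p = (\<Sum>i\<le>degree q. smult (coeff q i) (heat s ([:-a, 1:] ^ i)))"
      by (subst p) (simp only: heat_sum heat_smult)
    then show ?thesis by (simp add: poly_sum)
  qed
  ultimately show ?thesis by simp
qed

lemma gauss_moment_eq_heat: "s > 0 \<Longrightarrow> gauss_moment j u s = poly (heat s (monom 1 j)) u"
  using has_bochner_integral_gaussian_poly[of s "monom 1 j" u]
  unfolding gauss_moment_def by (simp add: has_bochner_integral_integral_eq poly_monom)

text \<open>The integrand is nonnegative and vanishes only at the finitely many roots of \<open>p\<close>.\<close>

lemma heat_pos:
  assumes "s > 0" and nonneg: "\<And>x. poly p x \<ge> 0" and "p \<noteq> 0"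
  shows "poly (heat s p) a > 0"
proof -
  define f where "f = (\<lambda>x. poly p x * normal_density a (sqrt s) x)"
  have int: "has_bochner_integral lborel f (poly (heat s p) a)"
    unfolding f_def by (rule has_bochner_integral_gaussian_poly) fact
  then have val: "integral\<^sup>L lborel f = poly (heat s p) a" and [simp]: "integrable lborel f"
    by (auto simp: has_bochner_integral_iff)
  have f: "f x \<ge> 0" for x using nonneg by (simp add: f_def)
  have "integral\<^sup>L lborel f \<noteq> 0"
  proof
    assume "integral\<^sup>L lborel f = 0"
    then have "AE x in lborel. f x = 0" using f by (subst (asm) integral_nonneg_eq_0_iff_AE) auto
    then have "AE x in lborel. x \<in> {x. poly p x = 0}"
      by eventually_elim
        (use normal_density_pos[of "sqrt s" a] assms(1) in \<open>auto simp: f_def less_le\<close>)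
    moreover have "AE x in lborel. x \<notin> {x. poly p x = 0}"
      using poly_roots_finite[OF \<open>p \<noteq> 0\<close>]
      by (intro AE_not_in finite_imp_null_set_lborel)
    ultimately have "AE x::real in lborel. False" by eventually_elim simp
    then have "emeasure lborel (UNIV :: real set) = 0"
      by (simp add: AE_iff_measurable[OF _ refl])
    then show False by simp
  qed
  moreover have "integral\<^sup>L lborel f \<ge> 0" using f by simp
  ultimately show ?thesis using val by simp
qed

section \<open>Solving equations in finitely many real variables\<close>

lemma trivial_kernel_imp_inverse:
  fixes A :: "real mat"
  assumes A: "A \<in> carrier_mat n n"
    and inj: "\<And>v. v \<in> carrier_vec n \<Longrightarrow> A *\<^sub>v v = 0\<^sub>v n \<Longrightarrow> v = 0\<^sub>v n"
  obtains B where "B \<in> carrier_mat n n" "A * B = 1\<^sub>m n" "B * A = 1\<^sub>m n"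
proof -
  have "det A \<noteq> 0" using det_0_iff_vec_prod_zero_field[OF A] inj by auto
  from det_non_zero_imp_unit[OF A this, unfolded Units_def, of "()"]
  show ?thesis by (auto simp: ring_mat_def intro: that)
qed

text \<open>A square matrix whose transpose is injective has an inverse; \<open>D k i\<close> will be a Jacobian, with \<open>k\<close>
counting functions and \<open>i\<close> counting variables.\<close>

lemma left_inverse_coefficients:
  fixes D :: "nat \<Rightarrow> nat \<Rightarrow> real"
  assumes inj: "\<And>d. \<forall>i<n. (\<Sum>k<n. d k * D k i) = 0 \<Longrightarrow> \<forall>k<n. d k = 0"
  obtains B where "\<And>i j. i < n \<Longrightarrow> j < n \<Longrightarrow> (\<Sum>k<n. B i k * D k j) = of_bool (i = j)"
proof -
  define A where "A = mat n n (\<lambda>(i, k). D k i)"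
  have A: "A \<in> carrier_mat n n" by (simp add: A_def)
  have "v = 0\<^sub>v n" if v: "v \<in> carrier_vec n" "A *\<^sub>v v = 0\<^sub>v n" for v
  proof (rule eq_vecI)
    have "(\<Sum>k<n. v $ k * D k i) = 0" if "i < n" for i
    proof -
      have "(A *\<^sub>v v) $ i = (\<Sum>k<n. v $ k * D k i)"
        using that v(1) by (auto simp: A_def scalar_prod_def lessThan_atLeast0 intro!: sum.cong)
      then show ?thesis using v(2) that by simp
    qed
    then show "v $ k = 0\<^sub>v n $ k" if "k < dim_vec (0\<^sub>v n)" for k
      using inj[of "\<lambda>k. v $ k"] that by simp
  qed (use v in auto)
  with A obtain C where C: "C \<in> carrier_mat n n" "A * C = 1\<^sub>m n"
    by (rule trivial_kernel_imp_inverse)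
  show ?thesis
  proof (rule that)
    fix i j assume ij: "i < n" "j < n"
    have "(\<Sum>k<n. C $$ (k, i) * D k j) = (A * C) $$ (j, i)"
      using C(1) ij by (auto simp: A_def scalar_prod_def lessThan_atLeast0 intro!: sum.cong)
    then show "(\<Sum>k<n. C $$ (k, i) * D k j) = of_bool (i = j)" using C(2) ij by auto
  qed
qed

text \<open>The number \<open>n\<close> of variables is a natural number rather than the dimension of a type. Points are
therefore sequences of which only the first \<open>n\<close> entries vary, and all topology is that of pointwise
convergence, for which these boxes are compact.\<close>

definition coord_box :: "nat \<Rightarrow> (nat \<Rightarrow> real) \<Rightarrow> real \<Rightarrow> (nat \<Rightarrow> real) set" where
  "coord_box n x0 r = {x. (\<forall>i<n. \<bar>x i - x0 i\<bar> \<le> r) \<and> (\<forall>i\<ge>n. x i = x0 i)}"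

lemma compact_coord_box: "compact (coord_box n x0 r)"
proof -
  have "coord_box n x0 r = PiE UNIV (\<lambda>i. if i < n then {x0 i - r..x0 i + r} else {x0 i})"
    unfolding coord_box_def by (auto simp: PiE_iff abs_le_iff algebra_simps split: if_splits)
  moreover have "compactin (product_topology (\<lambda>i. euclidean) UNIV) \<dots>"
    by (subst compactin_PiE) auto
  ultimately show ?thesis by (simp add: euclidean_product_topology)
qed

lemma coord_box_subset_open:
  assumes "open U" "x0 \<in> U"
  shows "eventually (\<lambda>r. coord_box n x0 r \<subseteq> U) (at_right 0)"
proof -
  obtain X where X: "x0 \<in> Pi\<^sub>E UNIV X" "\<And>i. open (X i)" "Pi\<^sub>E UNIV X \<subseteq> U"
    using product_topology_open_contains_basis[of "\<lambda>_. euclidean" UNIV U x0] assms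
    by (auto simp: open_fun_def)
  have "\<exists>e>0. \<forall>y. dist y (x0 i) < e \<longrightarrow> y \<in> X i" for i
    using X(1,2) by (auto simp: open_dist PiE_iff)
  then obtain e where e: "\<And>i. e i > 0" "\<And>i y. dist y (x0 i) < e i \<Longrightarrow> y \<in> X i"
    by metis
  have "eventually (\<lambda>r. \<forall>i\<in>{..<n}. r < e i) (at_right 0)"
    using e(1) by (intro eventually_ball_finite) (auto intro: eventually_at_rightI[of 0 "e _"])
  then show ?thesis
  proof eventually_elim
    case (elim r)
    have "x i \<in> X i" if "x \<in> coord_box n x0 r" for x i
      using that elim e X(1) by (cases "i < n") (force simp: coord_box_def dist_real_def PiE_iff)+
    then show ?case using X(3) by (auto simp: PiE_iff)
  qed
qed

text \<open>Continuous differentiability in the first \<open>n\<close> variables. Derivatives along lines are what the mean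
value theorem needs, and for explicit formulas they come out of the ordinary chain rule.\<close>

definition has_partials ::
  "nat \<Rightarrow> ((nat \<Rightarrow> real) \<Rightarrow> real) \<Rightarrow> (nat \<Rightarrow> (nat \<Rightarrow> real) \<Rightarrow> real) \<Rightarrow> bool" where
  "has_partials n f f' \<longleftrightarrow> continuous_on UNIV f \<and> (\<forall>i<n. continuous_on UNIV (f' i)) \<and>
     (\<forall>x h t. (\<forall>i\<ge>n. h i = 0) \<longrightarrow> ((\<lambda>t. f (\<lambda>i. x i + t * h i)) has_real_derivative
        (\<Sum>i<n. f' i (\<lambda>i. x i + t * h i) * h i)) (at t))"

text \<open>The mean value theorem on the segment from \<open>x0\<close> to \<open>x\<close> gives the partial derivatives at an
intermediate point, which differ from those at \<open>x0\<close> by at most \<open>\<epsilon>\<close>.\<close>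

lemma first_order_expansion:
  assumes f: "has_partials n f f'" and "\<epsilon> > 0"
  shows "eventually (\<lambda>r. \<forall>x\<in>coord_box n x0 r.
     \<bar>f x - f x0 - (\<Sum>i<n. f' i x0 * (x i - x0 i))\<bar> \<le> \<epsilon> * (\<Sum>i<n. \<bar>x i - x0 i\<bar>)) (at_right 0)"
proof -
  define U where "U = (\<Inter>i<n. {x. \<bar>f' i x - f' i x0\<bar> < \<epsilon>})"
  have "open U" unfolding U_def
    using f by (intro open_INT finite_lessThan ballI open_Collect_less continuous_intros)
      (auto simp: has_partials_def)
  moreover have "x0 \<in> U" using \<open>\<epsilon> > 0\<close> by (simp add: U_def)
  ultimately have "eventually (\<lambda>r. coord_box n x0 r \<subseteq> U) (at_right 0)" by (rule coord_box_subset_open)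
  then show ?thesis
  proof eventually_elim
    case (elim r)
    show ?case
    proof
      fix x assume x: "x \<in> coord_box n x0 r"
      define h where "h = (\<lambda>i. x i - x0 i)"
      have h0: "\<forall>i\<ge>n. h i = 0" using x by (auto simp: h_def coord_box_def)
      obtain \<tau> where \<tau>: "0 < \<tau>" "\<tau> < 1" and
        "f (\<lambda>i. x0 i + 1 * h i) - f (\<lambda>i. x0 i + 0 * h i) =
          (1 - 0) * (\<Sum>i<n. f' i (\<lambda>i. x0 i + \<tau> * h i) * h i)"
        using f h0 MVT2[of 0 1 "\<lambda>t. f (\<lambda>i. x0 i + t * h i)"
            "\<lambda>t. \<Sum>i<n. f' i (\<lambda>i. x0 i + t * h i) * h i"]
        unfolding has_partials_def by auto
      then have "f x - f x0 - (\<Sum>i<n. f' i x0 * h i) =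
          (\<Sum>i<n. (f' i (\<lambda>i. x0 i + \<tau> * h i) - f' i x0) * h i)"
        by (simp add: h_def sum_subtractf left_diff_distrib)
      also have "\<bar>\<dots>\<bar> \<le> (\<Sum>i<n. \<epsilon> * \<bar>h i\<bar>)"
      proof (rule sum_abs[THEN order.trans], rule sum_mono)
        fix i assume "i \<in> {..<n}"
        have "\<bar>\<tau> * h i\<bar> \<le> r" if "i < n" for i
        proof -
          have "\<bar>\<tau> * h i\<bar> \<le> \<bar>h i\<bar>"
            using \<tau> by (simp add: abs_mult mult_left_le_one_le)
          then show ?thesis using x that by (force simp: coord_box_def h_def)
        qed
        then have "(\<lambda>i. x0 i + \<tau> * h i) \<in> coord_box n x0 r"
          using h0 by (auto simp: coord_box_def)
        then have "\<bar>f' i (\<lambda>i. x0 i + \<tau> * h i) - f' i x0\<bar> < \<epsilon>"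
          using elim \<open>i \<in> {..<n}\<close> by (auto simp: U_def)
        then show "\<bar>(f' i (\<lambda>i. x0 i + \<tau> * h i) - f' i x0) * h i\<bar> \<le> \<epsilon> * \<bar>h i\<bar>"
          by (simp add: abs_mult mult_right_mono)
      qed
      finally show "\<bar>f x - f x0 - (\<Sum>i<n. f' i x0 * (x i - x0 i))\<bar> \<le> \<epsilon> * (\<Sum>i<n. \<bar>x i - x0 i\<bar>)"
        by (simp add: h_def sum_distrib_left)
    qed
  qed
qed

text \<open>The linear part of \<open>F\<close> at \<open>x0\<close> has a left inverse and is hence bounded below; close to \<open>x0\<close> it
dominates the remainder.\<close>

lemma distance_le_image_distance:
  fixes F :: "nat \<Rightarrow> (nat \<Rightarrow> real) \<Rightarrow> real"
  assumes F: "\<And>k. k < n \<Longrightarrow> has_partials n (F k) (F' k)"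
    and inj: "\<And>d. \<forall>i<n. (\<Sum>k<n. d k * F' k i x0) = 0 \<Longrightarrow> \<forall>k<n. d k = 0"
  obtains C where "C > 0" "eventually (\<lambda>r. \<forall>x\<in>coord_box n x0 r.
      (\<Sum>i<n. \<bar>x i - x0 i\<bar>) \<le> C * (\<Sum>k<n. \<bar>F k x - F k x0\<bar>)) (at_right 0)"
proof -
  obtain B where B: "\<And>i j. i < n \<Longrightarrow> j < n \<Longrightarrow> (\<Sum>k<n. B i k * F' k j x0) = of_bool (i = j)"
    using left_inverse_coefficients[of n "\<lambda>k i. F' k i x0"] inj by blast
  define \<beta> where "\<beta> = 1 + (\<Sum>i<n. \<Sum>k<n. \<bar>B i k\<bar>)"
  have "\<beta> > 0" unfolding \<beta>_def by (intro add_pos_nonneg sum_nonneg) auto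
  \<comment> \<open>With this \<open>\<epsilon>\<close> the remainder is at most half of the distance and can be absorbed.\<close>
  define \<epsilon> where "\<epsilon> = 1 / (2 * \<beta>)"
  have "\<epsilon> > 0" using \<open>\<beta> > 0\<close> by (simp add: \<epsilon>_def)
  have "eventually (\<lambda>r. \<forall>k\<in>{..<n}. \<forall>x\<in>coord_box n x0 r.
     \<bar>F k x - F k x0 - (\<Sum>i<n. F' k i x0 * (x i - x0 i))\<bar> \<le> \<epsilon> * (\<Sum>i<n. \<bar>x i - x0 i\<bar>)) (at_right 0)"
    by (intro eventually_ball_finite) (auto intro!: first_order_expansion F \<open>\<epsilon> > 0\<close>)
  then have "eventually (\<lambda>r. \<forall>x\<in>coord_box n x0 r.
      (\<Sum>i<n. \<bar>x i - x0 i\<bar>) \<le> 2 * \<beta> * (\<Sum>k<n. \<bar>F k x - F k x0\<bar>)) (at_right 0)"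
  proof eventually_elim
    case (elim r)
    show ?case
    proof
      fix x assume x: "x \<in> coord_box n x0 r"
      define S where "S = (\<Sum>i<n. \<bar>x i - x0 i\<bar>)"
      define T where "T = (\<Sum>k<n. \<bar>F k x - F k x0\<bar>)"
      define L where "L = (\<lambda>k. \<Sum>j<n. F' k j x0 * (x j - x0 j))"
      have "S \<ge> 0" by (simp add: S_def sum_nonneg)
      have L: "\<bar>L k\<bar> \<le> T + \<epsilon> * S" if "k < n" for k
      proof -
        have "\<bar>F k x - F k x0\<bar> \<le> T"
          unfolding T_def using that by (intro member_le_sum) auto
        moreover have "\<bar>F k x - F k x0 - L k\<bar> \<le> \<epsilon> * S"
          using elim x that by (auto simp: L_def S_def)
        ultimately show ?thesis by linarith
      qed
      have "x i - x0 i = (\<Sum>k<n. B i k * L k)" if "i < n" for i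
      proof -
        have "(\<Sum>k<n. B i k * L k) = (\<Sum>j<n. (\<Sum>k<n. B i k * F' k j x0) * (x j - x0 j))"
          unfolding L_def sum_distrib_left sum_distrib_right
          by (subst sum.swap) (simp add: mult.assoc)
        also have "\<dots> = (\<Sum>j<n. of_bool (i = j) * (x j - x0 j))"
          using B that by (intro sum.cong) auto
        also have "\<dots> = x i - x0 i" using that by (simp add: of_bool_def if_distrib[of "\<lambda>c. c * _"] sum.delta cong: if_cong)
        finally show ?thesis by simp
      qed
      then have "S = (\<Sum>i<n. \<bar>\<Sum>k<n. B i k * L k\<bar>)" by (simp add: S_def)
      also have "\<dots> \<le> (\<Sum>i<n. \<Sum>k<n. \<bar>B i k\<bar> * (T + \<epsilon> * S))"
        using L by (intro sum_mono sum_abs[THEN order.trans]) (auto simp: abs_mult intro!: mult_left_mono)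
      also have "\<dots> = (\<beta> - 1) * (T + \<epsilon> * S)"
        by (simp add: \<beta>_def sum_distrib_right)
      also have "\<dots> \<le> \<beta> * (T + \<epsilon> * S)"
        using \<open>S \<ge> 0\<close> \<open>\<epsilon> > 0\<close> by (intro mult_right_mono add_nonneg_nonneg) (auto simp: T_def sum_nonneg)
      also have "\<dots> = \<beta> * T + S / 2" using \<open>\<beta> > 0\<close> by (simp add: \<epsilon>_def field_simps)
      finally show "S \<le> 2 * \<beta> * T" by simp
    qed
  qed
  moreover have "2 * \<beta> > 0" using \<open>\<beta> > 0\<close> by simp
  ultimately show ?thesis by (rule that[rotated])
qed

text \<open>The existence half of the inverse function theorem. Minimise \<open>\<Sum>k. (F k x - y k)\<^sup>2\<close> over a box. Its
value at \<open>x0\<close> is so small that \<open>distance_le_image_distance\<close> keeps the minimiser away from the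
boundary. At an interior minimiser the partial derivatives of the sum vanish, and as the transposed
Jacobian is injective, every \<open>F k x - y k\<close> is zero.\<close>

lemma local_solvability:
  fixes F :: "nat \<Rightarrow> (nat \<Rightarrow> real) \<Rightarrow> real"
  assumes F: "\<And>k. k < n \<Longrightarrow> has_partials n (F k) (F' k)"
    and inj: "\<And>x d. x \<in> U \<Longrightarrow> \<forall>i<n. (\<Sum>k<n. d k * F' k i x) = 0 \<Longrightarrow> \<forall>k<n. d k = 0"
    and U: "open U" "x0 \<in> U"
  obtains C where "C > 0" "eventually (\<lambda>r. \<forall>y. C * (\<Sum>k<n. \<bar>y k - F k x0\<bar>) < r \<longrightarrow>
      (\<exists>x \<in> U \<inter> coord_box n x0 r. (\<forall>k<n. F k x = y k) \<and>
        (\<Sum>i<n. \<bar>x i - x0 i\<bar>) \<le> C * (\<Sum>k<n. \<bar>y k - F k x0\<bar>))) (at_right 0)"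
proof -
  obtain C0 where C0: "C0 > 0" "eventually (\<lambda>r. \<forall>x\<in>coord_box n x0 r.
      (\<Sum>i<n. \<bar>x i - x0 i\<bar>) \<le> C0 * (\<Sum>k<n. \<bar>F k x - F k x0\<bar>)) (at_right 0)"
    by (rule distance_le_image_distance[of n F F' x0, OF F inj[OF U(2)]])
  \<comment> \<open>At the minimiser each \<open>F k x\<close> is within \<open>\<eta>\<close> of \<open>y k\<close>, which costs \<open>n\<close> further copies of \<open>\<eta>\<close>.\<close>
  define C where "C = C0 * (real n + 1)"
  have "C > 0" using C0(1) by (simp add: C_def)
  moreover have "eventually (\<lambda>r. \<forall>y. C * (\<Sum>k<n. \<bar>y k - F k x0\<bar>) < r \<longrightarrow>
      (\<exists>x \<in> U \<inter> coord_box n x0 r. (\<forall>k<n. F k x = y k) \<and>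
        (\<Sum>i<n. \<bar>x i - x0 i\<bar>) \<le> C * (\<Sum>k<n. \<bar>y k - F k x0\<bar>))) (at_right 0)"
    using C0(2) coord_box_subset_open[OF U, of n]
  proof eventually_elim
    case (elim r)
    show ?case
    proof (intro allI impI)
      fix y
      define \<eta> where "\<eta> = (\<Sum>k<n. \<bar>y k - F k x0\<bar>)"
      assume "C * (\<Sum>k<n. \<bar>y k - F k x0\<bar>) < r"
      then have small: "C * \<eta> < r" by (simp add: \<eta>_def)
      have "\<eta> \<ge> 0" by (simp add: \<eta>_def sum_nonneg)
      then have "r > 0" using small \<open>C > 0\<close> by (smt (verit) mult_nonneg_nonneg)
      define \<phi> where "\<phi> = (\<lambda>x. \<Sum>k<n. (F k x - y k)\<^sup>2)"
      have "continuous_on (coord_box n x0 r) \<phi>"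
        unfolding \<phi>_def using F
        by (intro continuous_intros) (auto simp: has_partials_def intro: continuous_on_subset)
      moreover have x0: "x0 \<in> coord_box n x0 r" using \<open>r > 0\<close> by (simp add: coord_box_def)
      ultimately obtain x where x: "x \<in> coord_box n x0 r"
        and min: "\<And>z. z \<in> coord_box n x0 r \<Longrightarrow> \<phi> x \<le> \<phi> z"
        using continuous_attains_inf[OF compact_coord_box, of n x0 r \<phi>] by blast
      have "\<phi> x0 \<le> \<eta>\<^sup>2"
      proof -
        have "\<phi> x0 = (\<Sum>k<n. \<bar>y k - F k x0\<bar> * \<bar>y k - F k x0\<bar>)"
          unfolding \<phi>_def by (intro sum.cong) (auto simp: power2_eq_square algebra_simps)
        also have "\<dots> \<le> (\<Sum>k<n. \<bar>y k - F k x0\<bar> * \<eta>)"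
          unfolding \<eta>_def by (intro sum_mono mult_left_mono member_le_sum) auto
        also have "\<dots> = \<eta>\<^sup>2" by (simp add: \<eta>_def power2_eq_square sum_distrib_right)
        finally show ?thesis .
      qed
      have close: "\<bar>F k x - y k\<bar> \<le> \<eta>" if "k < n" for k
      proof -
        have "(F k x - y k)\<^sup>2 \<le> \<phi> x"
          unfolding \<phi>_def using that by (intro member_le_sum) auto
        also have "\<phi> x \<le> \<eta>\<^sup>2" using min[OF x0] \<open>\<phi> x0 \<le> \<eta>\<^sup>2\<close> by linarith
        finally show ?thesis using \<open>\<eta> \<ge> 0\<close> using abs_le_square_iff[of "F k x - y k" \<eta>] by simp
      qed
      have "(\<Sum>k<n. \<bar>F k x - F k x0\<bar>) \<le> (\<Sum>k<n. \<eta> + \<bar>y k - F k x0\<bar>)"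
        using close by (intro sum_mono) (smt (verit) lessThan_iff)
      also have "\<dots> = (real n + 1) * \<eta>" by (simp add: sum.distrib \<eta>_def distrib_right)
      finally have "C0 * (\<Sum>k<n. \<bar>F k x - F k x0\<bar>) \<le> C0 * ((real n + 1) * \<eta>)"
        using C0(1) by (intro mult_left_mono) auto
      then have S: "(\<Sum>i<n. \<bar>x i - x0 i\<bar>) \<le> C * \<eta>"
        using elim(1) x by (force simp: C_def mult.assoc)
      have interior: "\<bar>x i - x0 i\<bar> < r" if "i < n" for i
      proof -
        have "\<bar>x i - x0 i\<bar> \<le> (\<Sum>i<n. \<bar>x i - x0 i\<bar>)"
          using that by (intro member_le_sum) auto
        then show ?thesis using S small by linarith
      qed
      have crit: "(\<Sum>k<n. (F k x - y k) * F' k i x) = 0" if i: "i < n" for i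
      proof -
        define h where "h = (\<lambda>j. of_bool (j = i) :: real)"
        have line: "((\<lambda>t. F k (\<lambda>j. x j + t * h j)) has_real_derivative F' k i x) (at 0)" if "k < n" for k
        proof -
          have "\<forall>j\<ge>n. h j = 0" using i by (auto simp: h_def)
          with F[OF that] have "((\<lambda>t. F k (\<lambda>j. x j + t * h j)) has_real_derivative
              (\<Sum>j<n. F' k j (\<lambda>j. x j + 0 * h j) * h j)) (at 0)"
            unfolding has_partials_def by blast
          moreover have "(\<Sum>j<n. F' k j x * h j) = F' k i x"
            using i by (simp add: h_def of_bool_def if_distrib[of "\<lambda>c. _ * c"] sum.delta cong: if_cong)
          ultimately show ?thesis by simp
        qed
        have "((\<lambda>t. \<phi> (\<lambda>j. x j + t * h j)) has_real_derivative
            (\<Sum>k<n. 2 * ((F k x - y k) * F' k i x))) (at 0)"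
          unfolding \<phi>_def
          by (rule DERIV_sum) (auto intro!: derivative_eq_intros line)
        moreover have "r - \<bar>x i - x0 i\<bar> > 0" using interior[OF i] by simp
        moreover have "\<phi> (\<lambda>j. x j + 0 * h j) \<le> \<phi> (\<lambda>j. x j + t * h j)"
          if "\<bar>0 - t\<bar> < r - \<bar>x i - x0 i\<bar>" for t
        proof -
          have "(\<lambda>j. x j + t * h j) \<in> coord_box n x0 r"
            using x that i by (auto simp: coord_box_def h_def)
          then show ?thesis using min by simp
        qed
        ultimately have "(\<Sum>k<n. 2 * ((F k x - y k) * F' k i x)) = 0"
          by (intro DERIV_local_min) blast+
        then show ?thesis by (simp only: flip: sum_distrib_left)
      qed
      have "x \<in> U" using x elim(2) by blast
      then have "F k x - y k = 0" if "k < n" for k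
        using inj[of x "\<lambda>k. F k x - y k"] crit that by blast
      then show "\<exists>x \<in> U \<inter> coord_box n x0 r. (\<forall>k<n. F k x = y k) \<and>
        (\<Sum>i<n. \<bar>x i - x0 i\<bar>) \<le> C * (\<Sum>k<n. \<bar>y k - F k x0\<bar>)"
        using x \<open>x \<in> U\<close> S by (intro bexI[of _ x]) (auto simp: \<eta>_def)
    qed
  qed
  ultimately show ?thesis by (rule that)
qed

text \<open>If the gradient of \<open>G\<close> vanishes at \<open>x0\<close>, then \<open>G\<close> changes by \<open>o(\<bar>y - F x0\<bar>)\<close> on passing from \<open>x0\<close>
to a suitable solution of \<open>F x = y\<close>. Applied to a moment minus a linear combination of the moments \<open>F\<close>, this gives the
derivatives of that moment as a function of \<open>F\<close> without differentiating a solution map.\<close>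

lemma critical_change_negligible:
  fixes F :: "nat \<Rightarrow> (nat \<Rightarrow> real) \<Rightarrow> real"
  assumes F: "\<And>k. k < n \<Longrightarrow> has_partials n (F k) (F' k)"
    and inj: "\<And>x d. x \<in> U \<Longrightarrow> \<forall>i<n. (\<Sum>k<n. d k * F' k i x) = 0 \<Longrightarrow> \<forall>k<n. d k = 0"
    and U: "open U" "x0 \<in> U"
    and G: "has_partials n G G'" "\<And>i. i < n \<Longrightarrow> G' i x0 = 0"
    and "\<epsilon> > 0"
  obtains \<delta> where "\<delta> > 0" "\<And>y. (\<Sum>k<n. \<bar>y k - F k x0\<bar>) < \<delta> \<Longrightarrow>
    (\<exists>x \<in> U. (\<forall>k<n. F k x = y k) \<and> (\<forall>i\<ge>n. x i = x0 i) \<and>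
       \<bar>G x - G x0\<bar> \<le> \<epsilon> * (\<Sum>k<n. \<bar>y k - F k x0\<bar>))"
proof -
  obtain C where C: "C > 0" "eventually (\<lambda>r. \<forall>y. C * (\<Sum>k<n. \<bar>y k - F k x0\<bar>) < r \<longrightarrow>
      (\<exists>x \<in> U \<inter> coord_box n x0 r. (\<forall>k<n. F k x = y k) \<and>
        (\<Sum>i<n. \<bar>x i - x0 i\<bar>) \<le> C * (\<Sum>k<n. \<bar>y k - F k x0\<bar>))) (at_right 0)"
    by (rule local_solvability[of n F F' U x0, OF F inj U])
  have "\<epsilon> / C > 0" using \<open>\<epsilon> > 0\<close> \<open>C > 0\<close> by simp
  from first_order_expansion[OF G(1) this, of x0] C(2) eventually_at_right_less[of "0::real"]
  have "eventually (\<lambda>r. r > 0 \<and> (\<forall>y. C * (\<Sum>k<n. \<bar>y k - F k x0\<bar>) < r \<longrightarrow>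
      (\<exists>x \<in> U. (\<forall>k<n. F k x = y k) \<and> (\<forall>i\<ge>n. x i = x0 i) \<and>
       \<bar>G x - G x0\<bar> \<le> \<epsilon> * (\<Sum>k<n. \<bar>y k - F k x0\<bar>)))) (at_right 0)"
  proof eventually_elim
    case (elim r)
    show ?case
    proof (intro conjI allI impI)
      fix y assume "C * (\<Sum>k<n. \<bar>y k - F k x0\<bar>) < r"
      then obtain x where x: "x \<in> U \<inter> coord_box n x0 r" "\<forall>k<n. F k x = y k"
        "(\<Sum>i<n. \<bar>x i - x0 i\<bar>) \<le> C * (\<Sum>k<n. \<bar>y k - F k x0\<bar>)"
        using elim(2) by blast
      have "\<bar>G x - G x0\<bar> \<le> \<epsilon> / C * (\<Sum>i<n. \<bar>x i - x0 i\<bar>)"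
        using elim(1) x(1) G(2) by auto
      also have "\<dots> \<le> \<epsilon> / C * (C * (\<Sum>k<n. \<bar>y k - F k x0\<bar>))"
        using x(3) \<open>\<epsilon> / C > 0\<close> by (intro mult_left_mono) auto
      also have "\<dots> = \<epsilon> * (\<Sum>k<n. \<bar>y k - F k x0\<bar>)" using \<open>C > 0\<close> by simp
      finally show "\<exists>x \<in> U. (\<forall>k<n. F k x = y k) \<and> (\<forall>i\<ge>n. x i = x0 i) \<and>
       \<bar>G x - G x0\<bar> \<le> \<epsilon> * (\<Sum>k<n. \<bar>y k - F k x0\<bar>)"
        using x by (intro bexI[of _ x]) (auto simp: coord_box_def)
    qed (fact elim(3))
  qed
  then obtain r where r: "r > 0" "\<forall>y. C * (\<Sum>k<n. \<bar>y k - F k x0\<bar>) < r \<longrightarrow>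
      (\<exists>x \<in> U. (\<forall>k<n. F k x = y k) \<and> (\<forall>i\<ge>n. x i = x0 i) \<and>
       \<bar>G x - G x0\<bar> \<le> \<epsilon> * (\<Sum>k<n. \<bar>y k - F k x0\<bar>))"
    using eventually_happens'[of "at_right (0::real)"] trivial_limit_at_right_real by blast
  show ?thesis
  proof (rule that[of "r / C"])
    show "r / C > 0" using r(1) C(1) by simp
    fix y assume "(\<Sum>k<n. \<bar>y k - F k x0\<bar>) < r / C"
    then have "C * (\<Sum>k<n. \<bar>y k - F k x0\<bar>) < r" using C(1) by (simp add: field_simps)
    then show "\<exists>x \<in> U. (\<forall>k<n. F k x = y k) \<and> (\<forall>i\<ge>n. x i = x0 i) \<and>
       \<bar>G x - G x0\<bar> \<le> \<epsilon> * (\<Sum>k<n. \<bar>y k - F k x0\<bar>)" using r(2) by blast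
  qed
qed

section \<open>Gaussian mixtures and their parameters\<close>

text \<open>The integral of \<open>p\<close> against the Gaussian mixture with parameters
\<open>x = (w\<^sub>1, u\<^sub>1, \<dots>, w\<^sub>N, u\<^sub>N, \<sigma>\<^sup>2)\<close>. As a function of a sequence \<open>x\<close> it fits \<open>has_partials\<close>.\<close>

definition mixture_mean :: "nat \<Rightarrow> (nat \<Rightarrow> real) \<Rightarrow> real poly \<Rightarrow> real" where
  "mixture_mean N x p = (\<Sum>b<N. x (2 * b) * poly (heat (x (2 * N)) p) (x (2 * b + 1)))"

text \<open>The partial derivative of \<open>mixture_mean\<close> in the parameter \<open>x i\<close>. The variance enters through the heat
equation, hence the second derivative of \<open>p\<close>.\<close>

definition mixture_partial :: "nat \<Rightarrow> real poly \<Rightarrow> nat \<Rightarrow> (nat \<Rightarrow> real) \<Rightarrow> real" where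
  "mixture_partial N p i x = (\<Sum>b<N.
     of_bool (i = 2 * b) * poly (heat (x (2 * N)) p) (x (2 * b + 1)) +
     of_bool (i = 2 * b + 1) * (x (2 * b) * poly (heat (x (2 * N)) (pderiv p)) (x (2 * b + 1))) +
     of_bool (i = 2 * N) * (x (2 * b) * poly (heat (x (2 * N)) (pderiv (pderiv p))) (x (2 * b + 1)) / 2))"

definition root_poly :: "nat \<Rightarrow> (nat \<Rightarrow> real) \<Rightarrow> real poly" where
  "root_poly n u = (\<Prod>b<n. [:- u b, 1:])"

abbreviation nodal_poly :: "nat \<Rightarrow> (nat \<Rightarrow> real) \<Rightarrow> real poly" where
  "nodal_poly N x \<equiv> root_poly N (\<lambda>b. x (2 * b + 1))"

text \<open>The parameter sequences of \<open>Omega_open\<close>, with arbitrary entries from position \<open>2N + 1\<close> on so that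
the set is open.\<close>

definition eqmom_domain :: "nat \<Rightarrow> (nat \<Rightarrow> real) set" where
  "eqmom_domain N = {x. (\<forall>i<N. x (2 * i) > 0) \<and> x (2 * N) > 0 \<and>
     (\<forall>i<N. \<forall>j<N. i \<noteq> j \<longrightarrow> x (2 * i + 1) \<noteq> x (2 * j + 1))}"

lemma mixture_mean_add: "mixture_mean N x (p + q) = mixture_mean N x p + mixture_mean N x q"
  by (simp add: mixture_mean_def heat_add distrib_left sum.distrib)

lemma mixture_mean_smult: "mixture_mean N x (smult c p) = c * mixture_mean N x p"
  by (simp add: mixture_mean_def heat_smult sum_distrib_left mult_ac)

lemma mixture_mean_0 [simp]: "mixture_mean N x 0 = 0"
  by (simp add: mixture_mean_def)

lemma mixture_mean_sum: "mixture_mean N x (sum f A) = (\<Sum>k\<in>A. mixture_mean N x (f k))"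
  by (induction A rule: infinite_finite_induct) (auto simp: mixture_mean_add)

lemma poly_as_smult_monoms:
  "degree p < n \<Longrightarrow> (p :: real poly) = (\<Sum>k<n. smult (coeff p k) (monom 1 k))"
  by (auto simp: poly_eq_iff coeff_sum coeff_eq_0 if_distrib[of "\<lambda>c. _ * c"] sum.delta cong: if_cong)

lemma mixture_mean_conv_moments:
  "degree p < n \<Longrightarrow> mixture_mean N x p = (\<Sum>k<n. coeff p k * mixture_mean N x (monom 1 k))"
  by (subst poly_as_smult_monoms[of p n], assumption)
    (simp only: mixture_mean_sum mixture_mean_smult)

lemma mixture_partial_add:
  "mixture_partial N (p + q) i x = mixture_partial N p i x + mixture_partial N q i x"
  by (simp add: mixture_partial_def heat_add pderiv_add distrib_left add_divide_distrib sum.distrib)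

lemma mixture_partial_smult: "mixture_partial N (smult c p) i x = c * mixture_partial N p i x"
  by (simp add: mixture_partial_def heat_smult pderiv_smult sum_distrib_left algebra_simps)

lemma mixture_partial_sum: "mixture_partial N (sum f A) i x = (\<Sum>k\<in>A. mixture_partial N (f k) i x)"
proof (induction A rule: infinite_finite_induct)
  case (insert a A)
  then show ?case by (simp add: mixture_partial_add)
qed (simp_all add: mixture_partial_def)

lemma has_partials_mixture_mean:
  "has_partials (2 * N + 1) (\<lambda>x. mixture_mean N x p) (mixture_partial N p)"
  unfolding has_partials_def
proof (intro conjI allI impI)
  have coord: "continuous_on UNIV (\<lambda>x :: nat \<Rightarrow> real. x i)" for i
    by (rule continuous_on_product_coordinates)
  show "continuous_on UNIV (\<lambda>x. mixture_mean N x p)"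
    unfolding mixture_mean_def by (intro continuous_intros continuous_on_heat coord)
  show "continuous_on UNIV (mixture_partial N p i)" for i
    unfolding mixture_partial_def[abs_def] by (intro continuous_intros continuous_on_heat coord) auto
  fix x h :: "nat \<Rightarrow> real" and t :: real
  define y where "y = (\<lambda>i. x i + t * h i)"
  have coord: "((\<lambda>t. x i + t * h i) has_real_derivative h i) (at t)" for i
    by (auto intro!: derivative_eq_intros)
  have "((\<lambda>t. mixture_mean N (\<lambda>i. x i + t * h i) p) has_real_derivative
      (\<Sum>b<N. y (2 * b) * (poly (heat (y (2 * N)) (pderiv p)) (y (2 * b + 1)) * h (2 * b + 1) +
        poly (heat (y (2 * N)) (pderiv (pderiv p))) (y (2 * b + 1)) / 2 * h (2 * N)) +
        h (2 * b) * poly (heat (y (2 * N)) p) (y (2 * b + 1)))) (at t)"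
    unfolding mixture_mean_def y_def
    by (intro DERIV_sum DERIV_mult' coord DERIV_poly_heat)
  moreover have "(\<Sum>i<2 * N + 1. mixture_partial N p i y * h i) =
    (\<Sum>b<N. \<Sum>i<2 * N + 1. of_bool (i = 2 * b) * (poly (heat (y (2 * N)) p) (y (2 * b + 1)) * h (2 * b)) +
     of_bool (i = 2 * b + 1) * (y (2 * b) * poly (heat (y (2 * N)) (pderiv p)) (y (2 * b + 1)) * h (2 * b + 1)) +
     of_bool (i = 2 * N) * (y (2 * b) * poly (heat (y (2 * N)) (pderiv (pderiv p))) (y (2 * b + 1)) / 2 * h (2 * N)))"
    unfolding mixture_partial_def sum_distrib_right
    by (subst sum.swap, intro sum.cong refl) (auto simp: algebra_simps of_bool_def)
  moreover have pick: "(\<Sum>i<2 * N + 1. of_bool (i = m) * c) = c" if "m < 2 * N + 1" for m and c :: real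
    using that by (simp add: of_bool_def if_distrib[of "\<lambda>c. c * _"] sum.delta cong: if_cong)
  moreover have "(\<Sum>i<2 * N + 1. of_bool (i = 2 * b) * (poly (heat (y (2 * N)) p) (y (2 * b + 1)) * h (2 * b)) +
     of_bool (i = 2 * b + 1) * (y (2 * b) * poly (heat (y (2 * N)) (pderiv p)) (y (2 * b + 1)) * h (2 * b + 1)) +
     of_bool (i = 2 * N) * (y (2 * b) * poly (heat (y (2 * N)) (pderiv (pderiv p))) (y (2 * b + 1)) / 2 * h (2 * N)))
     = y (2 * b) * (poly (heat (y (2 * N)) (pderiv p)) (y (2 * b + 1)) * h (2 * b + 1) +
        poly (heat (y (2 * N)) (pderiv (pderiv p))) (y (2 * b + 1)) / 2 * h (2 * N)) +
        h (2 * b) * poly (heat (y (2 * N)) p) (y (2 * b + 1))" if "b < N" for b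
    unfolding sum.distrib using that by (simp only: pick) (simp add: algebra_simps)
  ultimately show "((\<lambda>t. mixture_mean N (\<lambda>i. x i + t * h i) p) has_real_derivative
      (\<Sum>i<2 * N + 1. mixture_partial N p i (\<lambda>i. x i + t * h i) * h i)) (at t)"
    by (simp add: y_def)
qed

lemma mixture_partial_weight:
  "b < N \<Longrightarrow> mixture_partial N p (2 * b) x = poly (heat (x (2 * N)) p) (x (2 * b + 1))"
proof -
  assume b: "b < N"
  have "mixture_partial N p (2 * b) x =
      (\<Sum>a<N. if b = a then poly (heat (x (2 * N)) p) (x (2 * a + 1)) else 0)"
    unfolding mixture_partial_def using b by (intro sum.cong) auto
  then show ?thesis using b by simp
qed

lemma mixture_partial_node:
  "b < N \<Longrightarrow> mixture_partial N p (2 * b + 1) x =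
     x (2 * b) * poly (heat (x (2 * N)) (pderiv p)) (x (2 * b + 1))"
proof -
  assume b: "b < N"
  have "mixture_partial N p (2 * b + 1) x =
      (\<Sum>a<N. if b = a then x (2 * a) * poly (heat (x (2 * N)) (pderiv p)) (x (2 * a + 1)) else 0)"
    unfolding mixture_partial_def using b by (intro sum.cong) auto
  then show ?thesis using b by simp
qed

lemma mixture_partial_variance:
  "mixture_partial N p (2 * N) x =
     (\<Sum>b<N. x (2 * b) * poly (heat (x (2 * N)) (pderiv (pderiv p))) (x (2 * b + 1)) / 2)"
  unfolding mixture_partial_def by (intro sum.cong) auto

lemma poly_root_poly [simp]: "poly (root_poly n u) t = (\<Prod>b<n. t - u b)"
  by (simp add: root_poly_def poly_prod)

lemma degree_root_poly [simp]: "degree (root_poly n u) = n"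
  unfolding root_poly_def by (subst degree_prod_eq_sum_degree) auto

lemma root_poly_nonzero [simp]: "root_poly n u \<noteq> 0"
  by (simp add: root_poly_def)

lemma monic_root_poly [simp]: "lead_coeff (root_poly n u) = 1"
  by (simp add: root_poly_def lead_coeff_prod del: degree_root_poly)

lemma root_poly_0 [simp]: "root_poly 0 u = 1"
  by (simp add: root_poly_def)

lemma root_poly_Suc: "root_poly (Suc n) u = [:- u n, 1:] * root_poly n u"
  by (simp only: root_poly_def prod.lessThan_Suc mult.commute)

lemma root_poly_dvd:
  assumes "\<And>b. b < n \<Longrightarrow> poly g (u b) = 0"
    and "\<And>a b. a < n \<Longrightarrow> b < n \<Longrightarrow> a \<noteq> b \<Longrightarrow> u a \<noteq> u b"
  shows "root_poly n u dvd g"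
  using assms
proof (induction n)
  case (Suc n)
  then have "root_poly n u dvd g" by simp
  then obtain r where g: "g = root_poly n u * r" by (elim dvdE)
  have "poly (root_poly n u) (u n) \<noteq> 0" using Suc.prems(2)[of n] by force
  with Suc.prems(1)[of n] have "poly r (u n) = 0" unfolding g by simp
  then obtain r1 where r: "r = [:- u n, 1:] * r1" by (auto simp: poly_eq_0_iff_dvd elim: dvdE)
  show ?case unfolding g r root_poly_Suc by (simp only: dvdI mult_ac dvd_triv_right dvd_triv_left)
qed simp

lemma pderiv_root_poly:
  assumes "b < n"
  shows "poly (pderiv (root_poly n u)) (u b) = (\<Prod>a\<in>{..<n} - {b}. u b - u a)"
proof -
  define \<psi> where "\<psi> = (\<Prod>a\<in>{..<n} - {b}. [:- u a, 1:])"
  have "root_poly n u = [:- u b, 1:] * \<psi>"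
    unfolding root_poly_def \<psi>_def using assms by (intro prod.remove) auto
  then have "poly (pderiv (root_poly n u)) (u b) = poly \<psi> (u b)"
    by (simp only: pderiv_linear_mult) simp
  then show ?thesis by (simp add: \<psi>_def poly_prod)
qed

lemma pderiv_root_poly_nonzero:
  assumes "\<And>a b. a < n \<Longrightarrow> b < n \<Longrightarrow> a \<noteq> b \<Longrightarrow> u a \<noteq> u b" "b < n"
  shows "poly (pderiv (root_poly n u)) (u b) \<noteq> 0"
  using assms by (simp add: pderiv_root_poly)

text \<open>After one division by \<open>\<Prod>b. (x - u b)\<close>, the product rule shows that the quotient vanishes at the same
points again.\<close>

lemma root_poly_square_dvd:
  assumes "\<And>b. b < n \<Longrightarrow> poly g (u b) = 0" "\<And>b. b < n \<Longrightarrow> poly (pderiv g) (u b) = 0"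
    and "\<And>a b. a < n \<Longrightarrow> b < n \<Longrightarrow> a \<noteq> b \<Longrightarrow> u a \<noteq> u b"
  shows "(root_poly n u)\<^sup>2 dvd g"
proof -
  define \<pi> where "\<pi> = root_poly n u"
  have "\<pi> dvd g" unfolding \<pi>_def using assms by (intro root_poly_dvd) auto
  then obtain r where g: "g = \<pi> * r" by (elim dvdE)
  have "poly r (u b) = 0" if b: "b < n" for b
  proof -
    have "poly \<pi> (u b) = 0" using b by (auto simp: \<pi>_def)
    then have "poly (pderiv \<pi>) (u b) * poly r (u b) = 0"
      using assms(2)[OF b] by (simp add: g pderiv_mult mult.commute)
    then show ?thesis using pderiv_root_poly_nonzero[of n u b] assms(3) b by (simp add: \<pi>_def)
  qed
  then have "\<pi> dvd r" unfolding \<pi>_def using assms(3) by (intro root_poly_dvd) auto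
  then show ?thesis unfolding g \<pi>_def[symmetric] power2_eq_square by (rule mult_dvd_mono[OF dvd_refl])
qed

lemma poly_pderiv2_square_mult:
  fixes p r :: "real poly"
  assumes "poly p a = 0"
  shows "poly (pderiv (pderiv (p\<^sup>2 * r))) a = 2 * (poly (pderiv p) a)\<^sup>2 * poly r a"
  using assms by (simp add: power2_eq_square pderiv_mult pderiv_add algebra_simps)

text \<open>The Jacobian of the moment map is nonsingular. If all partial derivatives vanish, the flow \<open>g\<close> of
\<open>p\<close> has double zeros at the \<open>N\<close> nodes, so it is a constant multiple of the squared nodal polynomial.
At the nodes that square has positive second derivatives, so the derivative in the variance is the
constant times a positive number.\<close>

lemma mixture_partial_injective:
  assumes x: "x \<in> eqmom_domain N" and "N > 0"
    and "degree p \<le> 2 * N"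
    and zero: "\<And>i. i < 2 * N + 1 \<Longrightarrow> mixture_partial N p i x = 0"
  shows "p = 0"
proof -
  define g where "g = heat (x (2 * N)) p"
  define \<pi> where "\<pi> = nodal_poly N x"
  have w: "x (2 * b) > 0" if "b < N" for b using x that by (simp add: eqmom_domain_def)
  have distinct: "x (2 * a + 1) \<noteq> x (2 * b + 1)" if "a < N" "b < N" "a \<noteq> b" for a b
    using x that by (simp add: eqmom_domain_def)
  have "poly g (x (2 * b + 1)) = 0" if "b < N" for b
    using zero[of "2 * b"] that by (simp add: mixture_partial_weight g_def)
  moreover have "poly (pderiv g) (x (2 * b + 1)) = 0" if "b < N" for b
    using zero[of "2 * b + 1"] mixture_partial_node[of b N p x] that w[of b]
    by (simp add: g_def flip: heat_pderiv)
  ultimately have "\<pi>\<^sup>2 dvd g" unfolding \<pi>_def by (rule root_poly_square_dvd) (use distinct in auto)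
  then obtain r where g: "g = \<pi>\<^sup>2 * r" by (elim dvdE)
  have "degree r = 0"
  proof (cases "r = 0")
    case False
    then have "degree g = 2 * N + degree r"
      unfolding g by (simp add: degree_mult_eq degree_power_eq \<pi>_def)
    then show ?thesis using \<open>degree p \<le> 2 * N\<close> by (simp add: g_def)
  qed simp
  then obtain c where r: "r = [:c:]" by (metis degree_eq_zeroE)
  have "poly (heat (x (2 * N)) (pderiv (pderiv p))) (x (2 * b + 1)) =
      2 * (poly (pderiv \<pi>) (x (2 * b + 1)))\<^sup>2 * c" if "b < N" for b
    using poly_pderiv2_square_mult[of \<pi> "x (2 * b + 1)" r] that
    by (simp add: heat_pderiv r flip: g_def) (auto simp: g r \<pi>_def)
  then have "(\<Sum>b<N. x (2 * b) * (poly (pderiv \<pi>) (x (2 * b + 1)))\<^sup>2) * c = 0"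
    using zero[of "2 * N"] by (simp add: mixture_partial_variance sum_distrib_right mult.assoc)
  moreover have "(\<Sum>b<N. x (2 * b) * (poly (pderiv \<pi>) (x (2 * b + 1)))\<^sup>2) > 0"
    using w pderiv_root_poly_nonzero[of N "\<lambda>b. x (2 * b + 1)", OF distinct] \<open>N > 0\<close> unfolding \<pi>_def
    by (intro sum_pos) auto
  ultimately have "g = 0" by (simp add: g r)
  then show "p = 0" using heat_inverse(2)[of "x (2 * N)" p] by (simp add: g_def)
qed

section \<open>Moments determine the mixture\<close>

lemma mixture_mean_heat:
  "mixture_mean N x (heat s p) = (\<Sum>b<N. x (2 * b) * poly (heat (x (2 * N) + s) p) (x (2 * b + 1)))"
  by (simp add: mixture_mean_def heat_heat)

lemma nodal_root: "b < N \<Longrightarrow> poly (nodal_poly N x) (x (2 * b + 1)) = 0"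
  by auto

definition same_moments :: "nat \<Rightarrow> (nat \<Rightarrow> real) \<Rightarrow> (nat \<Rightarrow> real) \<Rightarrow> bool" where
  "same_moments N x y \<longleftrightarrow> (\<forall>p. degree p \<le> 2 * N \<longrightarrow> mixture_mean N x p = mixture_mean N y p)"

lemma same_moments_sym: "same_moments N x y \<Longrightarrow> same_moments N y x"
  by (simp add: same_moments_def)

text \<open>The test polynomial is the squared nodal polynomial of \<open>x\<close> with the Gaussian smoothing of \<open>x\<close>
removed. Under \<open>x\<close> it integrates to zero. If \<open>y\<close> had the larger variance, then after removing the
smoothing of \<open>x\<close> it would still be a mixture of Gaussians and integrate the square to a positive
number.\<close>

lemma same_moments_variance_le:
  assumes "same_moments N x y" "\<And>b. b < N \<Longrightarrow> y (2 * b) > 0" "N > 0"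
  shows "y (2 * N) \<le> x (2 * N)"
proof (rule ccontr)
  assume "\<not> y (2 * N) \<le> x (2 * N)"
  then have pos: "y (2 * N) - x (2 * N) > 0" by simp
  define r where "r = (nodal_poly N x)\<^sup>2"
  have "mixture_mean N x (heat (- x (2 * N)) r) = mixture_mean N y (heat (- x (2 * N)) r)"
    using assms(1) by (simp add: same_moments_def r_def degree_power_eq)
  moreover have "mixture_mean N x (heat (- x (2 * N)) r) = 0"
    unfolding mixture_mean_heat by (intro sum.neutral) (auto simp: r_def)
  moreover have "mixture_mean N y (heat (- x (2 * N)) r) > 0"
    unfolding mixture_mean_heat using assms(2,3) pos
    by (intro sum_pos mult_pos_pos) (auto intro!: heat_pos simp: r_def simp flip: diff_conv_add_uminus)
  ultimately show False by simp
qed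

lemma same_moments_variance:
  assumes "same_moments N x y" "N > 0"
    and "\<And>b. b < N \<Longrightarrow> x (2 * b) > 0" "\<And>b. b < N \<Longrightarrow> y (2 * b) > 0"
  shows "x (2 * N) = y (2 * N)"
  using same_moments_variance_le[of N x y] same_moments_variance_le[of N y x] assms
  by (meson antisym same_moments_sym)

text \<open>With equal variances the same test polynomial becomes a sum over the nodes of \<open>y\<close> of nonnegative terms
with sum zero.\<close>

lemma same_moments_nodes:
  assumes "same_moments N x y" "N > 0"
    and "\<And>b. b < N \<Longrightarrow> x (2 * b) > 0" "\<And>b. b < N \<Longrightarrow> y (2 * b) > 0" "b < N"
  shows "poly (nodal_poly N x) (y (2 * b + 1)) = 0"
proof -
  define r where "r = (nodal_poly N x)\<^sup>2"
  have eq: "x (2 * N) = y (2 * N)" using assms by (intro same_moments_variance) auto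
  have "mixture_mean N x (heat (- x (2 * N)) r) = mixture_mean N y (heat (- x (2 * N)) r)"
    using assms(1) by (simp add: same_moments_def r_def degree_power_eq)
  moreover have "mixture_mean N x (heat (- x (2 * N)) r) = 0"
    unfolding mixture_mean_heat by (intro sum.neutral) (auto simp: r_def)
  ultimately have "(\<Sum>b<N. y (2 * b) * poly r (y (2 * b + 1))) = 0"
    by (simp add: mixture_mean_heat eq)
  then have "y (2 * b) * poly r (y (2 * b + 1)) = 0"
    using assms(4,5) by (subst (asm) sum_nonneg_eq_0_iff) (auto simp: r_def less_imp_le)
  then show ?thesis using assms(4)[OF assms(5)] by (simp add: r_def)
qed

text \<open>Without the smoothing, both measures are carried by zeros of the nodal polynomial of \<open>x\<close>. Hence any
polynomial may be reduced modulo it, which leaves degree less than \<open>N\<close>.\<close>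

lemma same_moments_mixture_mean:
  assumes "same_moments N x y" "N > 0"
    and "\<And>b. b < N \<Longrightarrow> x (2 * b) > 0" "\<And>b. b < N \<Longrightarrow> y (2 * b) > 0"
  shows "mixture_mean N x p = mixture_mean N y p"
proof -
  define \<pi> where "\<pi> = nodal_poly N x"
  define q where "q = heat (x (2 * N)) p"
  have eq: "x (2 * N) = y (2 * N)" using assms by (rule same_moments_variance)
  have deg: "degree (q mod \<pi>) \<le> 2 * N"
    using degree_mod_less'[of \<pi> q] \<open>N > 0\<close> by (cases "q mod \<pi> = 0") (auto simp: \<pi>_def)
  have p: "p = heat (- x (2 * N)) q" by (simp add: q_def)
  have reduce: "poly q t = poly (q mod \<pi>) t" if "poly \<pi> t = 0" for t
    using that by (metis add.left_neutral div_mult_mod_eq mult_zero_right poly_add poly_mult)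
  have "mixture_mean N x p = mixture_mean N x (heat (- x (2 * N)) (q mod \<pi>))"
    unfolding p mixture_mean_heat
    using reduce[OF nodal_root[of _ N x, folded \<pi>_def]] by simp
  also have "\<dots> = mixture_mean N y (heat (- x (2 * N)) (q mod \<pi>))"
    using assms(1) deg by (simp add: same_moments_def)
  also have "\<dots> = mixture_mean N y p"
    unfolding p mixture_mean_heat
    using reduce[OF same_moments_nodes[OF assms, folded \<pi>_def]] by (simp add: eq)
  finally show ?thesis .
qed

lemma mixture_mean_cong:
  "(\<And>i. i < 2 * N + 1 \<Longrightarrow> x i = y i) \<Longrightarrow> mixture_mean N x p = mixture_mean N y p"
  unfolding mixture_mean_def by (intro sum.cong refl) simp

lemma eqmom_moment_conv:
  "variance_param N W > 0 \<Longrightarrow> eqmom_moment N W j = mixture_mean N (vec_index W) (monom 1 j)"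
  by (simp add: eqmom_moment_def mixture_mean_def weight_def node_def variance_param_def
      gauss_moment_eq_heat)

lemma same_moments_if_moment_map_eq:
  assumes "moment_map N W = moment_map N W'" "variance_param N W > 0" "variance_param N W' > 0"
  shows "same_moments N (vec_index W) (vec_index W')"
  unfolding same_moments_def
proof (intro allI impI)
  fix p :: "real poly" assume "degree p \<le> 2 * N"
  then have deg: "degree p < 2 * N + 1" by simp
  have "eqmom_moment N W j = eqmom_moment N W' j" if "j < 2 * N + 1" for j
    using arg_cong[OF assms(1), of "\<lambda>v. v $ j"] that by (simp add: moment_map_def)
  then show "mixture_mean N (vec_index W) p = mixture_mean N (vec_index W') p"
    using assms(2,3) by (simp add: mixture_mean_conv_moments[OF deg] eqmom_moment_conv)
qed

lemma Omega_open_iff: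
  "W \<in> Omega_open N \<longleftrightarrow> W \<in> carrier_vec (2 * N + 1) \<and> vec_index W \<in> eqmom_domain N"
  by (auto simp: Omega_open_def eqmom_domain_def weight_def node_def variance_param_def)

lemma M_bar_moment_map:
  assumes "W \<in> Omega_open N" "N > 0"
  shows "M_bar N (moment_map N W) = mixture_mean N (vec_index W) (monom 1 (2 * N + 1))"
proof -
  define W' where "W' = (SOME V. V \<in> Omega_open N \<and> moment_map N V = moment_map N W)"
  have W': "W' \<in> Omega_open N" "moment_map N W' = moment_map N W"
    unfolding W'_def using someI[of "\<lambda>V. V \<in> Omega_open N \<and> moment_map N V = moment_map N W" W] assms by auto
  have "same_moments N (vec_index W') (vec_index W)"
    using assms(1) W' by (intro same_moments_if_moment_map_eq) (auto simp: Omega_open_def)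
  then have "mixture_mean N (vec_index W') p = mixture_mean N (vec_index W) p" for p
    by (rule same_moments_mixture_mean)
      (use assms W'(1) in \<open>auto simp: Omega_open_iff eqmom_domain_def\<close>)
  moreover have "variance_param N W' > 0" using W'(1) by (simp add: Omega_open_def)
  ultimately show ?thesis
    unfolding M_bar_def W'_def[symmetric] by (simp only: eqmom_moment_conv)
qed

text \<open>Equal moments would place all the distinct nodes of one parameter vector at the single node of the
other.\<close>

lemma Omega_images_disjoint:
  assumes "N \<ge> 2"
  shows "moment_map N ` Omega_open N \<inter> moment_map N ` Omega_eq N = {}"
proof (rule ccontr)
  assume "moment_map N ` Omega_open N \<inter> moment_map N ` Omega_eq N \<noteq> {}"
  then obtain W V where W: "W \<in> Omega_open N" and V: "V \<in> Omega_eq N"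
    and eq: "moment_map N W = moment_map N V" by auto
  have "same_moments N (vec_index V) (vec_index W)"
    using W V eq by (intro same_moments_if_moment_map_eq) (auto simp: Omega_open_def Omega_eq_def)
  then have root: "poly (nodal_poly N (vec_index V)) (node W b) = 0" if "b < N" for b
    unfolding node_def
    by (rule same_moments_nodes)
      (use assms W V that in \<open>auto simp: Omega_open_def Omega_eq_def weight_def\<close>)
  have "node W b = node V 0" if b: "b < N" for b
  proof -
    obtain a where a: "a < N" "node W b = node V a"
      using root[OF b] by (auto simp: node_def)
    have "0 < N" using assms by simp
    then have "node V a = node V 0" using V a(1) unfolding Omega_eq_def by blast
    with a(2) show ?thesis by simp
  qed
  from this[of 0] this[of 1] have "node W 0 = node W 1" using assms by simp
  moreover have "node W 0 \<noteq> node W 1"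
    using W assms by (simp add: Omega_open_def)
  ultimately show False by simp
qed

lemma open_eqmom_domain: "open (eqmom_domain N)"
proof -
  have coord: "continuous_on UNIV (\<lambda>x :: nat \<Rightarrow> real. x i)" for i
    by (rule continuous_on_product_coordinates)
  have all: "open {x :: nat \<Rightarrow> real. \<forall>i<N. P i x}" if "\<And>i. i < N \<Longrightarrow> open {x. P i x}" for P
  proof -
    have "{x. \<forall>i<N. P i x} = (\<Inter>i\<in>{..<N}. {x. P i x})" by blast
    then show ?thesis using that by (simp only:) (intro open_INT, auto)
  qed
  have "open {x :: nat \<Rightarrow> real. i \<noteq> j \<longrightarrow> x (2 * i + 1) \<noteq> x (2 * j + 1)}" for i j
    by (cases "i = j") (auto intro: open_Collect_neq coord)
  then show ?thesis
    unfolding eqmom_domain_def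
    by (intro open_Collect_conj all open_Collect_less continuous_on_const coord)
qed

section \<open>The differential of the closure\<close>

text \<open>Write \<open>\<langle>p\<rangle>\<close> for the mixture mean. As \<open>c\<close> is monic, \<open>M\<^sub>2\<^sub>N\<^sub>+\<^sub>1 = \<langle>c\<rangle> - (\<Sum>k\<le>2N. c\<^sub>k M\<^sub>k)\<close>. The
parameters are a critical point of \<open>\<langle>c\<rangle>\<close>, so only the linear combination contributes to first
order.\<close>

lemma closure_coeff_eq:
  assumes W: "W \<in> Omega_open N" and "N > 0" and "j < 2 * N + 1"
    and c: "degree c = 2 * N + 1" "lead_coeff c = 1"
      "\<And>i. i < 2 * N + 1 \<Longrightarrow> mixture_partial N c i (vec_index W) = 0"
  shows "closure_coeff N (moment_map N W) j = - coeff c j"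
proof -
  define n where "n = 2 * N + 1"
  define M where "M = moment_map N W"
  define x0 where "x0 = vec_index W"
  have x0: "x0 \<in> eqmom_domain N" using W by (simp add: Omega_open_iff x0_def)
  have M: "M $ k = mixture_mean N x0 (monom 1 k)" if "k < n" for k
    using W that by (simp add: M_def moment_map_def n_def eqmom_moment_conv Omega_open_def x0_def)
  have dimM: "dim_vec M = n" by (simp add: M_def moment_map_def n_def)
  have partials: "has_partials n (\<lambda>x. mixture_mean N x p) (mixture_partial N p)" for p
    unfolding n_def by (rule has_partials_mixture_mean)
  have jn: "j < n" using \<open>j < 2 * N + 1\<close> by (simp add: n_def)
  have inj: "\<forall>k<n. d k = 0"
    if x: "x \<in> eqmom_domain N"
    and 0: "\<forall>i<n. (\<Sum>k<n. d k * mixture_partial N (monom 1 k) i x) = 0" for x and d :: "nat \<Rightarrow> real"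
  proof -
    define p where "p = (\<Sum>k<n. smult (d k) (monom 1 k))"
    have "degree p \<le> 2 * N" unfolding p_def
      by (intro degree_sum_le order.trans[OF degree_smult_le])
        (auto simp: n_def degree_monom_eq)
    moreover have "mixture_partial N p i x = 0" if "i < 2 * N + 1" for i
      using 0 that unfolding n_def[symmetric] p_def mixture_partial_sum mixture_partial_smult by blast
    ultimately have "p = 0" using mixture_partial_injective[OF x \<open>N > 0\<close>] by blast
    moreover have "coeff p k = d k" if "k < n" for k
      using that by (simp add: p_def coeff_sum if_distrib[of "\<lambda>c. _ * c"] sum.delta cong: if_cong)
    ultimately show ?thesis by simp
  qed
  have split: "mixture_mean N x (monom 1 n) =
      mixture_mean N x c - (\<Sum>k<n. coeff c k * mixture_mean N x (monom 1 k))" for x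
    using mixture_mean_conv_moments[of c "Suc n" N x] c(1,2) by (simp add: n_def)
  have "((\<lambda>t. M_bar N (M |\<^sub>v j \<mapsto> t)) has_real_derivative (- coeff c j)) (at (M $ j))"
    unfolding DERIV_def LIM_eq
  proof (intro allI impI)
    fix r :: real assume "r > 0"
    then have "r / 2 > 0" by simp
    obtain \<delta> where \<delta>: "\<delta> > 0" "\<And>y. (\<Sum>k<n. \<bar>y k - mixture_mean N x0 (monom 1 k)\<bar>) < \<delta> \<Longrightarrow>
      (\<exists>x \<in> eqmom_domain N. (\<forall>k<n. mixture_mean N x (monom 1 k) = y k) \<and> (\<forall>i\<ge>n. x i = x0 i) \<and>
       \<bar>mixture_mean N x c - mixture_mean N x0 c\<bar> \<le> r / 2 * (\<Sum>k<n. \<bar>y k - mixture_mean N x0 (monom 1 k)\<bar>))"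
      by (rule critical_change_negligible[of n "\<lambda>k x. mixture_mean N x (monom 1 k)"
          "\<lambda>k. mixture_partial N (monom 1 k)" "eqmom_domain N" x0
          "\<lambda>x. mixture_mean N x c" "mixture_partial N c" "r / 2",
          OF partials inj open_eqmom_domain x0 partials _ \<open>r / 2 > 0\<close>])
        (use c(3) in \<open>auto simp: n_def x0_def\<close>)
    show "\<exists>s>0. \<forall>h. h \<noteq> 0 \<and> norm (h - 0) < s \<longrightarrow>
        norm ((M_bar N (M |\<^sub>v j \<mapsto> (M $ j + h)) - M_bar N (M |\<^sub>v j \<mapsto> (M $ j))) / h - (- coeff c j)) < r"
    proof (intro exI[of _ \<delta>] conjI allI impI \<delta>(1))
      fix h :: real assume h: "h \<noteq> 0 \<and> norm (h - 0) < \<delta>"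
      \<comment> \<open>Only the \<open>j\<close>-th moment moves, so the target differs from \<open>F x0\<close> by \<open>\<bar>h\<bar>\<close> in total.\<close>
      define y where "y = (\<lambda>k. M $ k + h * of_bool (k = j))"
      have "(\<Sum>k<n. \<bar>y k - mixture_mean N x0 (monom 1 k)\<bar>) = (\<Sum>k<n. \<bar>h\<bar> * of_bool (k = j))"
        by (intro sum.cong) (auto simp: y_def M)
      also have "\<dots> = \<bar>h\<bar>"
        using jn by (simp add: of_bool_def if_distrib[of "\<lambda>c. _ * c"] sum.delta cong: if_cong)
      finally have dist: "(\<Sum>k<n. \<bar>y k - mixture_mean N x0 (monom 1 k)\<bar>) = \<bar>h\<bar>" .
      obtain x where x: "x \<in> eqmom_domain N" "\<And>k. k < n \<Longrightarrow> mixture_mean N x (monom 1 k) = y k"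
        "\<bar>mixture_mean N x c - mixture_mean N x0 c\<bar> \<le> r / 2 * \<bar>h\<bar>"
        using \<delta>(2)[of y] h unfolding dist by auto
      define V where "V = vec n x"
      have V: "V \<in> Omega_open N"
        using x(1) by (auto simp: Omega_open_iff V_def n_def eqmom_domain_def)
      have meanV: "mixture_mean N (vec_index V) p = mixture_mean N x p" for p
        by (rule mixture_mean_cong) (simp add: V_def n_def)
      have "moment_map N V = M |\<^sub>v j \<mapsto> (M $ j + h)"
        using V x(2) dimM
        by (intro eq_vecI)
          (auto simp: moment_map_def update_vec_def n_def eqmom_moment_conv Omega_open_def meanV y_def)
      then have 1: "M_bar N (M |\<^sub>v j \<mapsto> (M $ j + h)) = mixture_mean N x (monom 1 n)"
        using M_bar_moment_map[OF V \<open>N > 0\<close>] by (simp add: meanV n_def)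
      have "M |\<^sub>v j \<mapsto> (M $ j) = M" by (intro eq_vecI) (auto simp: update_vec_def)
      then have 2: "M_bar N (M |\<^sub>v j \<mapsto> (M $ j)) = mixture_mean N x0 (monom 1 n)"
        using M_bar_moment_map[OF W \<open>N > 0\<close>] by (simp add: M_def x0_def n_def)
      have "(\<Sum>k<n. coeff c k * y k) = (\<Sum>k<n. coeff c k * M $ k) + coeff c j * h"
        using jn
        by (simp add: y_def distrib_left sum.distrib of_bool_def if_distrib[of "\<lambda>c. _ * c"] sum.delta
            cong: if_cong)
      then have "M_bar N (M |\<^sub>v j \<mapsto> (M $ j + h)) - M_bar N (M |\<^sub>v j \<mapsto> (M $ j)) =
          mixture_mean N x c - mixture_mean N x0 c - coeff c j * h"
        unfolding 1 2 split using x(2) M by simp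
      then have "(M_bar N (M |\<^sub>v j \<mapsto> (M $ j + h)) - M_bar N (M |\<^sub>v j \<mapsto> (M $ j))) / h - (- coeff c j) =
          (mixture_mean N x c - mixture_mean N x0 c) / h"
        using h by (simp add: field_simps)
      also have "norm \<dots> \<le> r / 2" using x(3) h by (simp add: abs_divide field_simps)
      finally show "norm ((M_bar N (M |\<^sub>v j \<mapsto> (M $ j + h)) - M_bar N (M |\<^sub>v j \<mapsto> (M $ j))) / h - (- coeff c j)) < r"
        using \<open>r > 0\<close> by simp
    qed
  qed
  then have "deriv (\<lambda>t. M_bar N (M |\<^sub>v j \<mapsto> t)) (M $ j) = - coeff c j" by (rule DERIV_imp_deriv)
  moreover have "M \<in> moment_map N ` Omega_open N" using W by (simp add: M_def)
  ultimately show ?thesis by (simp add: closure_coeff_def flip: M_def)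
qed

text \<open>Criticality in the weights and nodes asks for double zeros at the nodes, which leaves one further root
\<open>v\<close>. Criticality in the variance is a linear equation for \<open>v\<close>; its solution is a weighted mean of
the nodes.\<close>

lemma exists_critical_poly:
  assumes x: "x \<in> eqmom_domain N" and "N > 0"
  obtains v where "\<And>i. i < 2 * N + 1 \<Longrightarrow>
    mixture_partial N (heat (- x (2 * N)) ((nodal_poly N x)\<^sup>2 * [:- v, 1:])) i x = 0"
proof -
  define \<pi> where "\<pi> = nodal_poly N x"
  have w: "x (2 * b) > 0" if "b < N" for b using x that by (simp add: eqmom_domain_def)
  have distinct: "x (2 * a + 1) \<noteq> x (2 * b + 1)" if "a < N" "b < N" "a \<noteq> b" for a b
    using x that by (simp add: eqmom_domain_def)
  define \<omega> where "\<omega> = (\<lambda>b. x (2 * b) * (poly (pderiv \<pi>) (x (2 * b + 1)))\<^sup>2)"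
  have pos: "(\<Sum>b<N. \<omega> b) > 0"
    using w pderiv_root_poly_nonzero[of N "\<lambda>b. x (2 * b + 1)", OF distinct] \<open>N > 0\<close> unfolding \<pi>_def \<omega>_def
    by (intro sum_pos) auto
  define v where "v = (\<Sum>b<N. \<omega> b * x (2 * b + 1)) / (\<Sum>b<N. \<omega> b)"
  define g where "g = \<pi>\<^sup>2 * [:- v, 1:]"
  define c where "c = heat (- x (2 * N)) g"
  have root: "poly \<pi> (x (2 * b + 1)) = 0" if "b < N" for b using that by (auto simp: \<pi>_def)
  have pderiv_g: "poly (pderiv g) a = 0" if "poly \<pi> a = 0" for a
    unfolding g_def power2_eq_square mult.assoc pderiv_mult[of \<pi>]
    by (simp only: poly_add poly_mult that)
  have "mixture_partial N c i x = 0" if "i < 2 * N + 1" for i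
  proof -
    consider b where "b < N" "i = 2 * b" | b where "b < N" "i = 2 * b + 1" | "i = 2 * N"
    proof (cases "i = 2 * N")
      case False
      then have "i div 2 < N" "i = 2 * (i div 2) \<or> i = 2 * (i div 2) + 1" using \<open>i < 2 * N + 1\<close> by auto
      then show ?thesis using that(1,2) by blast
    qed (use that in blast)
    then show ?thesis
    proof cases
      case 1
      then show ?thesis using root[of b] by (simp add: mixture_partial_weight c_def g_def)
    next
      case 2
      then show ?thesis using pderiv_g[OF root[of b]] mixture_partial_node[of b N c x]
        by (simp add: c_def heat_pderiv)
    next
      case 3
      have "poly (heat (x (2 * N)) (pderiv (pderiv c))) (x (2 * b + 1)) =
          2 * (poly (pderiv \<pi>) (x (2 * b + 1)))\<^sup>2 * (x (2 * b + 1) - v)" if "b < N" for b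
        using poly_pderiv2_square_mult[OF root[OF that], of "[:- v, 1:]"]
        by (simp add: c_def heat_pderiv g_def)
      then have "mixture_partial N c i x = (\<Sum>b<N. \<omega> b * x (2 * b + 1) - \<omega> b * v)"
        unfolding 3 mixture_partial_variance
        by (intro sum.cong refl) (simp add: \<omega>_def right_diff_distrib mult.assoc mult.left_commute)
      also have "\<dots> = (\<Sum>b<N. \<omega> b * x (2 * b + 1)) - (\<Sum>b<N. \<omega> b) * v"
        by (simp add: sum_subtractf sum_distrib_right)
      also have "\<dots> = 0" using pos by (simp add: v_def)
      finally show ?thesis .
    qed
  qed
  then show ?thesis by (intro that) (simp add: c_def g_def \<pi>_def)
qed

section \<open>Backward heat flow makes real roots simple\<close>

definition real_simple_roots :: "nat \<Rightarrow> real poly \<Rightarrow> bool" where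
  "real_simple_roots n f \<longleftrightarrow> (\<exists>z. strict_mono_on {..<n} z \<and> f = root_poly n z)"

lemma monic_dvd_linear_cofactor:
  fixes F :: "real poly"
  assumes "root_poly n r dvd F" "degree F = Suc n" "lead_coeff F = 1"
  obtains r0 where "F = [:- r0, 1:] * root_poly n r"
proof -
  obtain q where F: "F = root_poly n r * q" using assms(1) by (elim dvdE)
  have "q \<noteq> 0" using assms(3) F by auto
  then have "degree q = 1" using assms(2) by (simp add: F degree_mult_eq)
  have "lead_coeff q = 1"
    using assms(3) lead_coeff_mult[of "root_poly n r" q, folded F] monic_root_poly[of n r]
    by (metis mult_1)
  have "coeff q k = coeff [:coeff q 0, 1:] k" for k
  proof -
    consider "k = 0" | "k = 1" | "k > 1" by linarith
    then show ?thesis using \<open>degree q = 1\<close> \<open>lead_coeff q = 1\<close>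
      by cases (auto simp: coeff_eq_0)
  qed
  then have "q = [:coeff q 0, 1:]" by (rule poly_eqI)
  with F have "F = root_poly n r * [:coeff q 0, 1:]" by (rule subst[of q _ "\<lambda>q. F = root_poly n r * q", rotated])
  then show ?thesis by (intro that[of "- coeff q 0"]) (simp only: minus_minus mult.commute)
qed

text \<open>At a root of \<open>f\<close> the new polynomial has the value \<open>- s f'\<close>, and these values alternate in sign. This
gives a root in each gap between roots of \<open>f\<close> and, since the new polynomial is positive far to the right
and negative at the last root of \<open>f\<close>, one more beyond it. The remaining linear factor is real, and the
sign at the first root of \<open>f\<close> puts its root to the left of all the others.\<close>

lemma real_simple_roots_heat_step:
  assumes "real_simple_roots n f" "s > 0"
  shows "real_simple_roots (Suc n) ([:- a, 1:] * f - smult s (pderiv f))"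
proof -
  define F where "F = [:- a, 1:] * f - smult s (pderiv f)"
  obtain y where y: "strict_mono_on {..<n} y" and f: "f = root_poly n y"
    using assms(1) unfolding real_simple_roots_def by blast
  have y_less: "y i < y j" if "i < j" "j < n" for i j
    by (rule strict_mono_onD[OF y]) (use that in auto)
  have y_neq: "y i \<noteq> y j" if "i < n" "j < n" "i \<noteq> j" for i j
    using y_less[of i j] y_less[of j i] that by (cases "i < j") auto
  have degf: "degree f = n" and "f \<noteq> 0" and monic: "lead_coeff f = 1" by (simp_all add: f del: degree_root_poly) (simp add: f)
  have degF: "degree F = Suc n"
  proof -
    have "degree ([:- a, 1:] * f) = Suc n" using \<open>f \<noteq> 0\<close> by (subst degree_mult_eq) (auto simp: degf)
    moreover have "degree (smult s (pderiv f)) < Suc n"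
      using degree_smult_le[of s "pderiv f"] by (simp add: degree_pderiv degf)
    ultimately show ?thesis
      unfolding F_def diff_conv_add_uminus by (subst degree_add_eq_left) auto
  qed
  have monicF: "lead_coeff F = 1"
    unfolding degF using monic by (simp add: F_def coeff_pderiv degf coeff_eq_0)
  have F_at: "poly F (y k) = - s * (\<Prod>i\<in>{..<n} - {k}. y k - y i)" if "k < n" for k
    using pderiv_root_poly[OF that, of y] that by (simp add: F_def f) (meson finite_lessThan lessThan_iff prod_zero_iff right_minus_eq)
  obtain Z where Z: "Z > y (n - 1)" "poly F Z > 0"
  proof -
    obtain m where "\<forall>x\<ge>m. poly F x \<ge> lead_coeff F" using poly_pinfty_gt_lc[of F] monicF by auto
    then have "poly F (max m (y (n - 1) + 1)) > 0" using monicF by (smt (verit) max.cobounded1)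
    then show ?thesis by (intro that[of "max m (y (n - 1) + 1)"]) auto
  qed
  \<comment> \<open>The roots of \<open>f\<close>, continued by a point where the new polynomial is positive.\<close>
  define z where "z = (\<lambda>k. if k < n then y k else Z)"
  have sign: "poly F (z k) * poly F (z (Suc k)) < 0" if k: "k < n" for k
  proof (cases "Suc k < n")
    case True
    define R where "R = {..<n} - {k, Suc k}"
    have R: "{..<n} - {k} - {Suc k} = R" "{..<n} - {Suc k} - {k} = R" by (auto simp: R_def)
    have "(\<Prod>i\<in>{..<n} - {k}. y k - y i) = (y k - y (Suc k)) * (\<Prod>i\<in>R. y k - y i)"
      using prod.remove[of "{..<n} - {k}" "Suc k" "\<lambda>i. y k - y i"] True by (simp add: R)
    moreover have "(\<Prod>i\<in>{..<n} - {Suc k}. y (Suc k) - y i) = (y (Suc k) - y k) * (\<Prod>i\<in>R. y (Suc k) - y i)"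
      using prod.remove[of "{..<n} - {Suc k}" k "\<lambda>i. y (Suc k) - y i"] True by (simp add: R)
    ultimately have "poly F (y k) * poly F (y (Suc k)) =
        s\<^sup>2 * ((y k - y (Suc k)) * (y (Suc k) - y k)) *
        ((\<Prod>i\<in>R. y k - y i) * (\<Prod>i\<in>R. y (Suc k) - y i))"
      using F_at[of k] F_at[of "Suc k"] True by (simp add: power2_eq_square)
    moreover have "(\<Prod>i\<in>R. y k - y i) * (\<Prod>i\<in>R. y (Suc k) - y i) > 0"
      unfolding prod.distrib[symmetric]
    proof (rule prod_pos)
      fix i assume "i \<in> R"
      then have "i < k \<or> (Suc k < i \<and> i < n)" by (auto simp: R_def)
      then show "0 < (y k - y i) * (y (Suc k) - y i)"
        using y_less[of i k] y_less[of i "Suc k"] y_less[of k i] y_less[of "Suc k" i] True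
        by (auto intro: mult_pos_pos mult_neg_neg)
    qed
    moreover have "(y k - y (Suc k)) * (y (Suc k) - y k) < 0"
      using y_less[of k "Suc k"] True by (intro mult_neg_pos) auto
    ultimately have "poly F (y k) * poly F (y (Suc k)) < 0"
      using \<open>s > 0\<close> by (simp add: mult_pos_neg mult_neg_pos)
    then show ?thesis using True by (simp add: z_def)
  next
    case False
    then have [simp]: "n = Suc k" using k by simp
    have "(\<Prod>i\<in>{..<n} - {k}. y k - y i) > 0" using y_less by (intro prod_pos) auto
    then have "poly F (y k) < 0" using F_at[of k] \<open>s > 0\<close> by (simp add: mult_pos_pos)
    then show ?thesis using Z(2) by (simp add: z_def mult_neg_pos)
  qed
  have z_less: "z k < z (Suc k)" if "k < n" for k
    using that y_less[of k "Suc k"] Z(1) by (cases "Suc k = n") (auto simp: z_def)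
  have "\<exists>r. \<forall>k<n. z k < r k \<and> r k < z (Suc k) \<and> poly F (r k) = 0"
    using poly_IVT[OF z_less sign] by metis
  then obtain r where r: "\<And>k. k < n \<Longrightarrow> z k < r k" "\<And>k. k < n \<Longrightarrow> r k < z (Suc k)"
    "\<And>k. k < n \<Longrightarrow> poly F (r k) = 0" by blast
  have r_less: "r i < r j" if "i < j" "j < n" for i j
  proof -
    have "z (Suc i) \<le> z j" using that y_less[of "Suc i" j] by (cases "Suc i = j") (auto simp: z_def)
    then show ?thesis using r(2)[of i] r(1)[of j] that by simp
  qed
  have r_neq: "r i \<noteq> r j" if "i < n" "j < n" "i \<noteq> j" for i j
    using r_less[of i j] r_less[of j i] that by (cases "i < j") auto
  have "root_poly n r dvd F" using r(3) r_neq by (rule root_poly_dvd)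
  then obtain r0 where F: "F = [:- r0, 1:] * root_poly n r"
    using degF monicF by (rule monic_dvd_linear_cofactor)
  have r0: "r0 < r 0" if "n > 0"
  proof -
    have "poly F (y 0) = (y 0 - r0) * (\<Prod>i<n. y 0 - r i)" by (simp add: F left_diff_distrib)
    moreover have "(\<Prod>i<n. y 0 - r i) = (- 1) ^ n * (\<Prod>i<n. r i - y 0)"
      using prod_uminus[of "\<lambda>i. r i - y 0" "{..<n}"] by simp
    moreover have "(\<Prod>i\<in>{..<n} - {0}. y 0 - y i) = (- 1) ^ (n - 1) * (\<Prod>i\<in>{..<n} - {0}. y i - y 0)"
      using prod_uminus[of "\<lambda>i. y i - y 0" "{..<n} - {0}"] that by simp
    moreover have "(- 1 :: real) ^ n = - ((- 1) ^ (n - 1))" using that by (cases n) auto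
    ultimately have "(y 0 - r0) * (\<Prod>i<n. r i - y 0) = s * (\<Prod>i\<in>{..<n} - {0}. y i - y 0)"
      using F_at[OF that] by simp
    moreover have "s * (\<Prod>i\<in>{..<n} - {0}. y i - y 0) > 0"
      using y_less \<open>s > 0\<close> by (intro mult_pos_pos prod_pos) auto
    moreover have "(\<Prod>i<n. r i - y 0) > 0"
    proof (rule prod_pos)
      fix i assume "i \<in> {..<n}"
      then show "0 < r i - y 0"
        using r(1)[of i] y_less[of 0 i] by (cases "i = 0") (auto simp: z_def)
    qed
    ultimately have "y 0 - r0 > 0" by (metis zero_less_mult_pos2)
    moreover have "y 0 < r 0" using r(1)[OF that] that by (simp add: z_def)
    ultimately show ?thesis by simp
  qed
  define w where "w = (\<lambda>k. case k of 0 \<Rightarrow> r0 | Suc k \<Rightarrow> r k)"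
  have "strict_mono_on {..<Suc n} w"
  proof (rule strict_mono_onI)
    fix i j assume ij: "i \<in> {..<Suc n}" "j \<in> {..<Suc n}" "i < j"
    then obtain j' where j: "j = Suc j'" "j' < n" by (cases j) auto
    have "r0 < r j'" using r0 r_less[of 0 j'] j by (cases "j' = 0") auto
    then show "w i < w j" using ij j r_less by (auto simp: w_def split: nat.split)
  qed
  moreover have "F = root_poly (Suc n) w"
    unfolding F root_poly_def by (simp add: prod.lessThan_Suc_shift w_def del: prod.lessThan_Suc mult_pCons_left)
  ultimately show ?thesis unfolding F_def[symmetric] real_simple_roots_def by blast
qed

text \<open>Adding one linear factor at a time, the commutator rule \<open>heat_linear_mult\<close> at time \<open>- s\<close> is the
preceding step. The roots \<open>a\<close> may coincide; positive \<open>s\<close> separates them.\<close>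

lemma real_simple_roots_heat_root_poly:
  assumes "s > 0"
  shows "real_simple_roots n (heat (- s) (root_poly n a))"
proof (induction n)
  case 0
  then show ?case unfolding real_simple_roots_def by (intro exI[of _ a]) (simp add: strict_mono_on_def)
next
  case (Suc n)
  from real_simple_roots_heat_step[OF this assms, of "a n"] show ?case
    by (simp add: root_poly_Suc heat_linear_mult heat_pderiv del: mult_pCons_left)
qed

lemma root_poly_square: "(root_poly n u)\<^sup>2 = root_poly (2 * n) (\<lambda>i. u (i div 2))"
proof (induction n)
  case (Suc n)
  have "root_poly (2 * Suc n) (\<lambda>i. u (i div 2)) =
      [:- u n, 1:] * ([:- u n, 1:] * root_poly (2 * n) (\<lambda>i. u (i div 2)))"
    by (simp add: root_poly_Suc del: mult_pCons_left)
  then show ?case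
    by (simp only: root_poly_Suc power_mult_distrib Suc.IH) (simp only: power2_eq_square mult.assoc)
qed simp

section \<open>Congruences and symmetrizers\<close>

lemma invertible_mat_if_inverse:
  fixes B :: "real mat"
  assumes "B \<in> carrier_mat n n" "C \<in> carrier_mat n n" "B * C = 1\<^sub>m n" "C * B = 1\<^sub>m n"
  shows "invertible_mat B"
  using assms unfolding invertible_mat_def inverts_mat_def by auto

lemma invertible_mat_mult_vec_nonzero:
  fixes B :: "real mat"
  assumes "B \<in> carrier_mat n n" "invertible_mat B" "v \<in> carrier_vec n" "v \<noteq> 0\<^sub>v n"
  shows "B *\<^sub>v v \<noteq> 0\<^sub>v n"
proof
  assume 0: "B *\<^sub>v v = 0\<^sub>v n"
  obtain C where C: "B * C = 1\<^sub>m (dim_row B)" "C * B = 1\<^sub>m (dim_row C)"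
    using assms(2) by (auto simp: invertible_mat_def inverts_mat_def)
  have "dim_col C = n" using arg_cong[OF C(1), of dim_col] assms(1) by simp
  moreover have "dim_row C = n" using arg_cong[OF C(2), of dim_col] assms(1) by simp
  ultimately have "C \<in> carrier_mat n n" by auto
  then have "v = C *\<^sub>v (B *\<^sub>v v)"
    using assms C(2) assoc_mult_mat_vec[of C n n B n v] by simp
  also have "\<dots> = 0\<^sub>v n" unfolding 0 using \<open>C \<in> carrier_mat n n\<close> by auto
  finally show False using assms(4) by simp
qed

lemma quadratic_form_congruence:
  fixes P D :: "real mat"
  assumes "P \<in> carrier_mat n n" "D \<in> carrier_mat n n" "v \<in> carrier_vec n"
  shows "v \<bullet> ((P\<^sup>T * D * P) *\<^sub>v v) = (P *\<^sub>v v) \<bullet> (D *\<^sub>v (P *\<^sub>v v))"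
proof -
  have "(P\<^sup>T * D * P) *\<^sub>v v = P\<^sup>T *\<^sub>v (D *\<^sub>v (P *\<^sub>v v))"
    using assms by (simp add: assoc_mult_mat_vec[of _ n n _ n])
  then have "v \<bullet> ((P\<^sup>T * D * P) *\<^sub>v v) = (P\<^sup>T *\<^sub>v (D *\<^sub>v (P *\<^sub>v v))) \<bullet> v"
    using assms by (simp add: comm_scalar_prod[of _ n])
  also have "\<dots> = (D *\<^sub>v (P *\<^sub>v v)) \<bullet> (P *\<^sub>v v)"
    using assms by (intro transpose_vec_mult_scalar) auto
  also have "\<dots> = (P *\<^sub>v v) \<bullet> (D *\<^sub>v (P *\<^sub>v v))"
    using assms by (intro comm_scalar_prod[of _ n]) auto
  finally show ?thesis .
qed

lemma transpose_congruence:
  fixes P D :: "real mat"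
  assumes "P \<in> carrier_mat n n" "D \<in> carrier_mat n n" "D\<^sup>T = D"
  shows "(P\<^sup>T * D * P)\<^sup>T = P\<^sup>T * D * P"
  using assms by (simp add: transpose_mult[of _ n n _ n] assoc_mult_mat[of _ n n _ n _ n])

definition real_diag :: "nat \<Rightarrow> (nat \<Rightarrow> real) \<Rightarrow> real mat" where
  "real_diag n d = mat n n (\<lambda>(i, j). if i = j then d i else 0)"

lemma real_diag_carrier [simp]: "real_diag n d \<in> carrier_mat n n"
  by (simp add: real_diag_def)

lemma transpose_real_diag [simp]: "(real_diag n d)\<^sup>T = real_diag n d"
  by (auto simp: real_diag_def)

lemma index_mult_square_mat:
  "A \<in> carrier_mat n n \<Longrightarrow> B \<in> carrier_mat n n \<Longrightarrow> k < n \<Longrightarrow> j < n \<Longrightarrow>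
     (A * B) $$ (k, j) = (\<Sum>i<n. A $$ (k, i) * B $$ (i, j))"
  by (simp add: scalar_prod_def lessThan_atLeast0)

lemma real_diag_mult_index:
  assumes "B \<in> carrier_mat n n" "k < n" "j < n"
  shows "(real_diag n d * B) $$ (k, j) = d k * B $$ (k, j)"
proof -
  have "(real_diag n d * B) $$ (k, j) = (\<Sum>i<n. real_diag n d $$ (k, i) * B $$ (i, j))"
    using assms by (intro index_mult_square_mat) auto
  also have "\<dots> = (\<Sum>i<n. if i = k then d k * B $$ (k, j) else 0)"
    using assms by (intro sum.cong) (auto simp: real_diag_def)
  finally show ?thesis using assms(2) by simp
qed

lemma real_diag_mult_vec:
  "v \<in> carrier_vec n \<Longrightarrow> real_diag n d *\<^sub>v v = vec n (\<lambda>i. d i * v $ i)"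
  by (intro eq_vecI) (auto simp: real_diag_def scalar_prod_def if_distrib[of "\<lambda>c. c * _"] sum.delta cong: if_cong)

lemma quadratic_form_real_diag:
  "v \<in> carrier_vec n \<Longrightarrow> v \<bullet> (real_diag n d *\<^sub>v v) = (\<Sum>i<n. d i * (v $ i)\<^sup>2)"
  by (simp add: real_diag_mult_vec scalar_prod_def lessThan_atLeast0 power2_eq_square mult_ac)

lemma congruence_index:
  assumes "P \<in> carrier_mat n n" "i < n" "j < n"
  shows "(P\<^sup>T * real_diag n d * P) $$ (i, j) = (\<Sum>k<n. P $$ (k, i) * (d k * P $$ (k, j)))"
proof -
  have "P\<^sup>T * real_diag n d * P = P\<^sup>T * (real_diag n d * P)"
    using assms by (simp add: assoc_mult_mat[of _ n n _ n _ n])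
  then have "(P\<^sup>T * real_diag n d * P) $$ (i, j) = (\<Sum>k<n. P\<^sup>T $$ (i, k) * (real_diag n d * P) $$ (k, j))"
    using assms index_mult_square_mat[of "P\<^sup>T" n "real_diag n d * P" i j]
      mult_carrier_mat[OF real_diag_carrier assms(1)] by simp
  also have "\<dots> = (\<Sum>k<n. P $$ (k, i) * (d k * P $$ (k, j)))"
    using assms by (intro sum.cong) (auto simp: real_diag_mult_index)
  finally show ?thesis .
qed

lemma positive_definite_congruence:
  assumes "P \<in> carrier_mat n n" "invertible_mat P" "\<kappa> > 0"
  shows "positive_definite n (P\<^sup>T * real_diag n (\<lambda>_. \<kappa>) * P)"
  unfolding positive_definite_def
proof (intro conjI ballI impI)
  show "(P\<^sup>T * real_diag n (\<lambda>_. \<kappa>) * P)\<^sup>T = P\<^sup>T * real_diag n (\<lambda>_. \<kappa>) * P"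
    using assms by (intro transpose_congruence) auto
  fix v :: "real vec" assume v: "v \<in> carrier_vec n" "v \<noteq> 0\<^sub>v n"
  have "P *\<^sub>v v \<noteq> 0\<^sub>v n" using invertible_mat_mult_vec_nonzero[OF assms(1,2) v] .
  then obtain i where i: "i < n" "(P *\<^sub>v v) $ i \<noteq> 0"
    using assms(1) by (metis eq_vecI index_zero_vec dim_mult_mat_vec carrier_matD(1))
  have "(\<Sum>i<n. \<kappa> * ((P *\<^sub>v v) $ i)\<^sup>2) > 0"
    using i assms(3) by (intro sum_pos2[of _ i]) auto
  then show "0 < v \<bullet> (P\<^sup>T * real_diag n (\<lambda>_. \<kappa>) * P *\<^sub>v v)"
    using assms(1) v by (simp add: quadratic_form_congruence quadratic_form_real_diag)
qed (use assms in auto)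

lemma positive_semidefinite_congruence:
  assumes "P \<in> carrier_mat n n" "\<And>i. i < n \<Longrightarrow> d i \<ge> 0"
  shows "positive_semidefinite n (P\<^sup>T * real_diag n d * P)"
  unfolding positive_semidefinite_def
proof (intro conjI ballI)
  show "(P\<^sup>T * real_diag n d * P)\<^sup>T = P\<^sup>T * real_diag n d * P"
    using assms by (intro transpose_congruence) auto
  fix v :: "real vec" assume v: "v \<in> carrier_vec n"
  have "(\<Sum>i<n. d i * ((P *\<^sub>v v) $ i)\<^sup>2) \<ge> 0"
    using assms(2) by (intro sum_nonneg) auto
  then show "0 \<le> v \<bullet> (P\<^sup>T * real_diag n d * P *\<^sub>v v)"
    using assms(1) v by (simp add: quadratic_form_congruence quadratic_form_real_diag)
qed (use assms in auto)

lemma real_diag_const_mult: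
  "B \<in> carrier_mat n n \<Longrightarrow> real_diag n (\<lambda>_. \<kappa>) * B = \<kappa> \<cdot>\<^sub>m B"
  by (intro eq_matI) (auto simp: real_diag_def scalar_prod_def if_distrib[of "\<lambda>c. c * _"] sum.delta cong: if_cong)

text \<open>The reason is \<open>P\<^sup>T P A = P\<^sup>T S P\<close>, which is symmetric.\<close>

lemma symmetrizer_congruence:
  fixes P A S :: "real mat"
  assumes P: "P \<in> carrier_mat n n" and A: "A \<in> carrier_mat n n" and S: "S \<in> carrier_mat n n"
    and conj: "P * A = S * P" and sym: "S\<^sup>T = S"
  shows "P\<^sup>T * real_diag n (\<lambda>_. \<kappa>) * P * A = A\<^sup>T * (P\<^sup>T * real_diag n (\<lambda>_. \<kappa>) * P)"
proof -
  have smult: "P\<^sup>T * real_diag n (\<lambda>_. \<kappa>) * P = \<kappa> \<cdot>\<^sub>m (P\<^sup>T * P)"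
    using P by (simp add: assoc_mult_mat[of _ n n _ n _ n] real_diag_const_mult mult_smult_distrib[of _ n n _ n])
  have "P\<^sup>T * P * A = P\<^sup>T * (S * P)"
    using P A by (simp add: assoc_mult_mat[of _ n n _ n _ n] conj)
  also have "\<dots> = (S * P)\<^sup>T * P"
    using P S by (simp add: transpose_mult[of _ n n _ n] sym assoc_mult_mat[of _ n n _ n _ n])
  also have "\<dots> = A\<^sup>T * (P\<^sup>T * P)"
    using P A by (simp add: transpose_mult[of _ n n _ n] assoc_mult_mat[of _ n n _ n _ n] flip: conj)
  finally show ?thesis
    unfolding smult using P A by (simp add: mult_smult_distrib[of _ n n _ n] mult_smult_assoc_mat[of _ n n _ n])
qed

lemma congruence_carrier: "P \<in> carrier_mat n n \<Longrightarrow> P\<^sup>T * real_diag n d * P \<in> carrier_mat n n"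
  by auto

lemma congruence_mult_diagonalized:
  assumes P: "P \<in> carrier_mat n n" and J: "J \<in> carrier_mat n n"
    and PJ: "P * J = real_diag n l * P"
  shows "P\<^sup>T * real_diag n (\<lambda>_. \<kappa>) * P * J = P\<^sup>T * real_diag n (\<lambda>k. \<kappa> * l k) * P"
proof -
  have lP: "real_diag n l * P \<in> carrier_mat n n" by (rule mult_carrier_mat[OF real_diag_carrier P])
  have "P\<^sup>T * real_diag n (\<lambda>_. \<kappa>) * P * J = P\<^sup>T * real_diag n (\<lambda>_. \<kappa>) * (real_diag n l * P)"
    unfolding PJ[symmetric] using P J by (intro assoc_mult_mat[of _ n n _ n _ n]) auto
  also have "\<dots> = P\<^sup>T * (real_diag n (\<lambda>_. \<kappa>) * (real_diag n l * P))"
    using P lP by (intro assoc_mult_mat[of _ n n _ n _ n]) auto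
  also have "real_diag n (\<lambda>_. \<kappa>) * (real_diag n l * P) = real_diag n (\<lambda>k. \<kappa> * l k) * P"
  proof (rule eq_matI)
    fix i j assume "i < dim_row (real_diag n (\<lambda>k. \<kappa> * l k) * P)" "j < dim_col (real_diag n (\<lambda>k. \<kappa> * l k) * P)"
    then have "i < n" "j < n" using P by (auto simp: real_diag_def)
    then show "(real_diag n (\<lambda>_. \<kappa>) * (real_diag n l * P)) $$ (i, j) = (real_diag n (\<lambda>k. \<kappa> * l k) * P) $$ (i, j)"
      by (simp only: real_diag_mult_index[OF lP] real_diag_mult_index[OF P] mult.assoc)
  qed (use P in \<open>auto simp: real_diag_def\<close>)
  also have "P\<^sup>T * (real_diag n (\<lambda>k. \<kappa> * l k) * P) = P\<^sup>T * real_diag n (\<lambda>k. \<kappa> * l k) * P"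
    using P by (intro assoc_mult_mat[of _ n n _ n _ n, symmetric]) auto
  finally show ?thesis .
qed

text \<open>Since \<open>P\<close> diagonalises \<open>J\<close>, the product \<open>A J\<close> is again of the form \<open>P\<^sup>T D P\<close> with \<open>D\<close> diagonal, and
the order of symmetric matrices reduces to that of diagonal entries.\<close>

lemma congruence_dissipation:
  assumes P: "P \<in> carrier_mat n n" and J: "J \<in> carrier_mat n n"
    and PJ: "P * J = real_diag n (\<lambda>k. - l k) * P"
    and le: "\<And>k. k < n \<Longrightarrow> e k \<le> 2 * \<kappa> * l k"
  defines "A \<equiv> P\<^sup>T * real_diag n (\<lambda>_. \<kappa>) * P"
  shows "symmetric_le n (A * J + J\<^sup>T * A) (- (P\<^sup>T * real_diag n e * P))"
proof -
  define C where "C = (\<lambda>d. P\<^sup>T * real_diag n d * P)"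
  have C: "C d \<in> carrier_mat n n" for d unfolding C_def using P by (rule congruence_carrier)
  have AC: "A = C (\<lambda>_. \<kappa>)" by (simp add: A_def C_def)
  have CT: "(C d)\<^sup>T = C d" for d
    unfolding C_def using P by (intro transpose_congruence) auto
  have AJ: "A * J = C (\<lambda>k. \<kappa> * - l k)"
    unfolding A_def C_def using P J PJ by (rule congruence_mult_diagonalized)
  have "J\<^sup>T * A = (A * J)\<^sup>T"
    unfolding AC using transpose_mult[OF C J, of "\<lambda>_. \<kappa>"] by (simp only: CT)
  then have JA: "J\<^sup>T * A = C (\<lambda>k. \<kappa> * - l k)" by (simp only: AJ CT)
  have "- C e - (C (\<lambda>k. \<kappa> * - l k) + C (\<lambda>k. \<kappa> * - l k)) = C (\<lambda>k. 2 * \<kappa> * l k - e k)"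
  proof (rule eq_matI)
    have dims: "dim_row (C d) = n" "dim_col (C d) = n" for d using C[of d] by auto
    fix i j assume "i < dim_row (C (\<lambda>k. 2 * \<kappa> * l k - e k))" "j < dim_col (C (\<lambda>k. 2 * \<kappa> * l k - e k))"
    then have ij: "i < n" "j < n" by (auto simp: dims)
    have entry: "C d $$ (i, j) = (\<Sum>k<n. P $$ (k, i) * (d k * P $$ (k, j)))" for d
      unfolding C_def using P ij by (rule congruence_index)
    have "(- C e - (C (\<lambda>k. \<kappa> * - l k) + C (\<lambda>k. \<kappa> * - l k))) $$ (i, j) =
        - C e $$ (i, j) - (C (\<lambda>k. \<kappa> * - l k) $$ (i, j) + C (\<lambda>k. \<kappa> * - l k) $$ (i, j))"
      using ij by (simp add: dims)
    also have "\<dots> = C (\<lambda>k. 2 * \<kappa> * l k - e k) $$ (i, j)"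
      unfolding entry by (simp add: algebra_simps sum.distrib sum_subtractf sum_negf sum_distrib_left)
    finally show "(- C e - (C (\<lambda>k. \<kappa> * - l k) + C (\<lambda>k. \<kappa> * - l k))) $$ (i, j) =
        C (\<lambda>k. 2 * \<kappa> * l k - e k) $$ (i, j)" .
  qed (use C[of e] C[of "\<lambda>k. \<kappa> * - l k"] C[of "\<lambda>k. 2 * \<kappa> * l k - e k"] in auto)
  moreover have "positive_semidefinite n (C (\<lambda>k. 2 * \<kappa> * l k - e k))"
    unfolding C_def using le by (intro positive_semidefinite_congruence[OF P]) simp
  ultimately show ?thesis
    unfolding symmetric_le_def AJ JA unfolding C_def by (simp only:)
qed

section \<open>Companion matrices\<close>

definition companion_mat :: "nat \<Rightarrow> real poly \<Rightarrow> real mat" where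
  "companion_mat n c = mat n n (\<lambda>(i, j). if Suc i = n then - coeff c j else if j = i + 1 then 1 else 0)"

definition coeff_rows :: "nat \<Rightarrow> (nat \<Rightarrow> real poly) \<Rightarrow> real mat" where
  "coeff_rows n p = mat n n (\<lambda>(k, j). coeff (p k) j)"

lemma coeff_rows_carrier [simp]: "coeff_rows n p \<in> carrier_mat n n"
  and companion_mat_carrier [simp]: "companion_mat n c \<in> carrier_mat n n"
  by (simp_all add: coeff_rows_def companion_mat_def)

text \<open>Multiplying the coefficient row of a polynomial by the companion matrix of \<open>c\<close> multiplies the polynomial
by \<open>x\<close> modulo \<open>c\<close>. So a system of polynomials on which multiplication by \<open>x\<close> acts through \<open>S\<close>
conjugates the companion matrix to \<open>S\<close>.\<close>

lemma coeff_rows_mult_companion: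
  assumes "n > 0" and S: "S \<in> carrier_mat n n"
    and rel: "\<And>k. k < n \<Longrightarrow>
      [:0, 1:] * p k - smult (coeff (p k) (n - 1)) c = (\<Sum>l<n. smult (S $$ (k, l)) (p l))"
  shows "coeff_rows n p * companion_mat n c = S * coeff_rows n p"
proof (rule eq_matI)
  fix k j assume kj: "k < dim_row (S * coeff_rows n p)" "j < dim_col (S * coeff_rows n p)"
  then have k: "k < n" and j: "j < n" using S by (auto simp: coeff_rows_def)
  obtain m where n: "n = Suc m" using \<open>n > 0\<close> by (cases n) auto
  have "(coeff_rows n p * companion_mat n c) $$ (k, j) =
      (\<Sum>i<n. coeff (p k) i * (if Suc i = n then - coeff c j else if j = i + 1 then 1 else 0))"
    using k j by (simp add: coeff_rows_def companion_mat_def scalar_prod_def lessThan_atLeast0)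
  also have "\<dots> = (\<Sum>i<m. if j = Suc i then coeff (p k) i else 0) - coeff (p k) m * coeff c j"
    unfolding n sum.lessThan_Suc by (auto intro!: sum.cong)
  also have "(\<Sum>i<m. if j = Suc i then coeff (p k) i else 0) = coeff ([:0, 1:] * p k) j"
    using j n by (cases j) (auto simp: sum.delta)
  also have "\<dots> - coeff (p k) m * coeff c j = coeff ([:0, 1:] * p k - smult (coeff (p k) (n - 1)) c) j"
    by (simp add: n)
  also have "\<dots> = (\<Sum>l<n. S $$ (k, l) * coeff (p l) j)"
    unfolding rel[OF k] by (simp add: coeff_sum)
  also have "\<dots> = (S * coeff_rows n p) $$ (k, j)"
    using k j S by (simp add: coeff_rows_def scalar_prod_def lessThan_atLeast0)
  finally show "(coeff_rows n p * companion_mat n c) $$ (k, j) = (S * coeff_rows n p) $$ (k, j)" .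
qed (use S in \<open>auto simp: coeff_rows_def companion_mat_def\<close>)

lemma invertible_coeff_rows:
  assumes "\<And>k. k < n \<Longrightarrow> degree (p k) < n"
    and indep: "\<And>\<alpha>. (\<Sum>k<n. smult (\<alpha> k) (p k)) = 0 \<Longrightarrow> \<forall>k<n. \<alpha> k = 0"
  shows "invertible_mat (coeff_rows n p)"
proof -
  have "v = 0\<^sub>v n" if v: "v \<in> carrier_vec n" "(coeff_rows n p)\<^sup>T *\<^sub>v v = 0\<^sub>v n" for v
  proof (rule eq_vecI)
    have "(\<Sum>k<n. smult (v $ k) (p k)) = 0"
    proof (rule poly_eqI)
      fix j
      show "coeff (\<Sum>k<n. smult (v $ k) (p k)) j = coeff 0 j"
      proof (cases "j < n")
        case True
        have "((coeff_rows n p)\<^sup>T *\<^sub>v v) $ j = (\<Sum>k<n. coeff (p k) j * v $ k)"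
          using True v(1) by (auto simp: coeff_rows_def scalar_prod_def lessThan_atLeast0 intro!: sum.cong)
        then show ?thesis using v(2) True by (simp add: coeff_sum mult.commute)
      next
        case False
        then have "coeff (p k) j = 0" if "k < n" for k
          using assms(1)[OF that] by (intro coeff_eq_0) auto
        then show ?thesis by (simp add: coeff_sum)
      qed
    qed
    from indep[OF this] show "v $ k = 0\<^sub>v n $ k" if "k < dim_vec (0\<^sub>v n)" for k
      using that by simp
  qed (use v in auto)
  then obtain C where C: "C \<in> carrier_mat n n" "(coeff_rows n p)\<^sup>T * C = 1\<^sub>m n" "C * (coeff_rows n p)\<^sup>T = 1\<^sub>m n"
    using trivial_kernel_imp_inverse[of "(coeff_rows n p)\<^sup>T" n] by auto
  have "C\<^sup>T * coeff_rows n p = 1\<^sub>m n"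
    using arg_cong[OF C(2), of transpose_mat] C(1) by (simp add: transpose_mult[of _ n n _ n])
  moreover have "coeff_rows n p * C\<^sup>T = 1\<^sub>m n"
    using arg_cong[OF C(3), of transpose_mat] C(1) by (simp add: transpose_mult[of _ n n _ n])
  ultimately show ?thesis using C(1) by (intro invertible_mat_if_inverse[of _ n "C\<^sup>T"]) auto
qed

text \<open>The polynomials \<open>c / (x - z k)\<close> satisfy \<open>x q = z k q\<close> modulo \<open>c\<close>, so their coefficients are left
eigenvectors; evaluation at the roots shows that they are independent.\<close>

lemma companion_symmetrizer:
  assumes "real_simple_roots n c" "n > 0"
  obtains A0 where "positive_definite n A0" "A0 * companion_mat n c = (companion_mat n c)\<^sup>T * A0"
proof -
  obtain z where z: "strict_mono_on {..<n} z" and c: "c = root_poly n z"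
    using assms unfolding real_simple_roots_def by blast
  have z_less: "z i < z j" if "i < j" "j < n" for i j
    by (rule strict_mono_onD[OF z]) (use that in auto)
  have z_neq: "z i \<noteq> z j" if "i < n" "j < n" "i \<noteq> j" for i j
    using z_less[of i j] z_less[of j i] that by (cases "i < j") auto
  define q where "q = (\<lambda>k. \<Prod>i\<in>{..<n} - {k}. [:- z i, 1:])"
  have c_split: "c = [:- z k, 1:] * q k" if "k < n" for k
    unfolding c root_poly_def q_def using that by (intro prod.remove) auto
  have deg: "degree (q k) = n - 1" if "k < n" for k
    unfolding q_def using that by (subst degree_prod_eq_sum_degree) auto
  have monic: "coeff (q k) (n - 1) = 1" if "k < n" for k
    using lead_coeff_prod[of "\<lambda>i. [:- z i, 1:]" "{..<n} - {k}"] deg[OF that] by (simp add: q_def)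
  have q_at: "poly (q k) (z l) = 0" if "k < n" "l < n" "l \<noteq> k" for k l
    using that by (auto simp: q_def poly_prod)
  have q_self: "poly (q k) (z k) \<noteq> 0" if "k < n" for k
    using that z_neq by (auto simp: q_def poly_prod)
  define B where "B = coeff_rows n q"
  have B: "B \<in> carrier_mat n n" by (simp add: B_def)
  have inv: "invertible_mat B"
    unfolding B_def
  proof (rule invertible_coeff_rows)
    show "degree (q k) < n" if "k < n" for k using deg that by simp
    fix \<alpha> assume 0: "(\<Sum>k<n. smult (\<alpha> k) (q k)) = 0"
    show "\<forall>k<n. \<alpha> k = 0"
    proof (intro allI impI)
      fix l assume l: "l < n"
      have "0 = (\<Sum>k<n. \<alpha> k * poly (q k) (z l))"
        using arg_cong[OF 0, of "\<lambda>p. poly p (z l)"] by (simp add: poly_sum)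
      also have "\<dots> = (\<Sum>k<n. if k = l then \<alpha> l * poly (q l) (z l) else 0)"
        using q_at l by (intro sum.cong) auto
      also have "\<dots> = \<alpha> l * poly (q l) (z l)" using l by simp
      finally show "\<alpha> l = 0" using q_self[OF l] by simp
    qed
  qed
  have "B * companion_mat n c = real_diag n z * B"
    unfolding B_def
  proof (rule coeff_rows_mult_companion)
    fix k assume k: "k < n"
    have "[:0, 1:] * q k - smult (coeff (q k) (n - 1)) c = smult (z k) (q k)"
      using monic[OF k] c_split[OF k] by simp
    also have "\<dots> = (\<Sum>l<n. if l = k then smult (z k) (q k) else 0)" using k by simp
    also have "\<dots> = (\<Sum>l<n. smult (real_diag n z $$ (k, l)) (q l))"
      using k by (intro sum.cong) (auto simp: real_diag_def)
    finally show "[:0, 1:] * q k - smult (coeff (q k) (n - 1)) c =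
      (\<Sum>l<n. smult (real_diag n z $$ (k, l)) (q l))" .
  qed (use assms in auto)
  then show ?thesis
    using B inv by (intro that[of "B\<^sup>T * real_diag n (\<lambda>_. 1) * B"] positive_definite_congruence
      symmetrizer_congruence[where S = "real_diag n z"]) auto
qed

section \<open>Hermite polynomials and the Jacobi matrix\<close>

text \<open>The monic Hermite polynomials of the Gaussian with mean \<open>u\<close> and variance \<open>s\<close>.\<close>

definition hermite :: "real \<Rightarrow> real \<Rightarrow> nat \<Rightarrow> real poly" where
  "hermite u s k = heat (- s) ([:- u, 1:] ^ k)"

lemma degree_hermite [simp]: "degree (hermite u s k) = k"
  by (simp add: hermite_def degree_linear_power)

lemma monic_hermite [simp]: "coeff (hermite u s k) k = 1"
  using lead_coeff_heat[of "-s" "[:- u, 1:] ^ k"]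
  by (simp add: hermite_def degree_linear_power lead_coeff_power coeff_linear_power)

lemma heat_hermite [simp]: "heat s (hermite u s k) = [:- u, 1:] ^ k"
  by (simp add: hermite_def)

lemma hermite_Suc:
  "hermite u s (Suc k) = [:- u, 1:] * hermite u s k - smult (s * real k) (hermite u s (k - 1))"
  unfolding hermite_def heat_linear_power_Suc by simp

lemma pderiv_hermite: "pderiv (hermite u s k) = smult (real k) (hermite u s (k - 1))"
  by (simp add: hermite_def heat_smult pderiv_linear_power flip: heat_pderiv)

text \<open>Raising the Hermite index is adjoint to differentiation: under the Gaussian, \<open>p H\<^sub>k\<^sub>+\<^sub>1\<close> and
\<open>s p' H\<^sub>k\<close> have the same mean.\<close>

lemma gaussian_integration_by_parts:
  "poly (heat s (p * hermite u s k)) u = s ^ k * poly (heat s ((pderiv ^^ k) p)) u"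
proof (induction k arbitrary: p)
  case (Suc k)
  have "p * hermite u s (Suc k) =
      [:- u, 1:] * (p * hermite u s k) - smult s (p * pderiv (hermite u s k))"
    by (simp only: hermite_Suc pderiv_hermite right_diff_distrib mult_smult_right smult_smult mult.left_commute)
  then have "heat s (p * hermite u s (Suc k)) =
      heat s ([:- u, 1:] * (p * hermite u s k)) - smult s (heat s (p * pderiv (hermite u s k)))"
    by (simp only: heat_diff heat_smult)
  then have "poly (heat s (p * hermite u s (Suc k))) u = s * poly (heat s (pderiv p * hermite u s k)) u"
    unfolding heat_linear_mult pderiv_mult heat_add
    by (simp add: distrib_left mult.commute[of "hermite u s k"])
  then show ?case using Suc.IH[of "pderiv p"] by (simp add: funpow_swap1)
qed (simp add: hermite_def)

lemma pderiv_linear_power_at: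
  "poly ((pderiv ^^ r) ([:- u, 1:] ^ k)) (u :: real) = (if r = k then fact k else 0)"
proof (induction r arbitrary: k)
  case 0
  then show ?case by (cases k) (simp_all add: poly_power del: power_Suc)
next
  case (Suc r)
  show ?case
  proof (cases k)
    case 0
    have "(pderiv ^^ r) (0 :: real poly) = 0" by (induction r) auto
    then show ?thesis using 0 by (simp add: funpow_swap1)
  next
    case (Suc k')
    then show ?thesis
      using Suc.IH[of k']
      by (simp add: funpow_swap1 pderiv_power_Suc pderiv_pCons higher_pderiv_smult del: power_Suc of_nat_Suc)
  qed
qed

lemma equilibrium_poly_eq_hermite:
  "equilibrium_poly N M = hermite (velocity M) (temperature M) (2 * N + 1)"
  unfolding hermite_def equilibrium_poly_def
  by (subst heat_eq_sum[where K = N], simp only: degree_linear_power, simp)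

text \<open>The factor makes the polynomials orthonormal for the Gaussian weight, under which \<open>H\<^sub>k\<close> has squared
norm \<open>k! s\<^sup>k\<close>. Orthonormality is what makes the recurrence matrix below symmetric.\<close>

definition hermite_orthonormal :: "real \<Rightarrow> real \<Rightarrow> nat \<Rightarrow> real poly" where
  "hermite_orthonormal u s k = smult (1 / sqrt (fact k * s ^ k)) (hermite u s k)"

definition hermite_mat :: "nat \<Rightarrow> real \<Rightarrow> real \<Rightarrow> real mat" where
  "hermite_mat n u s = coeff_rows n (hermite_orthonormal u s)"

lemma hermite_mat_carrier [simp]: "hermite_mat n u s \<in> carrier_mat n n"
  by (simp add: hermite_mat_def)

lemma invertible_hermite_mat:
  assumes "s > 0"
  shows "invertible_mat (hermite_mat n u s)"
proof -
  have "det (hermite_mat n u s) = prod_list (diag_mat (hermite_mat n u s))"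
    by (rule det_lower_triangular[of n])
      (auto simp: hermite_mat_def coeff_rows_def hermite_orthonormal_def coeff_eq_0)
  also have "\<dots> \<noteq> 0"
    using assms by (auto simp: prod_list_zero_iff diag_mat_def hermite_mat_def coeff_rows_def hermite_orthonormal_def)
  finally have "det (hermite_mat n u s) \<noteq> 0" .
  from det_non_zero_imp_unit[OF hermite_mat_carrier this, unfolded Units_def, of "()"]
  show ?thesis by (auto simp: ring_mat_def intro: invertible_mat_if_inverse[of _ n])
qed

definition jacobi_mat :: "nat \<Rightarrow> real \<Rightarrow> real \<Rightarrow> real mat" where
  "jacobi_mat n u s = mat n n (\<lambda>(k, l).
     (if l = Suc k then sqrt (s * real (Suc k)) else 0) + (if l = k then u else 0) +
     (if k = Suc l then sqrt (s * real k) else 0))"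

text \<open>The three-term recurrence of the Hermite polynomials. In the last row it would continue with \<open>H\<^sub>n\<close>,
which is the modulus of the companion matrix.\<close>

lemma hermite_mat_mult_companion:
  assumes "s > 0" "n > 0"
  shows "hermite_mat n u s * companion_mat n (hermite u s n) = jacobi_mat n u s * hermite_mat n u s"
  unfolding hermite_mat_def
proof (rule coeff_rows_mult_companion)
  fix k assume k: "k < n"
  define d where "d = (\<lambda>k. 1 / sqrt (fact k * s ^ k))"
  have on: "hermite_orthonormal u s k = smult (d k) (hermite u s k)" for k
    by (simp add: hermite_orthonormal_def d_def)
  have d_Suc: "sqrt (s * real (Suc k)) * d (Suc k) = d k" for k
  proof -
    have "d (Suc k) = 1 / (sqrt (s * real (Suc k)) * sqrt (fact k * s ^ k))"
      proof -
      have "fact (Suc k) * s ^ Suc k = s * real (Suc k) * (fact k * s ^ k)" by simp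
      then show ?thesis unfolding d_def by (simp only:) (simp only: real_sqrt_mult)
    qed
    moreover have "sqrt (s * real (Suc k)) \<noteq> 0" using \<open>s > 0\<close> by simp
    ultimately show ?thesis by (simp add: d_def)
  qed
  have d_pred: "sqrt (s * real (Suc k)) * d k = d (Suc k) * (s * real (Suc k))" for k
  proof -
    have "sqrt (s * real (Suc k)) * d k = sqrt (s * real (Suc k)) * sqrt (s * real (Suc k)) * d (Suc k)"
      by (subst d_Suc[symmetric]) (simp only: mult.assoc)
    then show ?thesis using \<open>s > 0\<close> by (simp add: algebra_simps)
  qed
  have "(\<Sum>l<n. smult (jacobi_mat n u s $$ (k, l)) (hermite_orthonormal u s l)) =
      (\<Sum>l<n. if l = Suc k then smult (sqrt (s * real (Suc k))) (hermite_orthonormal u s l) else 0) +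
      (\<Sum>l<n. if l = k then smult u (hermite_orthonormal u s l) else 0) +
      (\<Sum>l<n. if k = Suc l then smult (sqrt (s * real k)) (hermite_orthonormal u s l) else 0)"
    unfolding sum.distrib[symmetric] using k
    by (intro sum.cong) (auto simp: jacobi_mat_def)
  also have "(\<Sum>l<n. if l = Suc k then smult (sqrt (s * real (Suc k))) (hermite_orthonormal u s l) else 0) =
      (if Suc k < n then smult (d k) (hermite u s (Suc k)) else 0)"
    using d_Suc[of k] by (simp add: sum.delta on del: of_nat_Suc)
  also have "(\<Sum>l<n. if l = k then smult u (hermite_orthonormal u s l) else 0) = smult (u * d k) (hermite u s k)"
    using k by (simp add: sum.delta on)
  also have "(\<Sum>l<n. if k = Suc l then smult (sqrt (s * real k)) (hermite_orthonormal u s l) else 0) =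
      smult (d k * (s * real k)) (hermite u s (k - 1))"
  proof (cases k)
    case (Suc k')
    then show ?thesis using k d_pred[of k'] by (simp add: sum.delta' on del: of_nat_Suc)
  qed simp
  finally have rhs: "(\<Sum>l<n. smult (jacobi_mat n u s $$ (k, l)) (hermite_orthonormal u s l)) =
      (if Suc k < n then smult (d k) (hermite u s (Suc k)) else 0) + smult (u * d k) (hermite u s k) +
      smult (d k * (s * real k)) (hermite u s (k - 1))" .
  have "[:0, 1:] * hermite u s k = hermite u s (Suc k) + smult u (hermite u s k) +
      smult (s * real k) (hermite u s (k - 1))"
    unfolding hermite_Suc by simp
  then have "[:0, 1:] * hermite_orthonormal u s k = smult (d k) (hermite u s (Suc k)) +
      smult (u * d k) (hermite u s k) + smult (d k * (s * real k)) (hermite u s (k - 1))"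
    by (simp add: on smult_add_right mult.commute)
  moreover have "smult (coeff (hermite_orthonormal u s k) (n - 1)) (hermite u s n) =
      (if Suc k < n then 0 else smult (d k) (hermite u s (Suc k)))"
  proof (cases "Suc k = n")
    case True
    then show ?thesis by (auto simp: on)
  next
    case False
    then show ?thesis using k by (simp add: on coeff_eq_0)
  qed
  ultimately show "[:0, 1:] * hermite_orthonormal u s k - smult (coeff (hermite_orthonormal u s k) (n - 1)) (hermite u s n) =
      (\<Sum>l<n. smult (jacobi_mat n u s $$ (k, l)) (hermite_orthonormal u s l))"
    unfolding rhs by (simp del: mult_pCons_left)
qed (use assms in \<open>simp_all add: jacobi_mat_def\<close>)

lemma transpose_jacobi_mat [simp]: "(jacobi_mat n u s)\<^sup>T = jacobi_mat n u s"
  by (intro eq_matI) (auto simp: jacobi_mat_def)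

lemma jacobi_mat_carrier [simp]: "jacobi_mat n u s \<in> carrier_mat n n"
  by (simp add: jacobi_mat_def)

section \<open>The Shakhov source and its equilibria\<close>

text \<open>The correction factor of the Shakhov density is a multiple of \<open>H\<^sub>3\<close>, and integration by parts turns it
into a third derivative.\<close>

lemma has_bochner_integral_f_S:
  assumes "mass_density M \<noteq> 0" and "temperature M > 0"
  shows "has_bochner_integral lborel (\<lambda>\<xi>. poly p \<xi> * f_S Pr M \<xi>)
     (mass_density M * poly (heat (temperature M) p) (velocity M) +
      (1 - Pr) * heat_flux M / 3 * poly (heat (temperature M) ((pderiv ^^ 3) p)) (velocity M))"
proof -
  define \<rho> u s where "\<rho> = mass_density M" and "u = velocity M" and "s = temperature M"
  define C where "C = (1 - Pr) * heat_flux M / (3 * \<rho> * s\<^sup>2)"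
  have "\<rho> \<noteq> 0" "s > 0" using assms by (simp_all add: \<rho>_def s_def)
  define r where "r = smult \<rho> (p + smult (C / s) (p * hermite u s 3))"
  have H3: "poly (hermite u s 3) x = (x - u) ^ 3 - 3 * s * (x - u)" for x
    by (simp add: eval_nat_numeral hermite_Suc algebra_simps) (simp add: hermite_def algebra_simps)
  have "poly p \<xi> * f_S Pr M \<xi> = poly r \<xi> * normal_density u (sqrt s) \<xi>" for \<xi>
  proof -
    have "C * (\<xi> - u) * ((\<xi> - u)\<^sup>2 / s - 3) = C / s * poly (hermite u s 3) \<xi>"
      using \<open>s > 0\<close> unfolding H3 by (simp add: field_simps power3_eq_cube power2_eq_square)
    then have "f_S Pr M \<xi> = \<rho> * normal_density u (sqrt s) \<xi> * (1 + C / s * poly (hermite u s 3) \<xi>)"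
      by (simp add: f_S_def f_eq_def C_def flip: \<rho>_def u_def s_def)
    then show ?thesis by (simp add: r_def algebra_simps)
  qed
  moreover have "has_bochner_integral lborel (\<lambda>\<xi>. poly r \<xi> * normal_density u (sqrt s) \<xi>) (poly (heat s r) u)"
    by (rule has_bochner_integral_gaussian_poly) fact
  moreover have "poly (heat s r) u = \<rho> * poly (heat s p) u +
      (1 - Pr) * heat_flux M / 3 * poly (heat s ((pderiv ^^ 3) p)) u"
  proof -
    have "poly (heat s r) u = \<rho> * poly (heat s p) u + \<rho> * (C / s * s ^ 3) * poly (heat s ((pderiv ^^ 3) p)) u"
      by (simp add: r_def heat_smult heat_add gaussian_integration_by_parts distrib_left mult.assoc
          del: funpow.simps)
    also have "\<rho> * (C / s * s ^ 3) = (1 - Pr) * heat_flux M / 3"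
      using \<open>\<rho> \<noteq> 0\<close> \<open>s > 0\<close> by (simp add: C_def field_simps power3_eq_cube power2_eq_square)
    finally show ?thesis .
  qed
  ultimately show ?thesis by (simp add: \<rho>_def u_def s_def)
qed

text \<open>The integral of \<open>p\<close> against the Shakhov density, in the closed form that is differentiated later.\<close>

definition shakhov_mean :: "real \<Rightarrow> real vec \<Rightarrow> real poly \<Rightarrow> real" where
  "shakhov_mean Pr M p = mass_density M * poly (heat (temperature M) p) (velocity M) +
     (1 - Pr) * heat_flux M / 3 * poly (heat (temperature M) ((pderiv ^^ 3) p)) (velocity M)"

lemma Shakhov_source_index:
  assumes "mass_density M \<noteq> 0" "temperature M > 0" "dim_vec M = 2 * N + 1" "i < 2 * N + 1"
  shows "Shakhov_source N Pr M $ i = shakhov_mean Pr M (monom 1 i) - M $ i"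
proof -
  have "(LINT \<xi>|lborel. \<xi> ^ i * f_S Pr M \<xi>) = shakhov_mean Pr M (monom 1 i)"
    using has_bochner_integral_f_S[OF assms(1,2), of "monom 1 i" Pr]
    by (simp add: shakhov_mean_def poly_monom has_bochner_integral_integral_eq)
  then show ?thesis using assms by (simp add: Shakhov_source_def Shakhov_moment_def)
qed

lemma dim_Shakhov_source [simp]: "dim_vec (Shakhov_source N Pr M) = dim_vec M"
  by (simp add: Shakhov_source_def)

lemma heat_monom_1: "heat s (monom 1 1) = [:0, 1:]"
  by (simp add: monom_altdef heat_pCons pderiv_pCons)

lemma heat_monom_2: "heat s (monom 1 2) = [:s, 0, 1:]"
  by (simp add: monom_altdef power2_eq_square heat_pCons pderiv_pCons)

lemma heat_monom_3: "heat s (monom 1 3) = [:0, 3 * s, 0, 1:]"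
  by (simp add: monom_altdef power3_eq_cube heat_pCons pderiv_pCons)

text \<open>\<open>\<rho> \<theta>\<close> is the integral of \<open>(\<xi> - U)\<^sup>2\<close> against the mixture.\<close>

lemma macroscopic_positivity:
  assumes "N \<ge> 2" "M \<in> moment_map N ` Omega N"
  shows "mass_density M > 0" "temperature M > 0" "dim_vec M = 2 * N + 1"
proof -
  obtain W where W: "W \<in> Omega N" and M: "M = moment_map N W" using assms(2) by blast
  define x where "x = vec_index W"
  have w: "x (2 * b) > 0" if "b < N" for b
    using W that by (auto simp: Omega_def Omega_open_def Omega_eq_def weight_def x_def)
  have s: "x (2 * N) > 0" and var: "variance_param N W > 0"
    using W by (auto simp: Omega_def Omega_open_def Omega_eq_def variance_param_def x_def)
  have ne: "{..<N} \<noteq> {}" using assms(1) by (simp add: lessThan_empty_iff)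
  show "dim_vec M = 2 * N + 1" by (simp add: M moment_map_def)
  have Mk: "M $ k = mixture_mean N x (monom 1 k)" if "k < 2 * N + 1" for k
    using that var by (simp add: M moment_map_def eqmom_moment_conv x_def)
  have "M $ 0 = (\<Sum>b<N. x (2 * b))" by (simp add: Mk mixture_mean_def monom_0)
  moreover have "(\<Sum>b<N. x (2 * b)) > 0" using w ne by (intro sum_pos) auto
  ultimately show \<rho>: "mass_density M > 0" by (simp add: mass_density_def)
  define u where "u = velocity M"
  define p where "p = [:u\<^sup>2, - 2 * u, 1:]"
  have "mixture_mean N x p = (\<Sum>k<3. coeff p k * M $ k)"
    using assms(1) by (subst mixture_mean_conv_moments[of p 3]) (auto simp: p_def Mk intro!: sum.cong)
  also have "\<dots> = mass_density M * temperature M"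
    using \<rho> by (simp add: p_def eval_nat_numeral temperature_def u_def velocity_def mass_density_def field_simps power2_eq_square)
  finally have eq: "mixture_mean N x p = mass_density M * temperature M" .
  have "mixture_mean N x p > 0"
    unfolding mixture_mean_def
  proof (intro sum_pos mult_pos_pos)
    fix b assume "b \<in> {..<N}"
    have "heat (x (2 * N)) p = p + [:x (2 * N):]"
      by (simp add: p_def heat_pCons pderiv_pCons)
    then have "poly (heat (x (2 * N)) p) (x (2 * b + 1)) = (x (2 * b + 1) - u)\<^sup>2 + x (2 * N)"
      by (simp add: p_def power2_eq_square algebra_simps)
    then show "poly (heat (x (2 * N)) p) (x (2 * b + 1)) > 0" using s by (simp add: add_nonneg_pos)
  qed (use w ne in auto)
  then show "temperature M > 0" using \<rho> unfolding eq by (simp add: zero_less_mult_iff)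
qed

definition gaussian_moments :: "nat \<Rightarrow> real \<Rightarrow> real \<Rightarrow> real \<Rightarrow> real vec" where
  "gaussian_moments n \<rho> u s = vec n (\<lambda>j. \<rho> * poly (heat s (monom 1 j)) u)"

lemma gaussian_moments_in_Omega_eq:
  assumes "\<rho> > 0" "s > 0" "N > 0"
  shows "gaussian_moments (2 * N + 1) \<rho> u s \<in> moment_map N ` Omega_eq N"
proof -
  \<comment> \<open>The mass is spread evenly over \<open>N\<close> coinciding nodes.\<close>
  define W where "W = vec (2 * N + 1) (\<lambda>i. if i = 2 * N then s else if even i then \<rho> / real N else u)"
  have W: "weight W b = \<rho> / real N" "node W b = u" if "b < N" for b
    using that by (auto simp: W_def weight_def node_def)
  have s: "variance_param N W = s" by (simp add: W_def variance_param_def)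
  have "W \<in> Omega_eq N" using W s assms by (simp add: Omega_eq_def W_def)
  moreover have "moment_map N W = gaussian_moments (2 * N + 1) \<rho> u s"
    using assms W s
    by (intro eq_vecI) (simp_all add: moment_map_def gaussian_moments_def eqmom_moment_def gauss_moment_eq_heat)
  ultimately show ?thesis by (metis image_eqI)
qed

text \<open>The third component of the source is \<open>- 2 Pr q\<close>, so \<open>q = 0\<close>. Then the Shakhov density is a Gaussian,
and the vanishing of the source says that \<open>M\<close> consists of its moments.\<close>

lemma equilibria_gaussian:
  assumes "N \<ge> 2" "\<nu> > 0" "Pr > 0"
    and M: "M \<in> equilibria (2 * N + 1) (moment_map N ` Omega N) (\<lambda>M. \<nu> \<cdot>\<^sub>v Shakhov_source N Pr M)"
  shows "heat_flux M = 0" "M \<in> moment_map N ` Omega_eq N"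
proof -
  have MG: "M \<in> moment_map N ` Omega N" and 0: "\<nu> \<cdot>\<^sub>v Shakhov_source N Pr M = 0\<^sub>v (2 * N + 1)"
    using M by (auto simp: equilibria_def)
  note pos = macroscopic_positivity[OF assms(1) MG]
  have source0: "shakhov_mean Pr M (monom 1 i) = M $ i" if "i < 2 * N + 1" for i
  proof -
    have "\<nu> * Shakhov_source N Pr M $ i = 0"
      using arg_cong[OF 0, of "\<lambda>v. v $ i"] that pos(3) by simp
    then show ?thesis using Shakhov_source_index[of M N i Pr] pos that \<open>\<nu> > 0\<close> by simp
  qed
  have "(pderiv ^^ 3) (monom 1 3 :: real poly) = [:6:]"
    by (simp add: numeral_3_eq_3 pderiv_monom monom_0)
  then have "mass_density M * ((velocity M) ^ 3 + 3 * velocity M * temperature M)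
      + 2 * (1 - Pr) * heat_flux M = M $ 3"
    using source0[of 3] assms(1)
    by (simp add: shakhov_mean_def heat_monom_3 power3_eq_cube field_simps del: funpow.simps)
  then have "Pr * heat_flux M = 0" by (simp add: heat_flux_def field_simps)
  then show q: "heat_flux M = 0" using \<open>Pr > 0\<close> by simp
  have "M = gaussian_moments (2 * N + 1) (mass_density M) (velocity M) (temperature M)"
  proof (rule eq_vecI)
    fix i assume "i < dim_vec (gaussian_moments (2 * N + 1) (mass_density M) (velocity M) (temperature M))"
    then show "M $ i = gaussian_moments (2 * N + 1) (mass_density M) (velocity M) (temperature M) $ i"
      using source0[of i] q by (simp add: gaussian_moments_def shakhov_mean_def)
  qed (simp add: gaussian_moments_def pos(3))
  then show "M \<in> moment_map N ` Omega_eq N"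
    using gaussian_moments_in_Omega_eq[of "mass_density M" "temperature M" N "velocity M"] pos assms(1) by simp
qed

lemma equilibria_nonempty:
  assumes "N \<ge> 2"
  shows "equilibria (2 * N + 1) (moment_map N ` Omega N) (\<lambda>M. \<nu> \<cdot>\<^sub>v Shakhov_source N Pr M) \<noteq> {}"
proof -
  define M where "M = gaussian_moments (2 * N + 1) 1 0 1"
  have "M \<in> moment_map N ` Omega N"
    using gaussian_moments_in_Omega_eq[of 1 1 N 0] assms by (auto simp: M_def Omega_def)
  moreover have idx: "M $ i = poly (heat 1 (monom 1 i)) 0" if "i < 2 * N + 1" for i
    using that by (simp add: M_def gaussian_moments_def)
  have "M $ 0 = 1" using idx[of 0] by (simp add: monom_0)
  moreover have "M $ 1 = 0" using idx[of 1] assms by (simp add: heat_monom_1[simplified])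
  moreover have "M $ 2 = 1" using idx[of 2] assms by (simp add: heat_monom_2)
  moreover have "M $ 3 = 0" using idx[of 3] assms by (simp add: heat_monom_3)
  ultimately have macro: "mass_density M = 1" "velocity M = 0" "temperature M = 1" "heat_flux M = 0"
    by (simp_all add: mass_density_def velocity_def temperature_def heat_flux_def)
  have dim: "dim_vec M = 2 * N + 1" by (simp add: M_def gaussian_moments_def)
  have "\<nu> \<cdot>\<^sub>v Shakhov_source N Pr M = 0\<^sub>v (2 * N + 1)"
    by (rule eq_vecI) (simp_all add: dim macro idx Shakhov_source_index shakhov_mean_def)
  with \<open>M \<in> moment_map N ` Omega N\<close> show ?thesis by (auto simp: equilibria_def)
qed

section \<open>The linearised source in Hermite modes\<close>

lemma coeff_hermite_low:
  "coeff (hermite u s 0) j = of_bool (j = 0)"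
  "coeff (hermite u s 1) j = of_bool (j = 1) - u * of_bool (j = 0)"
  "coeff (hermite u s 2) j = of_bool (j = 2) - 2 * u * of_bool (j = 1) + (u\<^sup>2 - s) * of_bool (j = 0)"
  "coeff (hermite u s 3) j = of_bool (j = 3) - 3 * u * of_bool (j = 2) +
     3 * (u\<^sup>2 - s) * of_bool (j = 1) + (3 * u * s - u ^ 3) * of_bool (j = 0)"
proof -
  have h0: "hermite u s 0 = 1" by (simp add: hermite_def)
  have h1: "hermite u s 1 = [:- u, 1:]" using hermite_Suc[of u s 0] by (simp add: h0)
  have h2: "hermite u s 2 = [:u\<^sup>2 - s, - 2 * u, 1:]"
    using hermite_Suc[of u s 1] by (simp add: h0 h1[simplified] numeral_2_eq_2 power2_eq_square)
  have h3: "hermite u s 3 = [:3 * u * s - u ^ 3, 3 * (u\<^sup>2 - s), - 3 * u, 1:]"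
  proof -
    have "hermite u s 3 = [:- u, 1:] * hermite u s 2 - smult (s * 2) (hermite u s 1)"
      using hermite_Suc[of u s 2] by (simp add: numeral_3_eq_3 numeral_2_eq_2)
    then show ?thesis
      unfolding h1 h2 by (simp add: power2_eq_square power3_eq_cube algebra_simps)
  qed
  show "coeff (hermite u s 0) j = of_bool (j = 0)" by (simp add: h0)
  show "coeff (hermite u s 1) j = of_bool (j = 1) - u * of_bool (j = 0)"
    unfolding h1 by (auto simp: coeff_pCons split: nat.split)
  show "coeff (hermite u s 2) j = of_bool (j = 2) - 2 * u * of_bool (j = 1) + (u\<^sup>2 - s) * of_bool (j = 0)"
    unfolding h2 by (auto simp: coeff_pCons numeral_2_eq_2 split: nat.split)
  show "coeff (hermite u s 3) j = of_bool (j = 3) - 3 * u * of_bool (j = 2) +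
     3 * (u\<^sup>2 - s) * of_bool (j = 1) + (3 * u * s - u ^ 3) * of_bool (j = 0)"
    unfolding h3 by (auto simp: coeff_pCons numeral_3_eq_3 numeral_2_eq_2 split: nat.split)
qed

text \<open>To first order, a perturbation of \<open>M\<close> changes \<open>\<rho>\<close>, \<open>U\<close>, \<open>\<theta>\<close> and \<open>q\<close> by its Hermite moments of order 0
to 3, divided by \<open>1\<close>, \<open>\<rho>\<close>, \<open>\<rho>\<close> and \<open>2\<close>; \<open>D k\<close> is the weight of \<open>M\<^sub>j\<close> in the moment of order \<open>k\<close>.\<close>

lemma macroscopic_derivatives:
  fixes M :: "real vec" and j :: nat
  assumes "mass_density M \<noteq> 0" "dim_vec M > 3" "j < dim_vec M"
  defines "D \<equiv> \<lambda>k. coeff (hermite (velocity M) (temperature M) k) j"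
  shows "((\<lambda>t. mass_density (M |\<^sub>v j \<mapsto> t)) has_real_derivative D 0) (at (M $ j))"
    and "((\<lambda>t. velocity (M |\<^sub>v j \<mapsto> t)) has_real_derivative D 1 / mass_density M) (at (M $ j))"
    and "((\<lambda>t. temperature (M |\<^sub>v j \<mapsto> t)) has_real_derivative D 2 / mass_density M) (at (M $ j))"
    and "((\<lambda>t. heat_flux (M |\<^sub>v j \<mapsto> t)) has_real_derivative D 3 / 2) (at (M $ j))"
proof -
  define e :: "nat \<Rightarrow> real" where "e = (\<lambda>k. of_bool (j = k))"
  define \<rho> u s where "\<rho> = mass_density M" and "u = velocity M" and "s = temperature M"
  have "\<rho> \<noteq> 0" using assms by (simp add: \<rho>_def)
  have same: "M |\<^sub>v j \<mapsto> (M $ j) = M" by (intro eq_vecI) (auto simp: update_vec_def)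
  have coord: "((\<lambda>t. (M |\<^sub>v j \<mapsto> t) $ k) has_real_derivative e k) (at (M $ j))" if "k \<le> 3" for k
    using that assms(2) by (cases "j = k") (auto simp: update_vec_def e_def)
  show d0: "((\<lambda>t. mass_density (M |\<^sub>v j \<mapsto> t)) has_real_derivative D 0) (at (M $ j))"
    using coord[of 0] by (simp add: mass_density_def D_def coeff_hermite_low e_def)
  have D: "D 0 = e 0" "D 1 = e 1 - u * e 0" "D 2 = e 2 - 2 * u * e 1 + (u\<^sup>2 - s) * e 0"
    "D 3 = e 3 - 3 * u * e 2 + 3 * (u\<^sup>2 - s) * e 1 + (3 * u * s - u ^ 3) * e 0"
    by (simp_all only: D_def coeff_hermite_low e_def u_def s_def)
  have M1: "M $ 1 = \<rho> * u" and M2: "M $ 2 = \<rho> * (s + u\<^sup>2)"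
    using \<open>\<rho> \<noteq> 0\<close> by (simp_all add: u_def s_def \<rho>_def velocity_def temperature_def)
  have "((\<lambda>t. velocity (M |\<^sub>v j \<mapsto> t)) has_real_derivative
      (e 1 * mass_density (M |\<^sub>v j \<mapsto> (M $ j)) - (M |\<^sub>v j \<mapsto> (M $ j)) $ 1 * D 0) /
      (mass_density (M |\<^sub>v j \<mapsto> (M $ j)) * mass_density (M |\<^sub>v j \<mapsto> (M $ j)))) (at (M $ j))"
    unfolding velocity_def by (intro DERIV_divide coord d0) (use assms(1) same in auto)
  moreover have "(e 1 * \<rho> - \<rho> * u * D 0) / (\<rho> * \<rho>) = D 1 / \<rho>"
    using \<open>\<rho> \<noteq> 0\<close> by (simp add: D(1,2) field_simps del: One_nat_def)
  ultimately show d1: "((\<lambda>t. velocity (M |\<^sub>v j \<mapsto> t)) has_real_derivative D 1 / mass_density M) (at (M $ j))"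
    by (simp add: same M1[simplified] flip: \<rho>_def)
  have sq: "((\<lambda>t. (velocity (M |\<^sub>v j \<mapsto> t))\<^sup>2) has_real_derivative 2 * (D 1 / \<rho> * u)) (at (M $ j))"
    by (rule DERIV_cong[OF DERIV_power[OF d1]]) (simp add: same u_def \<rho>_def)
  have "((\<lambda>t. temperature (M |\<^sub>v j \<mapsto> t)) has_real_derivative
      (e 2 * mass_density (M |\<^sub>v j \<mapsto> (M $ j)) - (M |\<^sub>v j \<mapsto> (M $ j)) $ 2 * D 0) /
      (mass_density (M |\<^sub>v j \<mapsto> (M $ j)) * mass_density (M |\<^sub>v j \<mapsto> (M $ j)))
      - 2 * (D 1 / \<rho> * u)) (at (M $ j))"
    unfolding temperature_def by (intro DERIV_divide DERIV_diff coord d0 sq) (use assms(1) same in auto)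
  moreover have "(e 2 * \<rho> - \<rho> * (s + u\<^sup>2) * D 0) / (\<rho> * \<rho>) - 2 * (D 1 / \<rho> * u) = D 2 / \<rho>"
    using \<open>\<rho> \<noteq> 0\<close> by (simp add: D field_simps power2_eq_square del: One_nat_def)
  ultimately show d2: "((\<lambda>t. temperature (M |\<^sub>v j \<mapsto> t)) has_real_derivative D 2 / mass_density M) (at (M $ j))"
    by (simp add: same M2 flip: \<rho>_def u_def)
  have "((\<lambda>t. heat_flux (M |\<^sub>v j \<mapsto> t)) has_real_derivative
      (e 3 - (\<rho> * (3 * (D 1 / \<rho> * u\<^sup>2) + 3 * (u * (D 2 / \<rho>) + D 1 / \<rho> * s)) +
        D 0 * (u ^ 3 + 3 * u * s))) / 2) (at (M $ j))"
    unfolding heat_flux_def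
    by (rule derivative_eq_intros coord d0 d1 d2 refl | simp add: same flip: \<rho>_def u_def s_def)+
      (simp add: algebra_simps)
  moreover have "(e 3 - (\<rho> * (3 * (D 1 / \<rho> * u\<^sup>2) + 3 * (u * (D 2 / \<rho>) + D 1 / \<rho> * s)) +
        D 0 * (u ^ 3 + 3 * u * s))) / 2 = D 3 / 2"
    using \<open>\<rho> \<noteq> 0\<close> by (simp add: D field_simps power2_eq_square power3_eq_cube del: One_nat_def)
  ultimately show "((\<lambda>t. heat_flux (M |\<^sub>v j \<mapsto> t)) has_real_derivative D 3 / 2) (at (M $ j))"
    by (rule DERIV_cong)
qed

text \<open>At an equilibrium the linearised Shakhov density is the projection of the perturbation to the Hermite
modes 0, 1, 2, plus \<open>1 - Pr\<close> times its projection to mode 3. The functional \<open>h r / r!\<close> is the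
contribution of mode \<open>r\<close> to the moment of order \<open>i\<close>.\<close>

lemma shakhov_source_derivative:
  fixes M :: "real vec"
  assumes "mass_density M > 0" "temperature M > 0" "heat_flux M = 0" "dim_vec M = 2 * N + 1" "N \<ge> 2"
    and "i < 2 * N + 1" "j < 2 * N + 1"
  defines "D \<equiv> \<lambda>k. coeff (hermite (velocity M) (temperature M) k) j"
    and "h \<equiv> \<lambda>r. poly (heat (temperature M) ((pderiv ^^ r) (monom 1 i))) (velocity M)"
  shows "((\<lambda>t. Shakhov_source N Pr (M |\<^sub>v j \<mapsto> t) $ i) has_real_derivative
     (D 0 * h 0 + D 1 * h 1 + D 2 * h 2 / 2 + (1 - Pr) * D 3 * h 3 / 6 - of_bool (i = j))) (at (M $ j))"
proof -
  define \<rho> u s where "\<rho> = mass_density M" and "u = velocity M" and "s = temperature M"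
  define X where "X = (\<lambda>t. M |\<^sub>v j \<mapsto> t)"
  have same: "X (M $ j) = M" by (intro eq_vecI) (auto simp: update_vec_def X_def)
  have d: "((\<lambda>t. mass_density (X t)) has_real_derivative D 0) (at (M $ j))"
    "((\<lambda>t. velocity (X t)) has_real_derivative D 1 / \<rho>) (at (M $ j))"
    "((\<lambda>t. temperature (X t)) has_real_derivative D 2 / \<rho>) (at (M $ j))"
    "((\<lambda>t. heat_flux (X t)) has_real_derivative D 3 / 2) (at (M $ j))"
    unfolding D_def \<rho>_def X_def by (rule macroscopic_derivatives; use assms in simp)+
  \<comment> \<open>The closed form of the source requires \<open>\<rho> \<noteq> 0\<close> and \<open>\<theta> > 0\<close>, which persist near \<open>M\<close>.\<close>
  have "eventually (\<lambda>t. mass_density (X t) > 0) (nhds (M $ j))"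
    using DERIV_isCont[OF d(1)] assms(1) same
    by (intro order_tendstoD(1)[of "\<lambda>t. mass_density (X t)" "mass_density M"])
      (auto simp: isCont_def tendsto_nhds_iff)
  moreover have "eventually (\<lambda>t. temperature (X t) > 0) (nhds (M $ j))"
    using DERIV_isCont[OF d(3)] assms(2) same
    by (intro order_tendstoD(1)[of "\<lambda>t. temperature (X t)" "temperature M"])
      (auto simp: isCont_def tendsto_nhds_iff)
  ultimately have ev: "eventually (\<lambda>t. Shakhov_source N Pr (X t) $ i =
      shakhov_mean Pr (X t) (monom 1 i) - (if i = j then t else M $ i)) (nhds (M $ j))"
  proof eventually_elim
    case (elim t)
    have "X t $ i = (if i = j then t else M $ i)"
      using assms(4,6) by (simp add: X_def update_vec_def)
    moreover have "dim_vec (X t) = 2 * N + 1" using assms(4) by (simp add: X_def)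
    ultimately show ?case using Shakhov_source_index[of "X t" N i Pr] elim assms(6) by simp
  qed
  have "((\<lambda>t. shakhov_mean Pr (X t) (monom 1 i)) has_real_derivative
      D 0 * h 0 + D 1 * h 1 + D 2 * h 2 / 2 + (1 - Pr) * D 3 * h 3 / 6) (at (M $ j))"
    unfolding shakhov_mean_def
  proof (rule DERIV_cong[OF DERIV_add[OF DERIV_mult'[OF d(1) DERIV_poly_heat[OF d(3,2)]]
          DERIV_mult'[OF DERIV_cdivide[OF DERIV_cmult[OF d(4)]] DERIV_poly_heat[OF d(3,2)]]]])
    show "mass_density (X (M $ j)) *
      (poly (heat (temperature (X (M $ j))) (pderiv (monom 1 i))) (velocity (X (M $ j))) * (D 1 / \<rho>) +
       poly (heat (temperature (X (M $ j))) (pderiv (pderiv (monom 1 i)))) (velocity (X (M $ j))) / 2 * (D 2 / \<rho>)) +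
      D 0 * poly (heat (temperature (X (M $ j))) (monom 1 i)) (velocity (X (M $ j))) +
      ((1 - Pr) * heat_flux (X (M $ j)) / 3 *
       (poly (heat (temperature (X (M $ j))) (pderiv ((pderiv ^^ 3) (monom 1 i)))) (velocity (X (M $ j))) * (D 1 / \<rho>) +
        poly (heat (temperature (X (M $ j))) (pderiv (pderiv ((pderiv ^^ 3) (monom 1 i))))) (velocity (X (M $ j))) / 2 * (D 2 / \<rho>)) +
       (1 - Pr) * (D 3 / 2) / 3 *
       poly (heat (temperature (X (M $ j))) ((pderiv ^^ 3) (monom 1 i))) (velocity (X (M $ j)))) =
      D 0 * h 0 + D 1 * h 1 + D 2 * h 2 / 2 + (1 - Pr) * D 3 * h 3 / 6"
    proof -
      have "(pderiv ^^ 2) p = pderiv (pderiv p)" for p :: "real poly"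
        by (simp add: numeral_2_eq_2)
      then show ?thesis
        using assms(1) unfolding same assms(3) h_def \<rho>_def[symmetric]
        by (simp add: field_simps \<rho>_def del: funpow.simps(2)) (simp add: field_simps)
    qed
  qed
  moreover have "((\<lambda>t. if i = j then t else M $ i) has_real_derivative of_bool (i = j)) (at (M $ j))"
    by (cases "i = j") auto
  ultimately have "((\<lambda>t. shakhov_mean Pr (X t) (monom 1 i) - (if i = j then t else M $ i)) has_real_derivative
     (D 0 * h 0 + D 1 * h 1 + D 2 * h 2 / 2 + (1 - Pr) * D 3 * h 3 / 6 - of_bool (i = j))) (at (M $ j))"
    by (rule DERIV_diff)
  then show ?thesis using DERIV_cong_ev[OF refl ev refl] by (simp add: X_def)
qed

text \<open>Mass, momentum and energy are conserved, the heat flux relaxes at rate \<open>\<nu> Pr\<close>, and all higher Hermite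
modes at rate \<open>\<nu>\<close>.\<close>

definition relaxation_rate :: "real \<Rightarrow> real \<Rightarrow> nat \<Rightarrow> real" where
  "relaxation_rate \<nu> Pr k = \<nu> * (if k < 3 then 0 else if k = 3 then Pr else 1)"

text \<open>Taking Hermite combinations of the rows isolates the modes, because \<open>h r\<close> maps \<open>H\<^sub>k\<close> to \<open>k!\<close> if
\<open>r = k\<close> and to 0 otherwise.\<close>

lemma hermite_mat_mult_jacobian:
  fixes M :: "real vec"
  assumes "mass_density M > 0" "temperature M > 0" "heat_flux M = 0" "dim_vec M = 2 * N + 1" "N \<ge> 2"
  shows "hermite_mat (2 * N + 1) (velocity M) (temperature M) *
      jacobian (2 * N + 1) (\<lambda>M. \<nu> \<cdot>\<^sub>v Shakhov_source N Pr M) M =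
    real_diag (2 * N + 1) (\<lambda>k. - relaxation_rate \<nu> Pr k) *
      hermite_mat (2 * N + 1) (velocity M) (temperature M)"
proof -
  define n u s where "n = 2 * N + 1" and "u = velocity M" and "s = temperature M"
  define H where "H = hermite u s"
  define J where "J = jacobian n (\<lambda>M. \<nu> \<cdot>\<^sub>v Shakhov_source N Pr M) M"
  define h where "h = (\<lambda>r p. poly (heat s ((pderiv ^^ r) p)) u)"
  have h_lin: "h r p = (\<Sum>i<n. coeff p i * h r (monom 1 i))" if "degree p < n" for r p
  proof -
    have sum: "(pderiv ^^ r) (\<Sum>i\<in>A. f i :: real poly) = (\<Sum>i\<in>A. (pderiv ^^ r) (f i))" for A :: "nat set" and f
    proof (induction A rule: infinite_finite_induct)
      case (insert a A)
      then show ?case by (simp add: higher_pderiv_add)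
    next
      case empty
      show ?case by (induction r) (auto simp: funpow_swap1)
    next
      case (infinite A)
      then show ?case by (induction r) (auto simp: funpow_swap1)
    qed
    show ?thesis
      by (subst poly_as_smult_monoms[OF that])
        (simp only: h_def sum higher_pderiv_smult heat_sum heat_smult poly_sum poly_smult)
  qed
  have lin: "(\<Sum>i<n. d * c i * (\<nu> * (A0 * a0 i + A1 * a1 i + A2 * a2 i / 2 + A3 * a3 i / 6 - \<delta> i))) =
      d * \<nu> * (A0 * (\<Sum>i<n. c i * a0 i) + A1 * (\<Sum>i<n. c i * a1 i) + A2 * (\<Sum>i<n. c i * a2 i) / 2 +
        A3 * (\<Sum>i<n. c i * a3 i) / 6 - (\<Sum>i<n. c i * \<delta> i))"
    for c a0 a1 a2 a3 \<delta> :: "nat \<Rightarrow> real" and d A0 A1 A2 A3 :: real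
    by (simp add: sum_distrib_left sum_divide_distrib sum.distrib sum_subtractf algebra_simps)
  have hH: "h r (H k) = (if r = k then fact k else 0)" for r k
  proof -
    have "heat s ((pderiv ^^ r) p) = (pderiv ^^ r) (heat s p)" for p
      by (induction r) (simp_all add: heat_pderiv)
    then show ?thesis by (simp add: h_def H_def pderiv_linear_power_at)
  qed
  have J: "J $$ (i, j) = \<nu> * (coeff (H 0) j * h 0 (monom 1 i) + coeff (H 1) j * h 1 (monom 1 i) +
      coeff (H 2) j * h 2 (monom 1 i) / 2 + (1 - Pr) * coeff (H 3) j * h 3 (monom 1 i) / 6 - of_bool (i = j))"
    if "i < n" "j < n" for i j
  proof -
    have "((\<lambda>t. \<nu> * Shakhov_source N Pr (M |\<^sub>v j \<mapsto> t) $ i) has_real_derivative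
       \<nu> * (coeff (H 0) j * h 0 (monom 1 i) + coeff (H 1) j * h 1 (monom 1 i) +
      coeff (H 2) j * h 2 (monom 1 i) / 2 + (1 - Pr) * coeff (H 3) j * h 3 (monom 1 i) / 6 - of_bool (i = j)))
      (at (M $ j))"
      unfolding H_def h_def u_def s_def
      by (intro DERIV_cmult shakhov_source_derivative) (use assms that in \<open>simp_all add: n_def\<close>)
    moreover have "(\<nu> \<cdot>\<^sub>v Shakhov_source N Pr (M |\<^sub>v j \<mapsto> t)) $ i = \<nu> * Shakhov_source N Pr (M |\<^sub>v j \<mapsto> t) $ i" for t
      using that assms(4) by (simp add: n_def)
    ultimately show ?thesis using that by (simp add: J_def jacobian_def DERIV_imp_deriv)
  qed
  have "hermite_mat n u s * J = real_diag n (\<lambda>k. - relaxation_rate \<nu> Pr k) * hermite_mat n u s"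
  proof (rule eq_matI)
    fix k j assume kj: "k < dim_row (real_diag n (\<lambda>k. - relaxation_rate \<nu> Pr k) * hermite_mat n u s)"
      "j < dim_col (real_diag n (\<lambda>k. - relaxation_rate \<nu> Pr k) * hermite_mat n u s)"
    then have k: "k < n" and j: "j < n" by (auto simp: hermite_mat_def coeff_rows_def real_diag_def)
    define d where "d = 1 / sqrt (fact k * s ^ k)"
    have entry: "hermite_mat n u s $$ (k, i) = d * coeff (H k) i" if "i < n" for i
      using k that by (simp add: hermite_mat_def coeff_rows_def hermite_orthonormal_def H_def d_def)
    have deg: "degree (H k) < n" using k by (simp add: H_def)
    have "(hermite_mat n u s * J) $$ (k, j) = (\<Sum>i<n. d * coeff (H k) i * J $$ (i, j))"
      using k j entry by (subst index_mult_square_mat[of _ n]) (auto simp: J_def jacobian_def)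
    also have "\<dots> = (\<Sum>i<n. d * coeff (H k) i * (\<nu> * (coeff (H 0) j * h 0 (monom 1 i) + coeff (H 1) j * h 1 (monom 1 i) +
      coeff (H 2) j * h 2 (monom 1 i) / 2 + (1 - Pr) * coeff (H 3) j * h 3 (monom 1 i) / 6 - of_bool (i = j))))"
      using J j by (intro sum.cong) auto
    also have "\<dots> = d * \<nu> * (coeff (H 0) j * (\<Sum>i<n. coeff (H k) i * h 0 (monom 1 i)) +
        coeff (H 1) j * (\<Sum>i<n. coeff (H k) i * h 1 (monom 1 i)) +
        coeff (H 2) j * (\<Sum>i<n. coeff (H k) i * h 2 (monom 1 i)) / 2 +
        (1 - Pr) * coeff (H 3) j * (\<Sum>i<n. coeff (H k) i * h 3 (monom 1 i)) / 6 -
        (\<Sum>i<n. coeff (H k) i * of_bool (i = j)))"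
      by (rule lin)
    also have "(\<Sum>i<n. coeff (H k) i * of_bool (i = j)) = coeff (H k) j"
      using j by (simp add: of_bool_def if_distrib[of "\<lambda>c. _ * c"] sum.delta cong: if_cong)
    finally have "(hermite_mat n u s * J) $$ (k, j) = d * \<nu> * (coeff (H 0) j * h 0 (H k) +
        coeff (H 1) j * h 1 (H k) + coeff (H 2) j * h 2 (H k) / 2 +
        (1 - Pr) * coeff (H 3) j * h 3 (H k) / 6 - coeff (H k) j)"
      by (simp only: h_lin[OF deg, symmetric])
    also have "\<dots> = - relaxation_rate \<nu> Pr k * (d * coeff (H k) j)"
    proof -
      consider "k = 0" | "k = 1" | "k = 2" | "k = 3" | "k > 3" by linarith
      then show ?thesis
        by cases (simp_all add: hH relaxation_rate_def fact_numeral field_simps)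
    qed
    also have "\<dots> = (real_diag n (\<lambda>k. - relaxation_rate \<nu> Pr k) * hermite_mat n u s) $$ (k, j)"
      using k j entry[OF j] by (simp add: real_diag_mult_index[OF hermite_mat_carrier])
    finally show "(hermite_mat n u s * J) $$ (k, j) =
      (real_diag n (\<lambda>k. - relaxation_rate \<nu> Pr k) * hermite_mat n u s) $$ (k, j)" .
  qed (auto simp: J_def jacobian_def real_diag_def hermite_mat_def coeff_rows_def)
  then show ?thesis by (simp add: n_def u_def s_def J_def)
qed

section \<open>The structural stability condition\<close>

lemma coeff_matrix_eq_companion:
  assumes "\<And>j. j < 2 * N + 1 \<Longrightarrow> closure_coeff N M j = - coeff c j"
  shows "coeff_matrix N M = companion_mat (2 * N + 1) c"
  using assms by (intro eq_matI) (auto simp: coeff_matrix_def companion_mat_def)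

text \<open>The coefficient matrix is the companion matrix of the critical polynomial, which is the backward heat
flow of a polynomial whose roots are the doubled nodes and one further real number.\<close>

lemma open_symmetrizer:
  assumes "M \<in> moment_map N ` Omega_open N" "N > 0"
  obtains A0 where "positive_definite (2 * N + 1) A0"
    "A0 * coeff_matrix N M = (coeff_matrix N M)\<^sup>T * A0"
proof -
  obtain W where W: "W \<in> Omega_open N" and M: "M = moment_map N W" using assms(1) by blast
  define x where "x = vec_index W"
  have x: "x \<in> eqmom_domain N" using W by (simp add: Omega_open_iff x_def)
  obtain v where v: "\<And>i. i < 2 * N + 1 \<Longrightarrow>
      mixture_partial N (heat (- x (2 * N)) ((nodal_poly N x)\<^sup>2 * [:- v, 1:])) i x = 0"
    using exists_critical_poly[OF x assms(2)] by blast
  define a where "a = (\<lambda>i. if i < 2 * N then x (2 * (i div 2) + 1) else v)"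
  define c where "c = heat (- x (2 * N)) (root_poly (2 * N + 1) a)"
  have "root_poly (2 * N) (\<lambda>i. x (2 * (i div 2) + 1)) = root_poly (2 * N) a"
    unfolding root_poly_def by (intro prod.cong) (auto simp: a_def)
  then have "root_poly (2 * N + 1) a = (nodal_poly N x)\<^sup>2 * [:- v, 1:]"
    using root_poly_Suc[of "2 * N" a]
    by (simp add: root_poly_square a_def mult.commute del: mult_pCons_left mult_pCons_right)
  then have crit: "mixture_partial N c i x = 0" if "i < 2 * N + 1" for i
    using v[OF that] by (simp only: c_def)
  have "degree c = 2 * N + 1" by (simp add: c_def)
  moreover have "lead_coeff c = 1" unfolding c_def lead_coeff_heat by (rule monic_root_poly)
  ultimately have "closure_coeff N M j = - coeff c j" if "j < 2 * N + 1" for j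
    unfolding M using W assms(2) that crit by (intro closure_coeff_eq) (auto simp: x_def)
  then have "coeff_matrix N M = companion_mat (2 * N + 1) c" by (rule coeff_matrix_eq_companion)
  moreover have "real_simple_roots (2 * N + 1) c"
    unfolding c_def using x by (intro real_simple_roots_heat_root_poly) (simp add: eqmom_domain_def)
  ultimately show ?thesis using companion_symmetrizer[of "2 * N + 1" c] that by auto
qed

lemma coeff_matrix_equilibrium:
  assumes "M \<notin> moment_map N ` Omega_open N"
  shows "coeff_matrix N M =
    companion_mat (2 * N + 1) (hermite (velocity M) (temperature M) (2 * N + 1))"
  using assms by (intro coeff_matrix_eq_companion)
    (simp add: closure_coeff_def equilibrium_poly_eq_hermite)

lemma lower_block_real_diag:
  assumes "r \<le> n"
  shows "lower_block n r (real_diag r d) = real_diag n (\<lambda>k. if k < n - r then 0 else d (k - (n - r)))"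
  using assms unfolding lower_block_def
  by (intro eq_matI) (auto simp: real_diag_def)

lemma one_mat_real_diag: "1\<^sub>m n = real_diag n (\<lambda>_. 1)"
  by (intro eq_matI) (auto simp: real_diag_def)

lemma invertible_real_diag:
  assumes "\<And>k. k < n \<Longrightarrow> d k \<noteq> 0"
  shows "invertible_mat (real_diag n d)"
proof (rule invertible_mat_if_inverse)
  show "real_diag n d * real_diag n (\<lambda>k. 1 / d k) = 1\<^sub>m n" "real_diag n (\<lambda>k. 1 / d k) * real_diag n d = 1\<^sub>m n"
    using assms by (auto intro!: eq_matI simp: real_diag_mult_index simp del: index_mult_mat(1))
      (auto simp: real_diag_def)
qed auto

theorem theorem4p14:
  fixes N :: nat and \<nu> Pr :: real
  assumes "N \<ge> 2" and "\<nu> > 0" and "Pr > 0"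
  shows "structural_stability_condition (2 * N + 1) (moment_map N ` Omega N)
           (coeff_matrix N) (\<lambda>M. \<nu> \<cdot>\<^sub>v Shakhov_source N Pr M)"
proof -
  define n where "n = 2 * N + 1"
  define r where "r = 2 * N - 2"
  have r: "0 < r" "r \<le> n" "n - r = 3" using \<open>N \<ge> 2\<close> by (auto simp: n_def r_def)
  define G where "G = moment_map N ` Omega N"
  define Q where "Q = (\<lambda>M. \<nu> \<cdot>\<^sub>v Shakhov_source N Pr M)"
  define P where "P = (\<lambda>M. hermite_mat n (velocity M) (temperature M))"
  define rate where "rate = relaxation_rate \<nu> Pr"
  define T where "T = (\<lambda>M :: real vec. real_diag r (\<lambda>k. - rate (k + 3)))"
  \<comment> \<open>Twice \<open>\<kappa>\<close> times the smallest nonzero relaxation rate is 1.\<close>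
  define \<kappa> where "\<kappa> = 1 / (2 * \<nu> * min Pr 1)"
  have "\<kappa> > 0" using assms by (simp add: \<kappa>_def)
  define hermite_symmetrizer where
    "hermite_symmetrizer = (\<lambda>M. (P M)\<^sup>T * real_diag n (\<lambda>_. \<kappa>) * P M)"
  define is_symmetrizer where "is_symmetrizer = (\<lambda>M A0. positive_definite n A0 \<and>
    A0 * coeff_matrix N M = (coeff_matrix N M)\<^sup>T * A0)"
  \<comment> \<open>The condition relates \<open>A\<^sub>0\<close> to the source only at equilibria, so elsewhere any symmetrizer will do.\<close>
  define A0 where "A0 = (\<lambda>M. if M \<in> moment_map N ` Omega_open N
    then SOME A. is_symmetrizer M A else hermite_symmetrizer M)"
  have P: "P M \<in> carrier_mat n n" for M by (simp add: P_def)
  have pos: "mass_density M > 0" "temperature M > 0" "dim_vec M = n" if "M \<in> G" for M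
    using macroscopic_positivity[OF \<open>N \<ge> 2\<close>] that by (auto simp: G_def n_def)
  have invP: "invertible_mat (P M)" if "M \<in> G" for M
    unfolding P_def by (rule invertible_hermite_mat) (rule pos(2)[OF that])
  have symm: "is_symmetrizer M (A0 M)" if "M \<in> G" for M
  proof (cases "M \<in> moment_map N ` Omega_open N")
    case True
    then obtain A where "is_symmetrizer M A"
      using open_symmetrizer[of M N] \<open>N \<ge> 2\<close> by (auto simp: is_symmetrizer_def n_def)
    then show ?thesis using True by (simp add: A0_def someI[of "is_symmetrizer M"])
  next
    case False
    have "P M * coeff_matrix N M = jacobi_mat n (velocity M) (temperature M) * P M"
      unfolding coeff_matrix_equilibrium[OF False] P_def n_def
      by (rule hermite_mat_mult_companion) (use pos(2)[OF that] in auto)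
    then have "is_symmetrizer M (hermite_symmetrizer M)"
      unfolding is_symmetrizer_def hermite_symmetrizer_def
      using P invP[OF that] \<open>\<kappa> > 0\<close>
      by (intro conjI positive_definite_congruence symmetrizer_congruence[where S = "jacobi_mat n (velocity M) (temperature M)"])
        (auto simp: coeff_matrix_def n_def)
    then show ?thesis using False by (simp add: A0_def)
  qed
  have block: "lower_block n r (T M) = real_diag n (\<lambda>k. - rate k)" for M
    unfolding T_def lower_block_real_diag[OF r(2)] r(3)
    by (intro eq_matI) (auto simp: real_diag_def rate_def relaxation_rate_def)
  have conj: "P M * jacobian n Q M = real_diag n (\<lambda>k. - rate k) * P M"
    and A0_eq: "A0 M = hermite_symmetrizer M" and MG: "M \<in> G"
    if M: "M \<in> equilibria n G Q" for M
  proof -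
    show MG: "M \<in> G" using M by (simp add: equilibria_def)
    have "heat_flux M = 0" and eq: "M \<in> moment_map N ` Omega_eq N"
      using equilibria_gaussian[OF assms] M by (auto simp: n_def G_def Q_def)
    with pos[OF MG] \<open>N \<ge> 2\<close> show "P M * jacobian n Q M = real_diag n (\<lambda>k. - rate k) * P M"
      unfolding P_def n_def Q_def rate_def by (intro hermite_mat_mult_jacobian) auto
    show "A0 M = hermite_symmetrizer M"
      using eq Omega_images_disjoint[OF \<open>N \<ge> 2\<close>] by (auto simp: A0_def)
  qed
  have dissipative: "symmetric_le n (A0 M * jacobian n Q M + (jacobian n Q M)\<^sup>T * A0 M)
      (- ((P M)\<^sup>T * lower_block n r (1\<^sub>m r) * P M))" if M: "M \<in> equilibria n G Q" for M
  proof -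
    have one: "lower_block n r (1\<^sub>m r) = real_diag n (\<lambda>k. if k < 3 then 0 else 1)"
      by (simp add: one_mat_real_diag lower_block_real_diag[OF r(2)] r(3))
    have "2 * \<kappa> * (\<nu> * Pr) \<ge> 1" "2 * \<kappa> * \<nu> \<ge> 1"
      using assms by (auto simp: \<kappa>_def field_simps min_def)
    then have "(if k < 3 then 0 else 1) \<le> 2 * \<kappa> * rate k" for k
      by (simp add: rate_def relaxation_rate_def)
    then show ?thesis
      unfolding A0_eq[OF M] hermite_symmetrizer_def one using P[of M] conj[OF M]
      by (intro congruence_dissipation[where l = rate]) (auto simp: jacobian_def)
  qed
  have "invertible_mat (T M)" for M
    unfolding T_def using assms by (intro invertible_real_diag) (auto simp: rate_def relaxation_rate_def)
  then have "\<forall>M\<in>equilibria n G Q. P M \<in> carrier_mat n n \<and> invertible_mat (P M) \<and>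
      T M \<in> carrier_mat r r \<and> invertible_mat (T M) \<and>
      P M * jacobian n Q M = lower_block n r (T M) * P M"
    using P invP MG conj by (auto simp: block) (auto simp: T_def)
  moreover have "\<forall>M\<in>G. positive_definite n (A0 M) \<and> A0 M * coeff_matrix N M = (coeff_matrix N M)\<^sup>T * A0 M"
    using symm by (auto simp: is_symmetrizer_def)
  moreover have "equilibria n G Q \<noteq> {}"
    using equilibria_nonempty[OF \<open>N \<ge> 2\<close>] by (simp add: n_def G_def Q_def)
  ultimately have "structural_stability_condition n G (coeff_matrix N) Q"
    unfolding structural_stability_condition_def using r dissipative by blast
  then show ?thesis by (simp only: n_def G_def Q_def)
qed

end
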